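(* Let $\phi$ be a finite Blaschke product of order less than or equal to $8$. Then the von Neumann algebra $\mathcal A_\phi=\{M_\phi\}'\cap\{M_\phi^*\}'$ is commutative, and hence the number of minimal reducing subspaces of $M_\phi$ equals the number of connected components of the Riemann surface $S_\phi$ of $\phi^{-1}\circ\phi$ over the unit disk.
   Context: $\mathbb D$ is the open unit disk, $dA$ is normalized area measure on $\mathbb D$, and $L^2_a$ is the Bergman space of analytic functions in $L^2(\mathbb D,dA)$. A Blaschke product of order $n$ is $\phi(z)=\prod_{j=1}^n\frac{z-a_j}{1-\overline{a}_jz}$ with $a_j\in\mathbb D$. $M_\phi h=\phi h$ on $L^2_a$. For a bounded operator $T$, $\{T\}'$ is the set of bounded operators on $L^2_a$ commuting with $T$. A reducing subspace of $T$ is a closed subspace $\mathcal M$ with $T\mathcal M\subset\mathcal M$ and $T^*\mathcal M\subset\mathcal M$; a nonzero reducing subspace $\mathcal M$ is minimal if the only reducing subspaces contained in $\mathcal M$ are $\mathcal M$ and $\{0\}$. Let $\mathcal C$ be the (finite) set of critical points of $\phi$ in $\mathbb D$, $\mathcal F=\mathbb D\cap\phi^{-1}(\phi(\mathcal C))$ and $E=\mathbb D\setminus\mathcal F$. The Riemann surface $S_\phi$ of $\phi^{-1}\circ\phi$ over $\mathbb D$ is the $n$-sheeted branched cover of $\mathbb D$ obtained by completing, over the points of the finite set $\mathcal F$, the $n$-sheeted unbranched cover $\{(w,z): z\in E,\ w\in\mathbb D,\ \phi(w)=\phi(z)\}\to E$, $(w,z)\mapsto z$. Its number of connected components is the number of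 connected components of this unbranched cover. *)

theory Defs
  imports "HOL-Analysis.Analysis"
begin

section \<open>The Bergman space\<close>

abbreviation unit_disk :: "complex set"
  where "unit_disk \<equiv> ball 0 1"

definition area :: "complex measure"
  where "area = uniform_measure lborel unit_disk"

text \<open>
  An element of the Bergman space is a function on the disk; it is represented by its extension
  by zero to the whole plane, so that equality of representatives is equality on the disk.
\<close>

typedef bergman =
  "{f :: complex \<Rightarrow> complex. f holomorphic_on unit_disk \<and> (\<forall>z. z \<notin> unit_disk \<longrightarrow> f z = 0)
     \<and> integrable area (\<lambda>z. (cmod (f z))\<^sup>2)}"
  by (rule exI[of _ "\<lambda>_. 0"]) auto

lemma sets_area [measurable_cong, simp]: "sets area = sets borel"
  by (simp add: area_def)

lemma Rep_bergman_holomorphic: "Rep_bergman f holomorphic_on unit_disk"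
  using Rep_bergman[of f] by auto

lemma Rep_bergman_outside: "z \<notin> unit_disk \<Longrightarrow> Rep_bergman f z = 0"
  using Rep_bergman[of f] by auto

lemma Rep_bergman_square_integrable: "integrable area (\<lambda>z. (cmod (Rep_bergman f z))\<^sup>2)"
  using Rep_bergman[of f] by auto

lemma holomorphic_disk_measurable:
  assumes "f holomorphic_on unit_disk" "\<And>z. z \<notin> unit_disk \<Longrightarrow> f z = 0"
  shows "f \<in> borel_measurable borel"
proof -
  have "(\<lambda>z. indicator unit_disk z *\<^sub>R f z) \<in> borel_measurable borel"
    by (intro borel_measurable_continuous_on_indicator holomorphic_on_imp_continuous_on assms) auto
  also have "(\<lambda>z. indicator unit_disk z *\<^sub>R f z) = f"
    using assms(2) by (auto simp: indicator_def fun_eq_iff)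
  finally show ?thesis .
qed

lemma Rep_bergman_measurable [measurable]: "Rep_bergman f \<in> borel_measurable borel"
  by (rule holomorphic_disk_measurable[OF Rep_bergman_holomorphic Rep_bergman_outside])

lemma bergman_memI:
  assumes "f holomorphic_on unit_disk" "\<And>z. z \<notin> unit_disk \<Longrightarrow> f z = 0"
    and "integrable area g" "\<And>z. (cmod (f z))\<^sup>2 \<le> g z"
  shows "f \<in> {f. f holomorphic_on unit_disk \<and> (\<forall>z. z \<notin> unit_disk \<longrightarrow> f z = 0)
     \<and> integrable area (\<lambda>z. (cmod (f z))\<^sup>2)}"
proof -
  have [measurable]: "f \<in> borel_measurable borel"
    by (rule holomorphic_disk_measurable[OF assms(1,2)])
  have "integrable area (\<lambda>z. (cmod (f z))\<^sup>2)"
    by (rule Bochner_Integration.integrable_bound[OF assms(3)])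
       (use assms(4) in \<open>auto intro: order_trans[OF _ abs_ge_self]\<close>)
  then show ?thesis using assms by auto
qed

lemma bergman_inner_integrable:
  "integrable area (\<lambda>z. Rep_bergman f z * cnj (Rep_bergman g z))"
proof (rule Bochner_Integration.integrable_bound)
  show "integrable area (\<lambda>z. (cmod (Rep_bergman f z))\<^sup>2 + (cmod (Rep_bergman g z))\<^sup>2)"
    by (intro Bochner_Integration.integrable_add Rep_bergman_square_integrable)
  have "a * b \<le> a\<^sup>2 + b\<^sup>2" for a b :: real
    using sum_squares_bound[of a b] zero_le_power2[of "a + b"] sum_power2_ge_zero[of a b]
    unfolding power2_sum by linarith
  then show "AE z in area. norm (Rep_bergman f z * cnj (Rep_bergman g z))
      \<le> norm ((cmod (Rep_bergman f z))\<^sup>2 + (cmod (Rep_bergman g z))\<^sup>2)"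
    by (auto simp: norm_mult)
  have [measurable]: "cnj \<in> borel_measurable borel"
    by (intro borel_measurable_continuous_onI continuous_intros)
  show "(\<lambda>z. Rep_bergman f z * cnj (Rep_bergman g z)) \<in> borel_measurable area"
    by measurable
qed

definition cinner :: "bergman \<Rightarrow> bergman \<Rightarrow> complex"
  where "cinner f g = (\<integral>z. Rep_bergman f z * cnj (Rep_bergman g z) \<partial>area)"

definition cscale :: "complex \<Rightarrow> bergman \<Rightarrow> bergman"
  where "cscale c f = Abs_bergman (\<lambda>z. c * Rep_bergman f z)"

lemma Rep_cscale: "Rep_bergman (cscale c f) = (\<lambda>z. c * Rep_bergman f z)"
  unfolding cscale_def
proof (rule Abs_bergman_inverse, rule bergman_memI)
  show "integrable area (\<lambda>z. (cmod c)\<^sup>2 * (cmod (Rep_bergman f z))\<^sup>2)"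
    by (intro integrable_mult_right Rep_bergman_square_integrable)
qed (auto intro!: holomorphic_intros Rep_bergman_holomorphic simp: norm_mult power_mult_distrib
       Rep_bergman_outside)

instantiation bergman :: real_vector
begin

definition zero_bergman :: bergman where "0 = Abs_bergman (\<lambda>z. 0)"
definition plus_bergman :: "bergman \<Rightarrow> bergman \<Rightarrow> bergman"
  where "f + g = Abs_bergman (\<lambda>z. Rep_bergman f z + Rep_bergman g z)"
definition uminus_bergman :: "bergman \<Rightarrow> bergman"
  where "- f = cscale (- 1) f"
definition minus_bergman :: "bergman \<Rightarrow> bergman \<Rightarrow> bergman"
  where "f - g = f + (- g :: bergman)"
definition scaleR_bergman :: "real \<Rightarrow> bergman \<Rightarrow> bergman"
  where "r *\<^sub>R f = cscale (of_real r) f"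

lemma Rep_zero_bergman: "Rep_bergman 0 = (\<lambda>z. 0)"
  unfolding zero_bergman_def by (rule Abs_bergman_inverse) auto

lemma Rep_plus_bergman: "Rep_bergman (f + g) = (\<lambda>z. Rep_bergman f z + Rep_bergman g z)"
  unfolding plus_bergman_def
proof (rule Abs_bergman_inverse, rule bergman_memI)
  show "integrable area (\<lambda>z. 2 * (cmod (Rep_bergman f z))\<^sup>2 + 2 * (cmod (Rep_bergman g z))\<^sup>2)"
    by (intro integrable_mult_right Bochner_Integration.integrable_add Rep_bergman_square_integrable)
  show "(cmod (Rep_bergman f z + Rep_bergman g z))\<^sup>2
      \<le> 2 * (cmod (Rep_bergman f z))\<^sup>2 + 2 * (cmod (Rep_bergman g z))\<^sup>2" for z
  proof -
    let ?a = "Rep_bergman f z" and ?b = "Rep_bergman g z"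
    have "(cmod (?a + ?b))\<^sup>2 \<le> (cmod ?a + cmod ?b)\<^sup>2"
      by (intro power_mono norm_triangle_ineq norm_ge_zero)
    also have "\<dots> \<le> 2 * (cmod ?a)\<^sup>2 + 2 * (cmod ?b)\<^sup>2"
      using sum_squares_bound[of "cmod ?a" "cmod ?b"] by (simp add: power2_sum)
    finally show ?thesis .
  qed
qed (auto intro!: holomorphic_intros Rep_bergman_holomorphic simp: Rep_bergman_outside)

lemma Rep_uminus_bergman: "Rep_bergman (- f) = (\<lambda>z. - Rep_bergman f z)"
  by (simp add: uminus_bergman_def Rep_cscale)

lemma Rep_minus_bergman: "Rep_bergman (f - g) = (\<lambda>z. Rep_bergman f z - Rep_bergman g z)"
  by (simp add: minus_bergman_def Rep_plus_bergman Rep_uminus_bergman)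

lemma Rep_scaleR_bergman: "Rep_bergman (r *\<^sub>R f) = (\<lambda>z. r *\<^sub>R Rep_bergman f z)"
  by (simp add: scaleR_bergman_def Rep_cscale scaleR_conv_of_real)

lemmas Rep_bergman_simps = Rep_zero_bergman Rep_plus_bergman Rep_uminus_bergman Rep_minus_bergman
  Rep_scaleR_bergman Rep_cscale

instance
  by standard
     (auto simp: Rep_bergman_inject[symmetric] Rep_bergman_simps fun_eq_iff algebra_simps)

end

lemma cinner_add_left: "cinner (f + g) h = cinner f h + cinner g h"
  by (simp add: cinner_def Rep_bergman_simps distrib_right bergman_inner_integrable)

lemma cinner_cscale_left: "cinner (cscale c f) h = c * cinner f h"
  by (simp add: cinner_def Rep_bergman_simps mult.assoc)

lemma cinner_commute: "cinner f g = cnj (cinner g f)"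
  unfolding cinner_def
  by (subst Bochner_Integration.integral_cnj[symmetric]) (simp add: mult.commute)

lemma cinner_self: "cinner f f = of_real (\<integral>z. (cmod (Rep_bergman f z))\<^sup>2 \<partial>area)"
  unfolding cinner_def complex_norm_square[symmetric]
  by (metis (no_types) integral_complex_of_real of_real_power)

lemma cinner_self_eq_0:
  assumes "cinner f f = 0"
  shows "f = 0"
proof -
  have "(\<integral>z. (cmod (Rep_bergman f z))\<^sup>2 \<partial>area) = 0"
    using assms by (simp add: cinner_self)
  then have "AE z in area. (cmod (Rep_bergman f z))\<^sup>2 = 0"
    by (subst integral_nonneg_eq_0_iff_AE[symmetric])
       (auto simp: Rep_bergman_square_integrable)
  moreover have "emeasure lborel unit_disk \<noteq> 0"
  proof
    assume "emeasure lborel unit_disk = 0"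
    then have "negligible unit_disk"
      by (simp add: negligible_iff_null_sets null_sets_completionI null_setsI)
    then show False
      using open_not_negligible[of unit_disk] by simp
  qed
  moreover have "emeasure lborel unit_disk < \<infinity>"
    by (rule emeasure_lborel_ball_finite)
  ultimately have "AE z in lborel. z \<in> unit_disk \<longrightarrow> Rep_bergman f z = 0"
    unfolding area_def by (simp add: AE_uniform_measure)
  then obtain N where N: "N \<in> null_sets lborel"
    "{z. \<not> (z \<in> unit_disk \<longrightarrow> Rep_bergman f z = 0)} \<subseteq> N"
    by (auto simp: eventually_ae_filter)
  define U where "U = {z \<in> unit_disk. Rep_bergman f z \<noteq> 0}"
  have "open U"
    unfolding U_def
    using continuous_open_preimage[of unit_disk "Rep_bergman f" "- {0}"]
      holomorphic_on_imp_continuous_on[OF Rep_bergman_holomorphic]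
    by (auto simp: vimage_def Int_def conj_commute open_Compl)
  have "U = {}"
  proof (rule ccontr)
    assume "U \<noteq> {}"
    then have "\<not> negligible U"
      using \<open>open U\<close> open_not_negligible by blast
    moreover have "U \<in> null_sets lborel"
      by (rule null_sets_subset[OF N(1)]) (use \<open>open U\<close> N(2) in \<open>auto simp: U_def\<close>)
    then have "negligible U"
      by (simp add: negligible_iff_null_sets null_sets_completionI)
    ultimately show False by blast
  qed
  then have "Rep_bergman f z = 0" for z
    using Rep_bergman_outside[of z f] by (auto simp: U_def)
  then show ?thesis
    by (auto simp: Rep_bergman_inject[symmetric] Rep_bergman_simps fun_eq_iff)
qed

text \<open>
  The norm and topology are those of \<open>L\<^sup>2\<close>; the type class only offers a real inner product, for
  which the real part of the Hermitian inner product is taken.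
\<close>

instantiation bergman :: real_inner
begin

definition inner_bergman :: "bergman \<Rightarrow> bergman \<Rightarrow> real"
  where "inner_bergman f g = Re (cinner f g)"
definition norm_bergman :: "bergman \<Rightarrow> real"
  where "norm_bergman f = sqrt (inner f f)"
definition sgn_bergman :: "bergman \<Rightarrow> bergman"
  where "sgn_bergman f = f /\<^sub>R norm f"
definition dist_bergman :: "bergman \<Rightarrow> bergman \<Rightarrow> real"
  where "dist_bergman f g = norm (f - g)"
definition uniformity_bergman :: "(bergman \<times> bergman) filter"
  where "uniformity_bergman = (INF e\<in>{0 <..}. principal {(f, g). dist f g < e})"
definition open_bergman :: "bergman set \<Rightarrow> bool"
  where "open_bergman U \<longleftrightarrow> (\<forall>f\<in>U. eventually (\<lambda>(f', g). f' = f \<longrightarrow> g \<in> U) uniformity)"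

instance
proof
  fix f g h :: bergman and r :: real
  show "inner f g = inner g f"
    unfolding inner_bergman_def by (subst cinner_commute) simp
  show "inner (f + g) h = inner f h + inner g h"
    by (simp add: inner_bergman_def cinner_add_left)
  show "inner (r *\<^sub>R f) g = r * inner f g"
    by (simp add: inner_bergman_def scaleR_bergman_def cinner_cscale_left)
  show "0 \<le> inner f f"
    by (simp add: inner_bergman_def cinner_self)
  show "inner f f = 0 \<longleftrightarrow> f = 0"
  proof
    assume "inner f f = 0"
    then have "cinner f f = 0" by (simp add: inner_bergman_def cinner_self)
    then show "f = 0" by (rule cinner_self_eq_0)
  qed (simp add: inner_bergman_def cinner_def Rep_bergman_simps)
qed (simp_all add: norm_bergman_def sgn_bergman_def dist_bergman_def uniformity_bergman_def
      open_bergman_def)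

end


section \<open>Operators and reducing subspaces\<close>

definition bounded_clinear :: "(bergman \<Rightarrow> bergman) \<Rightarrow> bool"
  where "bounded_clinear T \<longleftrightarrow> bounded_linear T \<and> (\<forall>c f. T (cscale c f) = cscale c (T f))"

definition cadjoint :: "(bergman \<Rightarrow> bergman) \<Rightarrow> bergman \<Rightarrow> bergman"
  where "cadjoint T = (THE S. \<forall>f g. cinner (T f) g = cinner f (S g))"

definition commutant :: "(bergman \<Rightarrow> bergman) \<Rightarrow> (bergman \<Rightarrow> bergman) set"
  where "commutant T = {S. bounded_clinear S \<and> S \<circ> T = T \<circ> S}"

definition csubspace :: "bergman set \<Rightarrow> bool"
  where "csubspace M \<longleftrightarrow> subspace M \<and> (\<forall>c. \<forall>f\<in>M. cscale c f \<in> M)"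

definition reducing_subspace :: "(bergman \<Rightarrow> bergman) \<Rightarrow> bergman set \<Rightarrow> bool"
  where "reducing_subspace T M \<longleftrightarrow>
    csubspace M \<and> closed M \<and> T ` M \<subseteq> M \<and> cadjoint T ` M \<subseteq> M"

definition minimal_reducing_subspace :: "(bergman \<Rightarrow> bergman) \<Rightarrow> bergman set \<Rightarrow> bool"
  where "minimal_reducing_subspace T M \<longleftrightarrow> reducing_subspace T M \<and> M \<noteq> {0} \<and>
    (\<forall>N. reducing_subspace T N \<and> N \<subseteq> M \<longrightarrow> N = M \<or> N = {0})"


section \<open>Blaschke products\<close>

definition blaschke :: "nat \<Rightarrow> (nat \<Rightarrow> complex) \<Rightarrow> complex \<Rightarrow> complex"
  where "blaschke n a z = (\<Prod>j=1..n. (z - a j) / (1 - cnj (a j) * z))"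

definition is_blaschke_product :: "nat \<Rightarrow> (complex \<Rightarrow> complex) \<Rightarrow> bool"
  where "is_blaschke_product n \<phi> \<longleftrightarrow> (\<exists>a. (\<forall>j\<in>{1..n}. a j \<in> unit_disk) \<and> \<phi> = blaschke n a)"

text \<open>Meaningful only if \<open>\<phi>\<close> is a multiplier of the Bergman space, e.g. a Blaschke product.\<close>

definition mult_op :: "(complex \<Rightarrow> complex) \<Rightarrow> bergman \<Rightarrow> bergman"
  where "mult_op \<phi> h = Abs_bergman (\<lambda>z. \<phi> z * Rep_bergman h z)"

lemma blaschke_denom_nonzero:
  assumes "a \<in> unit_disk" "z \<in> cball 0 1"
  shows "1 - cnj a * z \<noteq> 0"
proof
  assume "1 - cnj a * z = 0"
  then have "cmod a * cmod z = 1"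
    by (metis complex_mod_cnj eq_iff_diff_eq_0 norm_mult norm_one)
  moreover have "cmod a * cmod z \<le> cmod a * 1"
    using assms by (intro mult_left_mono) auto
  ultimately show False using assms by auto
qed

lemma Rep_mult_op:
  assumes "is_blaschke_product n \<phi>"
  shows "Rep_bergman (mult_op \<phi> h) = (\<lambda>z. \<phi> z * Rep_bergman h z)"
proof -
  obtain a where a: "\<And>j. j \<in> {1..n} \<Longrightarrow> a j \<in> unit_disk"
    and \<phi>: "\<phi> = (\<lambda>z. \<Prod>j=1..n. (z - a j) / (1 - cnj (a j) * z))"
    using assms unfolding is_blaschke_product_def blaschke_def[abs_def] by blast
  have "continuous_on (cball 0 1) \<phi>"
    unfolding \<phi> by (intro continuous_intros) (use a blaschke_denom_nonzero in blast)
  then have "bounded (\<phi> ` cball 0 1)"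
    by (intro compact_imp_bounded compact_continuous_image) auto
  then obtain B where B: "\<And>z. z \<in> cball 0 1 \<Longrightarrow> cmod (\<phi> z) \<le> B"
    unfolding bounded_iff by blast
  have hol: "\<phi> holomorphic_on unit_disk"
    unfolding \<phi> by (intro holomorphic_intros)
      (use a blaschke_denom_nonzero ball_subset_cball in blast)
  show ?thesis
    unfolding mult_op_def
  proof (rule Abs_bergman_inverse, rule bergman_memI)
    show "integrable area (\<lambda>z. B\<^sup>2 * (cmod (Rep_bergman h z))\<^sup>2)"
      by (intro integrable_mult_right Rep_bergman_square_integrable)
    show "(cmod (\<phi> z * Rep_bergman h z))\<^sup>2 \<le> B\<^sup>2 * (cmod (Rep_bergman h z))\<^sup>2" for z
    proof (cases "z \<in> unit_disk")
      case True
      then have "(cmod (\<phi> z))\<^sup>2 \<le> B\<^sup>2" by (intro power_mono B) auto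
      then show ?thesis by (simp add: norm_mult power_mult_distrib mult_right_mono)
    qed (simp add: Rep_bergman_outside)
  qed (auto intro!: holomorphic_intros hol Rep_bergman_holomorphic simp: Rep_bergman_outside)
qed

definition A_phi :: "(complex \<Rightarrow> complex) \<Rightarrow> (bergman \<Rightarrow> bergman) set"
  where "A_phi \<phi> = commutant (mult_op \<phi>) \<inter> commutant (cadjoint (mult_op \<phi>))"


section \<open>The Riemann surface\<close>

definition critical_points :: "(complex \<Rightarrow> complex) \<Rightarrow> complex set"
  where "critical_points \<phi> = {z \<in> unit_disk. deriv \<phi> z = 0}"

definition branch_fibres :: "(complex \<Rightarrow> complex) \<Rightarrow> complex set"
  where "branch_fibres \<phi> = unit_disk \<inter> \<phi> -` (\<phi> ` critical_points \<phi>)"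

definition unbranched_cover :: "(complex \<Rightarrow> complex) \<Rightarrow> (complex \<times> complex) set"
  where "unbranched_cover \<phi> =
    {(w, z). z \<in> unit_disk - branch_fibres \<phi> \<and> w \<in> unit_disk \<and> \<phi> w = \<phi> z}"

text \<open>
  The components of the Riemann surface \<open>S\<^sub>\<phi>\<close> correspond to those of the unbranched cover from
  which it is obtained by filling in finitely many points.  The cover carries the subspace
  topology of \<open>\<complex> \<times> \<complex>\<close>.
\<close>

definition surface_components :: "(complex \<Rightarrow> complex) \<Rightarrow> (complex \<times> complex) set set"
  where "surface_components \<phi> = components (unbranched_cover \<phi>)"

end

theory Submission
  imports Defs "HOL-Complex_Analysis.Complex_Analysis"
begin

text \<open>
  Let \<open>T\<close> commute with \<open>M\<^sub>\<phi>\<close> and its adjoint, and let \<open>S\<close> be the adjoint of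
  \<open>T\<close>. Comparing the moments of \<open>\<langle>\<phi>\<^sup>i T f, \<phi>\<^sup>j g\<rangle> =
  \<langle>\<phi>\<^sup>i f, \<phi>\<^sup>j S g\<rangle>\<close> shows that the sums over the fibres of \<open>\<phi>\<close>
  agree pointwise. Near a regular value, with branches \<open>\<beta>\<^sub>w\<close> of the inverse of \<open>\<phi>\<close>,
  this is an identity between a holomorphic and an antiholomorphic side; polarizing it gives \<open>(T f)(\<beta>\<^sub>w)
  \<beta>\<^sub>w' = \<Sum>\<^sub>v t\<^sub>w\<^sub>v f(\<beta>\<^sub>v) \<beta>\<^sub>v'\<close> with constants
  \<open>t\<^sub>w\<^sub>v\<close>. Thus \<open>T\<close> is a locally constant function on the unbranched cover. Conversely
  the indicator of every component defines an operator in the algebra: it is the derivative of a sum of primitives, so that the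
  branch points are removable singularities, and the change of variables along \<open>\<phi>\<close> bounds it and identifies
  its adjoint. Hence the dimension of the algebra is the number of components.

  Commutativity comes from the boundary, where \<open>\<phi>\<close> is an unbranched cyclic cover of an annulus: going once
  around it permutes the fibre cyclically, so that the matrices \<open>t\<close> are circulant. Their Fourier coefficients are
  multiplicative functionals that separate the algebra; the blocks of equal functionals correspond to the minimal idempotents
  and hence to the minimal reducing subspaces.
\<close>

section \<open>Projections and functionals on Hilbert spaces\<close>

text \<open>The weight shapes both directions. Pushing area forward along \<phi> produces the factor
  1/|\<phi>'|^2, the product of 1/\<phi>' and its conjugate; hence everything is phrased through the
  quotients f/\<phi>' on a fibre, that is, through the pullbacks of the form f dz by the branches.
  They turn the fibre identity into a sum of holomorphic times antiholomorphic terms, so that one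
  variable can be frozen. For the converse the same weight is an obstacle: f/\<phi>' can blow up at
  a critical point, whereas a primitive F of f stays bounded on the fibres over a compact part of
  the disk. Summing F over the sheets of a component and differentiating afterwards avoids any
  expansion at the branch points.

  One fibre near the circle carries all the information because every component of the cover has
  points over every regular point: the number of its sheets is locally constant. A single row of n
  coefficients therefore determines an operator. Dimensions are compared inside the Bergman space,
  by applying the operators to one vector on which the algebra acts injectively.\<close>

lemma orthogonal_decomposition_exists:
  fixes M :: "'a::real_inner set"
  assumes M: "subspace M" "complete M"
  shows "\<exists>m\<in>M. \<forall>y\<in>M. inner (x - m) y = 0"
proof -
  define d where "d = (INF y\<in>M. (norm (x - y))\<^sup>2)"
  have ne: "M \<noteq> {}" using subspace_0[OF M(1)] by auto
  have bdd: "bdd_below ((\<lambda>y. (norm (x - y))\<^sup>2) ` M)"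
    by (rule bdd_belowI2[of _ 0]) simp
  have d_le: "d \<le> (norm (x - y))\<^sup>2" if "y \<in> M" for y
    unfolding d_def by (rule cINF_lower[OF bdd that])
  have "\<exists>y\<in>M. (norm (x - y))\<^sup>2 < d + 1 / real (Suc n)" for n
    using cINF_less_iff[OF ne bdd, of "d + 1 / real (Suc n)"] by (simp add: d_def)
  then obtain Y where Y: "\<And>n. Y n \<in> M" "\<And>n. (norm (x - Y n))\<^sup>2 < d + 1 / real (Suc n)"
    by metis
  have dist: "(norm (Y i - Y j))\<^sup>2 \<le> 2 / real (Suc i) + 2 / real (Suc j)" for i j
  proof -
    have mid: "(1/2) *\<^sub>R (Y i + Y j) \<in> M"
      using M(1) Y(1) by (intro subspace_scale subspace_add) auto
    \<comment> \<open>Parallelogram law: the midpoint lies in M, so its squared distance from x is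
      at least the infimum d.\<close>
    have "(norm (Y i - Y j))\<^sup>2 = 2 * (norm (x - Y i))\<^sup>2 + 2 * (norm (x - Y j))\<^sup>2
        - 4 * (norm (x - (1/2) *\<^sub>R (Y i + Y j)))\<^sup>2"
      by (simp add: power2_norm_eq_inner inner_diff inner_add inner_commute algebra_simps)
    then show ?thesis using d_le[OF mid] Y(2)[of i] Y(2)[of j] by simp
  qed
  have "Cauchy Y"
  proof (rule metric_CauchyI)
    fix e :: real assume e: "0 < e"
    obtain N where N: "1 / real (Suc N) < e\<^sup>2 / 4"
      using e by (metis nat_approx_posE zero_less_divide_iff zero_less_numeral zero_less_power)
    have "dist (Y i) (Y j) < e" if "i \<ge> N" "j \<ge> N" for i j
    proof -
      have "1 / real (Suc i) \<le> 1 / real (Suc N)" "1 / real (Suc j) \<le> 1 / real (Suc N)"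
        using that by (auto intro!: divide_left_mono)
      then have "(norm (Y i - Y j))\<^sup>2 < e\<^sup>2" using dist[of i j] N by simp
      then show ?thesis using e by (simp add: dist_norm power2_less_imp_less)
    qed
    then show "\<exists>M. \<forall>m\<ge>M. \<forall>n\<ge>M. dist (Y m) (Y n) < e" by blast
  qed
  then obtain m where m: "m \<in> M" "Y \<longlonglongrightarrow> m"
    using M(2) Y(1) unfolding complete_def by blast
  have "(\<lambda>n. (norm (x - Y n))\<^sup>2) \<longlonglongrightarrow> (norm (x - m))\<^sup>2"
    by (intro tendsto_intros m(2))
  moreover have "(\<lambda>n. d + 1 / real (Suc n)) \<longlonglongrightarrow> d + 0"
    by (intro tendsto_intros LIMSEQ_Suc[OF lim_1_over_n])
  ultimately have m_le: "(norm (x - m))\<^sup>2 \<le> d"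
    using Y(2) by (intro LIMSEQ_le[of _ _ "\<lambda>n. d + 1 / real (Suc n)"]) (auto intro: less_imp_le)
  have "inner (x - m) y = 0" if "y \<in> M" for y
  proof (cases "y = 0")
    case False
    \<comment> \<open>The step length that minimizes |x - m - t y|^2; a strict decrease would
      contradict the minimality of m.\<close>
    define t where "t = inner (x - m) y / inner y y"
    have yy: "inner y y > 0" using False by simp
    have "m + t *\<^sub>R y \<in> M" using M(1) m(1) that by (intro subspace_add subspace_scale) auto
    from d_le[OF this] have "(norm (x - m))\<^sup>2 \<le> (norm (x - (m + t *\<^sub>R y)))\<^sup>2" using m_le by linarith
    also have "\<dots> = (norm (x - m))\<^sup>2 - 2 * t * inner (x - m) y + t\<^sup>2 * inner y y"
      unfolding power2_norm_eq_inner power2_eq_square[of t]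
      by (simp add: inner_diff inner_add inner_commute algebra_simps)
    also have "\<dots> = (norm (x - m))\<^sup>2 - (inner (x - m) y)\<^sup>2 / inner y y"
      using yy by (simp add: t_def power2_eq_square field_simps)
    finally have "(inner (x - m) y)\<^sup>2 / inner y y \<le> 0" by simp
    then show ?thesis using yy by (simp add: divide_le_0_iff)
  qed simp
  then show ?thesis using m(1) by blast
qed

text \<open>The kernel has codimension one: subtracting a multiple of the vector z orthogonal to it
  moves any f into the kernel. Such a z is what remains of a vector x with
  \<open>l x \<noteq> 0\<close> after its kernel part is removed.\<close>

lemma riesz_representation:
  fixes l :: "'a::{real_inner,complete_space} \<Rightarrow> real"
  assumes l: "bounded_linear l"
  shows "\<exists>g. \<forall>f. l f = inner f g"
proof (cases "\<forall>f. l f = 0")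
  case False
  then obtain x where x: "l x \<noteq> 0" by blast
  interpret l: bounded_linear l by (rule l)
  define K where "K = {f. l f = 0}"
  have "subspace K" by (auto simp: K_def subspace_def l.add l.scaleR l.zero)
  moreover have "closed K"
    unfolding K_def by (intro closed_Collect_eq linear_continuous_on l continuous_on_const)
  ultimately obtain m where m: "m \<in> K" "\<And>y. y \<in> K \<Longrightarrow> inner (x - m) y = 0"
    using orthogonal_decomposition_exists[of K x] complete_eq_closed by blast
  define z where "z = x - m"
  have lz: "l z \<noteq> 0" using x m(1) by (simp add: z_def K_def l.diff)
  then have zz: "inner z z \<noteq> 0" by (auto simp: l.zero)
  have "l f = inner f ((l z / inner z z) *\<^sub>R z)" for f
  proof -
    have "f - (l f / l z) *\<^sub>R z \<in> K" using lz by (simp add: K_def l.diff l.scaleR)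
    then have "inner z (f - (l f / l z) *\<^sub>R z) = 0" using m(2) by (simp add: z_def)
    then show ?thesis using lz zz by (simp add: inner_diff field_simps inner_commute)
  qed
  then show ?thesis by blast
qed (intro exI[of _ 0], simp)

section \<open>Area and holomorphic maps\<close>

text \<open>The Jacobian formula for measures of images is available on \<open>real^2\<close> with
  determinants of matrices. These coordinates, which preserve the measure, carry it to the complex
  plane.\<close>

definition vec_of_complex :: "complex \<Rightarrow> real^2"
  where "vec_of_complex z = vector [Re z, Im z]"

definition complex_of_vec :: "real^2 \<Rightarrow> complex"
  where "complex_of_vec x = Complex (vec_nth x 1) (vec_nth x 2)"

lemma complex_of_vec_inverse [simp]: "complex_of_vec (vec_of_complex z) = z"
  by (simp add: complex_of_vec_def vec_of_complex_def)

lemma vec_of_complex_inverse [simp]: "vec_of_complex (complex_of_vec x) = x"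
  by (simp add: complex_of_vec_def vec_of_complex_def vec_eq_iff forall_2)

lemma bounded_linear_complex_of_vec: "bounded_linear complex_of_vec"
  by (rule linear_conv_bounded_linear[THEN iffD1], rule linearI)
     (auto simp: complex_of_vec_def complex_eq_iff)

lemma bounded_linear_vec_of_complex: "bounded_linear vec_of_complex"
  by (rule linear_conv_bounded_linear[THEN iffD1], rule linearI)
     (auto simp: vec_of_complex_def vec_eq_iff forall_2)

lemma borel_measurable_complex_of_vec [measurable]: "complex_of_vec \<in> borel_measurable borel"
  by (intro borel_measurable_continuous_onI linear_continuous_on bounded_linear_complex_of_vec)

lemma vimage_complex_of_vec: "complex_of_vec -` A = vec_of_complex ` A"
  by (auto simp: image_iff intro: vec_of_complex_inverse[symmetric])

text \<open>Lebesgue measure is determined by its values on boxes, and the coordinates take boxes to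
  boxes with the same side lengths.\<close>

lemma distr_complex_of_vec: "distr lborel borel complex_of_vec = lborel"
proof (rule lborel_eqI[symmetric])
  fix l u :: complex
  assume lu: "\<And>b. b \<in> Basis \<Longrightarrow> l \<bullet> b \<le> u \<bullet> b"
  have le: "Re l \<le> Re u" "Im l \<le> Im u"
    using lu[of 1] lu[of \<i>] by (auto simp: Basis_complex_def)
  have Basis2: "Basis = {axis 1 1, axis 2 (1::real) :: real^2}"
    by (auto simp: Basis_vec_def UNIV_2)
  have eq: "complex_of_vec -` box l u = box (vec_of_complex l) (vec_of_complex u)"
    by (auto simp: box_def Basis_complex_def Basis2 complex_of_vec_def vec_of_complex_def
        inner_axis)
  have "emeasure (distr lborel borel complex_of_vec) (box l u)
      = emeasure lborel (box (vec_of_complex l) (vec_of_complex u))"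
    by (subst emeasure_distr) (auto simp: eq)
  also have "\<dots> = (\<Prod>b\<in>Basis. (vec_of_complex u - vec_of_complex l) \<bullet> b)"
    using le by (subst emeasure_lborel_box_eq)
      (auto simp: Basis2 vec_of_complex_def inner_axis)
  also have "(\<Prod>b\<in>Basis. (vec_of_complex u - vec_of_complex l) \<bullet> b) = (\<Prod>b\<in>Basis. (u - l) \<bullet> b)"
    by (simp add: Basis2 Basis_complex_def vec_of_complex_def inner_axis axis_eq_axis)
  finally show "emeasure (distr lborel borel complex_of_vec) (box l u) = (\<Prod>b\<in>Basis. (u - l) \<bullet> b)" .
qed simp

lemma emeasure_vec_of_complex_image:
  assumes "A \<in> sets borel"
  shows "emeasure lborel (vec_of_complex ` A) = emeasure lborel A"
proof -
  have "emeasure lborel A = emeasure (distr lborel borel complex_of_vec) A"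
    by (simp add: distr_complex_of_vec)
  then show ?thesis using assms by (simp add: emeasure_distr vimage_complex_of_vec)
qed

lemma nn_integral_vec_of_complex:
  assumes [measurable]: "g \<in> borel_measurable borel"
  shows "(\<integral>\<^sup>+x. g (complex_of_vec x) \<partial>lborel) = (\<integral>\<^sup>+z. g z \<partial>lborel)"
proof -
  have "(\<integral>\<^sup>+z. g z \<partial>lborel) = (\<integral>\<^sup>+z. g z \<partial>distr lborel borel complex_of_vec)"
    by (simp add: distr_complex_of_vec)
  then show ?thesis by (simp add: nn_integral_distr)
qed

text \<open>Multiplication by c is a rotation followed by a dilation by |c|. For a holomorphic map
  this identifies the real Jacobian with |f'|^2.\<close>

lemma det_complex_mult:
  "det (matrix (\<lambda>h. vec_of_complex (c * complex_of_vec h))) = (cmod c)\<^sup>2"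
  by (simp add: det_2 matrix_def vec_of_complex_def complex_of_vec_def axis_def cmod_power2[symmetric]
      power2_eq_square[symmetric])

text \<open>Injectivity gives a holomorphic inverse on the open image, and the image of A is the
  preimage of A under that inverse.\<close>

lemma borel_holomorphic_image:
  assumes f: "f holomorphic_on S" and S: "open S" and inj: "inj_on f S"
    and A: "A \<in> sets borel" "A \<subseteq> S"
  shows "f ` A \<in> sets borel"
proof -
  obtain g where g: "g holomorphic_on (f ` S)" "\<And>z. z \<in> S \<Longrightarrow> g (f z) = z"
    using holomorphic_has_inverse[OF f S inj] by metis
  have op: "open (f ` S)"
    using open_mapping_thm3[OF f S inj] .
  have "f ` A = (g -` A) \<inter> (f ` S)"
    using g(2) A(2) by (auto simp: image_iff subset_iff)
  also have "\<dots> \<in> sets borel"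
  proof -
    have m: "(\<lambda>z. indicator (f ` S) z *\<^sub>R g z) \<in> borel_measurable borel"
      by (intro borel_measurable_continuous_on_indicator holomorphic_on_imp_continuous_on g(1))
         (use op in auto)
    have "(\<lambda>z. indicator (f ` S) z *\<^sub>R g z) -` A \<inter> f ` S \<in> sets borel"
      by (intro sets.Int measurable_sets_borel[OF m] A(1)) (use op in auto)
    also have "(\<lambda>z. indicator (f ` S) z *\<^sub>R g z) -` A \<inter> f ` S = g -` A \<inter> f ` S" by auto
    finally show ?thesis .
  qed
  finally show ?thesis .
qed

lemma borel_measurable_deriv_weight:
  assumes f: "f holomorphic_on S" and S: "open S"
  shows "(\<lambda>z. indicator S z * (cmod (deriv f z))\<^sup>2 :: real) \<in> borel_measurable borel"
proof -
  have "(\<lambda>z. indicator S z *\<^sub>R deriv f z) \<in> borel_measurable borel"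
    by (intro borel_measurable_continuous_on_indicator holomorphic_on_imp_continuous_on
        holomorphic_deriv f S) (use S in auto)
  then have "(\<lambda>z. (cmod (indicator S z *\<^sub>R deriv f z))\<^sup>2) \<in> borel_measurable borel" by measurable
  also have "(\<lambda>z. (cmod (indicator S z *\<^sub>R deriv f z))\<^sup>2) = (\<lambda>z. indicator S z * (cmod (deriv f z))\<^sup>2)"
    by (auto simp: fun_eq_iff indicator_def)
  finally show ?thesis .
qed

text \<open>The real change of variables theorem enters as an equivalence: the image has finite
  measure m exactly when |f'|^2 has integral m over A. The formula in the extended reals therefore
  needs a separate argument when the integral is infinite.\<close>

lemma emeasure_holomorphic_image:
  assumes f: "f holomorphic_on S" and S: "open S" and inj: "inj_on f S"
    and A: "A \<in> sets borel" "A \<subseteq> S"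
  shows "emeasure lborel (f ` A) = (\<integral>\<^sup>+z. indicator A z * ennreal ((cmod (deriv f z))\<^sup>2) \<partial>lborel)"
proof -
  define A' where "A' = vec_of_complex ` A"
  define F where "F = (\<lambda>x. vec_of_complex (f (complex_of_vec x)))"
  define J where "J = (\<lambda>x. (cmod (deriv f (complex_of_vec x)))\<^sup>2)"
  have A'_eq: "A' = complex_of_vec -` A" by (simp add: A'_def vimage_complex_of_vec)
  have A'[measurable]: "A' \<in> sets borel"
    unfolding A'_eq using A(1) by (simp add: measurable_sets_borel[OF borel_measurable_complex_of_vec])
  have FA: "F ` A' = vec_of_complex ` (f ` A)"
    by (auto simp: F_def A'_def image_image)
  have fA: "f ` A \<in> sets borel" by (rule borel_holomorphic_image[OF f S inj A])
  have FA_borel: "F ` A' \<in> sets borel"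
    unfolding FA vimage_complex_of_vec[symmetric]
    using fA by (simp add: measurable_sets_borel[OF borel_measurable_complex_of_vec])
  have der: "(F has_derivative (\<lambda>h. vec_of_complex (deriv f (complex_of_vec x) * complex_of_vec h))) (at x within A')"
    if "x \<in> A'" for x
  proof -
    have "complex_of_vec x \<in> S" using that A(2) by (auto simp: A'_eq)
    then have "(f has_field_derivative deriv f (complex_of_vec x)) (at (complex_of_vec x))"
      using f S holomorphic_derivI by blast
    then have 1: "(f has_derivative ((*) (deriv f (complex_of_vec x)))) (at (complex_of_vec x))"
      by (simp add: has_field_derivative_def)
    have 2: "(complex_of_vec has_derivative complex_of_vec) (at x within A')"
      by (rule bounded_linear_imp_has_derivative[OF bounded_linear_complex_of_vec])
    have "((\<lambda>x. f (complex_of_vec x)) has_derivative (\<lambda>h. deriv f (complex_of_vec x) * complex_of_vec h)) (at x within A')"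
      using has_derivative_compose[OF 2 1] .
    then show ?thesis unfolding F_def
      by (rule bounded_linear.has_derivative[OF bounded_linear_vec_of_complex])
  qed
  have injF: "inj_on F A'"
  proof (rule inj_onI)
    fix x y assume xy: "x \<in> A'" "y \<in> A'" "F x = F y"
    then have "complex_of_vec (F x) = complex_of_vec (F y)" by simp
    then have "f (complex_of_vec x) = f (complex_of_vec y)" by (simp add: F_def)
    then have "complex_of_vec x = complex_of_vec y"
      using xy(1,2) A(2) inj by (auto simp: A'_eq dest: inj_onD)
    then have "vec_of_complex (complex_of_vec x) = vec_of_complex (complex_of_vec y)" by simp
    then show "x = y" by simp
  qed
  have A'leb: "A' \<in> sets lebesgue" using A' by simp
  have detJ: "\<bar>det (matrix (\<lambda>h. vec_of_complex (deriv f (complex_of_vec x) * complex_of_vec h)))\<bar> = J x" for x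
    by (simp add: det_complex_mult J_def)
  have key: "F ` A' \<in> lmeasurable \<and> measure lebesgue (F ` A') = m \<longleftrightarrow> (J has_integral m) A'" for m
    using has_measure_differentiable_image[OF A'leb der injF, of m] unfolding detJ by simp
  define G where "G = (\<lambda>z. indicator A z * ennreal ((cmod (deriv f z))\<^sup>2))"
  have [measurable]: "A \<in> sets borel" by (rule A(1))
  have [measurable]: "G \<in> borel_measurable borel"
  proof -
    have "(\<lambda>z. indicator A z * ennreal (indicator S z * (cmod (deriv f z))\<^sup>2)) \<in> borel_measurable borel"
      using borel_measurable_deriv_weight[OF f S] by measurable
    also have "(\<lambda>z. indicator A z * ennreal (indicator S z * (cmod (deriv f z))\<^sup>2)) = G"
      using A(2) by (auto simp: G_def fun_eq_iff indicator_def)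
    finally show ?thesis .
  qed
  have JG: "ennreal (indicator A' x * J x) = G (complex_of_vec x)" for x
    by (auto simp: G_def J_def A'_eq indicator_def)
  have JGm: "(\<lambda>x. indicator A' x * J x) \<in> borel_measurable borel"
  proof -
    have "(\<lambda>x. enn2real (G (complex_of_vec x))) \<in> borel_measurable borel" by measurable
    also have "(\<lambda>x. enn2real (G (complex_of_vec x))) = (\<lambda>x. indicator A' x * J x)"
      unfolding JG[symmetric] by (auto simp: J_def)
    finally show ?thesis .
  qed
  have int: "(\<integral>\<^sup>+z. G z \<partial>lborel) = (\<integral>\<^sup>+x. ennreal (indicator A' x * J x) \<partial>lborel)"
    unfolding JG by (rule nn_integral_vec_of_complex[symmetric]) simp
  have em: "emeasure lborel (f ` A) = emeasure lebesgue (F ` A')"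
    unfolding FA using FA_borel FA emeasure_vec_of_complex_image[OF fA] by (simp)
  have ind: "(\<lambda>x. indicator A' x * J x) = (\<lambda>x. if x \<in> A' then J x else 0)"
    by (auto simp: indicator_def)
  show ?thesis
  proof (cases "(\<integral>\<^sup>+x. ennreal (indicator A' x * J x) \<partial>lborel) = \<infinity>")
    case False
    then obtain m where m: "0 \<le> m" "(\<integral>\<^sup>+x. ennreal (indicator A' x * J x) \<partial>lborel) = ennreal m"
      by (cases "\<integral>\<^sup>+x. ennreal (indicator A' x * J x) \<partial>lborel" rule: ennreal_cases) auto
    have "((\<lambda>x. indicator A' x * J x) has_integral m) UNIV"
      by (rule nn_integral_has_integral[OF JGm]) (use m in \<open>auto simp: J_def\<close>)
    then have "(J has_integral m) A'"
      unfolding ind by (subst has_integral_restrict_UNIV[symmetric])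
    then have *: "F ` A' \<in> lmeasurable" "measure lebesgue (F ` A') = m" using key by auto
    have "emeasure lebesgue (F ` A') = ennreal m"
      using * by (metis emeasure_eq_measure2 fmeasurableD2 emeasure_eq_ennreal_measure)
    then show ?thesis using em int m by (simp add: G_def)
  next
    case True
    \<comment> \<open>A finite measure of the image would make the integral finite, by the other
      direction of \<open>key\<close>.\<close>
    have "emeasure lebesgue (F ` A') = \<infinity>"
    proof (rule ccontr)
      assume "emeasure lebesgue (F ` A') \<noteq> \<infinity>"
      then have "F ` A' \<in> lmeasurable"
        using FA_borel by (intro fmeasurableI) (auto simp: less_top)
      then have "(J has_integral (measure lebesgue (F ` A'))) A'" using key by blast
      then have "((\<lambda>x. indicator A' x * J x) has_integral (measure lebesgue (F ` A'))) UNIV"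
        unfolding ind by (subst has_integral_restrict_UNIV)
      then have "(\<integral>\<^sup>+x. ennreal (indicator A' x * J x) \<partial>lborel) = ennreal (measure lebesgue (F ` A'))"
        by (intro nn_integral_has_integral_lborel JGm) (auto simp: J_def)
      then show False using True by simp
    qed
    then show ?thesis using em int True by (simp add: G_def)
  qed
qed

text \<open>The change of variables as an identity of measures, from which the formulas for Bochner
  and for nonnegative integrals both follow. The factor \<open>indicator S\<close> in the map makes
  it Borel on the whole plane; off S the density vanishes.\<close>

lemma distr_holomorphic:
  assumes f: "f holomorphic_on S" and S: "open S" and inj: "inj_on f S"
  shows "distr (density lborel (\<lambda>z. ennreal (indicator S z * (cmod (deriv f z))\<^sup>2))) borel
      (\<lambda>z. indicator S z *\<^sub>R f z) = density lborel (indicator (f ` S))" (is "distr ?M borel ?f = ?N")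
proof (rule measure_eqI)
  have fm[measurable]: "?f \<in> borel_measurable borel"
    by (intro borel_measurable_continuous_on_indicator holomorphic_on_imp_continuous_on f) (use S in auto)
  note [measurable] = borel_measurable_deriv_weight[OF f S]
  show "sets (distr ?M borel ?f) = sets ?N" by simp
  fix A assume "A \<in> sets (distr ?M borel ?f)"
  then have A: "A \<in> sets borel" by simp
  have fS: "f ` S \<in> sets borel" using open_mapping_thm3[OF f S inj] by simp
  let ?B = "S \<inter> ?f -` A"
  have B: "?B \<in> sets borel" using A S by (simp add: measurable_sets_borel[OF fm] sets.Int)
  have "emeasure (distr ?M borel ?f) A = emeasure ?M (?f -` A)"
    using A by (subst emeasure_distr) auto
  also have "\<dots> = (\<integral>\<^sup>+z. ennreal (indicator S z * (cmod (deriv f z))\<^sup>2) * indicator (?f -` A) z \<partial>lborel)"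
    using A by (subst emeasure_density) (auto simp: measurable_sets_borel[OF fm])
  also have "\<dots> = (\<integral>\<^sup>+z. indicator ?B z * ennreal ((cmod (deriv f z))\<^sup>2) \<partial>lborel)"
    by (intro nn_integral_cong) (auto simp: indicator_def)
  also have "\<dots> = emeasure lborel (f ` ?B)"
    by (rule emeasure_holomorphic_image[OF f S inj B, symmetric]) auto
  also have "f ` ?B = f ` S \<inter> A" by (auto simp: indicator_def)
  also have "emeasure lborel (f ` S \<inter> A) = emeasure ?N A"
    using A fS by (subst emeasure_density) (auto simp: indicator_inter_arith[symmetric])
  finally show "emeasure (distr ?M borel ?f) A = emeasure ?N A" .
qed

lemma holomorphic_image_integral:
  fixes g :: "complex \<Rightarrow> 'b::{banach, second_countable_topology}"
  assumes f: "f holomorphic_on S" and S: "open S" and inj: "inj_on f S"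
    and g[measurable]: "g \<in> borel_measurable borel"
  shows "(LINT z:f ` S|lborel. g z) = (LINT z:S|lborel. (cmod (deriv f z))\<^sup>2 *\<^sub>R g (f z))"
proof -
  note [measurable] = borel_measurable_deriv_weight[OF f S]
  have [measurable]: "(\<lambda>z. indicator S z *\<^sub>R f z) \<in> borel_measurable borel"
    by (intro borel_measurable_continuous_on_indicator holomorphic_on_imp_continuous_on f) (use S in auto)
  have fS: "f ` S \<in> sets borel" using open_mapping_thm3[OF f S inj] by simp
  have ind: "density lborel (indicator (f ` S)) = density lborel (\<lambda>z. ennreal (indicator (f ` S) z))"
    by (simp add: ennreal_indicator)
  have "(LINT z:f ` S|lborel. g z) = integral\<^sup>L (density lborel (indicator (f ` S))) g"
    unfolding ind set_lebesgue_integral_def using fS by (subst integral_density) auto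
  also have "\<dots> = (\<integral>z. (indicator S z * (cmod (deriv f z))\<^sup>2) *\<^sub>R g (indicator S z *\<^sub>R f z) \<partial>lborel)"
    unfolding distr_holomorphic[OF f S inj, symmetric]
    by (subst integral_distr, simp, simp, subst integral_density) auto
  also have "\<dots> = (LINT z:S|lborel. (cmod (deriv f z))\<^sup>2 *\<^sub>R g (f z))"
    unfolding set_lebesgue_integral_def
    by (intro Bochner_Integration.integral_cong) (auto simp: indicator_def)
  finally show ?thesis .
qed

lemma holomorphic_image_nn_integral:
  assumes f: "f holomorphic_on S" and S: "open S" and inj: "inj_on f S"
    and g[measurable]: "g \<in> borel_measurable borel"
  shows "(\<integral>\<^sup>+z\<in>f ` S. g z \<partial>lborel) = (\<integral>\<^sup>+z\<in>S. ennreal ((cmod (deriv f z))\<^sup>2) * g (f z) \<partial>lborel)"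
proof -
  note [measurable] = borel_measurable_deriv_weight[OF f S]
  have [measurable]: "(\<lambda>z. indicator S z *\<^sub>R f z) \<in> borel_measurable borel"
    by (intro borel_measurable_continuous_on_indicator holomorphic_on_imp_continuous_on f) (use S in auto)
  have fS: "f ` S \<in> sets borel" using open_mapping_thm3[OF f S inj] by simp
  have "(\<integral>\<^sup>+z\<in>f ` S. g z \<partial>lborel) = (\<integral>\<^sup>+z. g z \<partial>density lborel (indicator (f ` S)))"
    using fS by (subst nn_integral_density) (auto simp: mult.commute)
  also have "\<dots> = (\<integral>\<^sup>+z. ennreal (indicator S z * (cmod (deriv f z))\<^sup>2) * g (indicator S z *\<^sub>R f z) \<partial>lborel)"
    unfolding distr_holomorphic[OF f S inj, symmetric]
    by (subst nn_integral_distr, simp, simp, subst nn_integral_density) auto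
  also have "\<dots> = (\<integral>\<^sup>+z\<in>S. ennreal ((cmod (deriv f z))\<^sup>2) * g (f z) \<partial>lborel)"
    by (intro nn_integral_cong) (auto simp: indicator_def)
  finally show ?thesis .
qed

section \<open>The mean value property for area integrals\<close>

lemma integral_ball_rotate:
  fixes g :: "complex \<Rightarrow> complex"
  assumes c: "cmod c = 1" and g: "g \<in> borel_measurable borel"
  shows "(LINT z:ball w r|lborel. g z) = (LINT z:ball 0 r|lborel. g (w + c * z))"
proof -
  have c0: "c \<noteq> 0" using c by auto
  have im: "(\<lambda>z. w + c * z) ` ball 0 r = ball w r"
  proof (intro equalityI subsetI)
    fix x assume x: "x \<in> ball w r"
    have "x = w + c * ((x - w) / c)" using c0 by simp
    moreover have "(x - w) / c \<in> ball 0 r" using x c by (simp add: norm_divide dist_norm norm_minus_commute)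
    ultimately show "x \<in> (\<lambda>z. w + c * z) ` ball 0 r" by blast
  qed (use c in \<open>auto simp: dist_norm norm_mult\<close>)
  have "deriv (\<lambda>z. w + c * z) z = c" for z
    by (rule DERIV_imp_deriv) (auto intro!: derivative_eq_intros)
  moreover have "inj_on (\<lambda>z. w + c * z) (ball 0 r)" using c0 by (auto simp: inj_on_def)
  ultimately show ?thesis
    using holomorphic_image_integral[of "\<lambda>z. w + c * z" "ball 0 r" g] g c
    by (simp add: im holomorphic_intros)
qed

lemma set_integrable_continuous_ball:
  fixes g :: "complex \<Rightarrow> complex"
  assumes "continuous_on (cball w r) g"
  shows "set_integrable lborel (ball w r) g"
proof -
  have "set_integrable lborel (cball w r) g"
    unfolding set_integrable_def
    by (rule borel_integrable_compact) (use assms in auto)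
  then show ?thesis by (rule set_integrable_subset) auto
qed

text \<open>The rotation by \<pi>/k preserves the disk and multiplies z^k by -1, so the integral
  equals its own negative.\<close>

lemma integral_ball_power_eq_0:
  assumes k: "k > 0"
  shows "(LINT z:ball 0 r|lborel. z ^ k) = (0::complex)"
proof -
  define c where "c = cis (pi / real k)"
  have ck: "c ^ k = -1" using k by (simp add: c_def Complex.DeMoivre)
  have "(LINT z:ball 0 r|lborel. z ^ k) = (LINT z:ball 0 r|lborel. (0 + c * z) ^ k)"
    by (rule integral_ball_rotate) (auto simp: c_def)
  also have "\<dots> = (LINT z:ball 0 r|lborel. (- 1) * z ^ k)"
    by (simp add: power_mult_distrib ck)
  also have "\<dots> = - (LINT z:ball 0 r|lborel. z ^ k)"
    by (simp add: set_lebesgue_integral_def)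
  finally show ?thesis by simp
qed

text \<open>Integrating the power series at w term by term leaves only the constant term.\<close>

lemma area_mean_value:
  assumes f: "f holomorphic_on ball w R" and r: "0 < r" "r < R"
  shows "(LINT z:ball w r|lborel. f z) = f w * measure lborel (ball (0::complex) r)"
proof -
  define a where "a = (\<lambda>k. (deriv ^^ k) f w / fact k)"
  have s: "(\<lambda>k. a k * (z - w) ^ k) sums f z" if "z \<in> ball w R" for z
    unfolding a_def by (rule holomorphic_power_series[OF f that])
  have sb: "(\<lambda>k. a k * z ^ k) sums f (w + z)" if "z \<in> ball 0 R" for z
    using s[of "w + z"] that by (simp add: dist_norm)
  have abs: "summable (\<lambda>k. cmod (a k) * r ^ k)"
  proof -
    \<comment> \<open>Convergence at a radius between r and R gives absolute convergence at r, which
      dominates the series on the smaller disk.\<close>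
    have "summable (\<lambda>k. a k * (of_real ((r + R) / 2)) ^ k)"
    proof -
      have "of_real ((r + R) / 2) \<in> ball (0::complex) R"
        by (simp only: mem_ball_0 norm_of_real) (use r in simp)
      then show ?thesis by (metis sb sums_summable)
    qed
    then have "summable (\<lambda>k. norm (a k * (of_real r) ^ k))"
      by (rule powser_insidea) (simp only: norm_of_real, use r in simp)
    then show ?thesis using r by (simp add: norm_mult norm_power)
  qed
  have "f w = a 0" by (simp add: a_def)
  define g where "g = (\<lambda>z. indicator (ball w R) z *\<^sub>R f z)"
  have gm: "g \<in> borel_measurable borel"
    unfolding g_def by (intro borel_measurable_continuous_on_indicator holomorphic_on_imp_continuous_on f) auto
  have "(LINT z:ball w r|lborel. f z) = (LINT z:ball w r|lborel. g z)"
    unfolding set_lebesgue_integral_def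
    by (rule Bochner_Integration.integral_cong) (use r in \<open>auto simp: g_def indicator_def\<close>)
  also have "\<dots> = (LINT z:ball 0 r|lborel. g (w + 1 * z))"
    by (rule integral_ball_rotate) (auto simp: gm)
  also have "\<dots> = (\<integral>z. (\<Sum>k. indicator (ball 0 r) z *\<^sub>R (a k * z ^ k)) \<partial>lborel)"
    unfolding set_lebesgue_integral_def
  proof (rule Bochner_Integration.integral_cong[OF refl])
    fix z :: complex
    show "indicator (ball 0 r) z *\<^sub>R g (w + 1 * z) = (\<Sum>k. indicator (ball 0 r) z *\<^sub>R (a k * z ^ k))"
      using sb[of z] r by (auto simp: indicator_def g_def sums_iff dist_norm)
  qed
  also have "\<dots> = (\<Sum>k. \<integral>z. indicator (ball 0 r) z *\<^sub>R (a k * z ^ k) \<partial>lborel)"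
  proof (rule integral_suminf)
    show int: "integrable lborel (\<lambda>z. indicator (ball 0 r) z *\<^sub>R (a k * z ^ k))" for k
      using set_integrable_continuous_ball[of 0 r "\<lambda>z. a k * z ^ k"]
      by (simp add: set_integrable_def continuous_intros)
    have le: "norm (indicator (ball 0 r) z *\<^sub>R (a k * z ^ k)) \<le> indicator (ball 0 r) z * (cmod (a k) * r ^ k)"
      for z :: complex and k
      by (auto simp: indicator_def norm_mult norm_power intro!: mult_left_mono power_mono)
    show "AE z in lborel. summable (\<lambda>k. norm (indicator (ball 0 r) z *\<^sub>R (a k * z ^ k)))"
    proof (rule AE_I2)
      fix z :: complex
      have "indicator (ball 0 r) z * (cmod (a k) * r ^ k) \<le> cmod (a k) * r ^ k" for k
        using r by (auto simp: indicator_def)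
      then show "summable (\<lambda>k. norm (indicator (ball 0 r) z *\<^sub>R (a k * z ^ k)))"
        by (intro summable_comparison_test'[OF abs, of 0]) (use le[of z] in \<open>auto intro: order_trans\<close>)
    qed
    have "(\<integral>z. norm (indicator (ball 0 r) z *\<^sub>R (a k * z ^ k)) \<partial>lborel)
        \<le> measure lborel (ball (0::complex) r) * (cmod (a k) * r ^ k)" for k
    proof -
      have "integrable lborel (\<lambda>z::complex. indicator (ball 0 r) z * (cmod (a k) * r ^ k))"
        using emeasure_lborel_ball_finite[of "0::complex" r]
        by (intro integrable_mult_left integrable_real_indicator) auto
      from integral_mono[OF integrable_norm[OF int] this le[of _ k]] show ?thesis by simp
    qed
    then show "summable (\<lambda>k. \<integral>z. norm (indicator (ball 0 r) z *\<^sub>R (a k * z ^ k)) \<partial>lborel)"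
      by (intro summable_comparison_test'[OF summable_mult[OF abs], of 0]) auto
  qed
  also have "(\<lambda>k. \<integral>z. indicator (ball 0 r) z *\<^sub>R (a k * z ^ k) \<partial>lborel)
      = (\<lambda>k. if k = 0 then a 0 * measure lborel (ball (0::complex) r) else 0)"
  proof
    fix k
    have "(\<integral>z. indicator (ball 0 r) z *\<^sub>R (a k * z ^ k) \<partial>lborel) = a k * (LINT z:ball 0 r|lborel. z ^ k)"
      unfolding set_lebesgue_integral_def
      by (subst integral_mult_right_zero[symmetric]) (simp add: mult_ac scaleR_conv_of_real)
    also have "\<dots> = (if k = 0 then a 0 * measure lborel (ball (0::complex) r) else 0)"
      using integral_ball_power_eq_0[of k r]
      by (auto simp: set_lebesgue_integral_def scaleR_conv_of_real emeasure_lborel_ball_finite)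
    finally show "(\<integral>z. indicator (ball 0 r) z *\<^sub>R (a k * z ^ k) \<partial>lborel)
      = (if k = 0 then a 0 * measure lborel (ball (0::complex) r) else 0)" .
  qed
  finally show ?thesis using \<open>f w = a 0\<close>
    by (subst (asm) suminf_finite[of "{0}"]) auto
qed

section \<open>The Bergman space as a Hilbert space\<close>

lemma measure_unit_disk_pos: "0 < measure lborel unit_disk"
  using content_ball_pos[of 1 "0::complex"] by simp

lemma emeasure_unit_disk: "emeasure lborel unit_disk = ennreal (measure lborel unit_disk)"
  using emeasure_lborel_ball_finite[of "0::complex" 1] by (intro emeasure_eq_ennreal_measure) auto

lemma area_eq_density:
  "area = density lborel (\<lambda>z. ennreal (indicator unit_disk z / measure lborel unit_disk))"
  unfolding area_def uniform_measure_def
  by (rule density_cong)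
     (auto simp: emeasure_unit_disk measure_unit_disk_pos indicator_def divide_ennreal[symmetric]
       simp flip: ennreal_1)

lemma borel_measurable_disk_weight [measurable]:
  "(\<lambda>z. indicator unit_disk z / c :: real) \<in> borel_measurable borel"
  by (intro borel_measurable_divide borel_measurable_indicator borel_measurable_const) auto

lemma disk_weight_scaleR:
  fixes x :: "'b::real_vector"
  shows
  "(indicator unit_disk z / c) *\<^sub>R x = inverse c *\<^sub>R (indicator unit_disk z *\<^sub>R x)"
  by (simp add: indicator_def inverse_eq_divide)

lemma integral_area:
  fixes f :: "complex \<Rightarrow> 'b::{banach, second_countable_topology}"
  assumes [measurable]: "f \<in> borel_measurable borel"
  shows "integral\<^sup>L area f = (LINT z:unit_disk|lborel. f z) /\<^sub>R measure lborel unit_disk"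
proof -
  have "integral\<^sup>L area f = (\<integral>z. (indicator unit_disk z / measure lborel unit_disk) *\<^sub>R f z \<partial>lborel)"
    unfolding area_eq_density by (rule integral_density) auto
  then show ?thesis unfolding disk_weight_scaleR set_lebesgue_integral_def
    by (simp only: integral_scaleR_right)
qed

lemma integrable_area:
  fixes f :: "complex \<Rightarrow> 'b::{banach, second_countable_topology}"
  assumes [measurable]: "f \<in> borel_measurable borel"
  shows "integrable area f \<longleftrightarrow> set_integrable lborel unit_disk f"
proof -
  have "integrable area f
      \<longleftrightarrow> integrable lborel (\<lambda>z. (indicator unit_disk z / measure lborel unit_disk) *\<^sub>R f z)"
    unfolding area_eq_density by (rule integrable_density) auto
  moreover have "integrable lborel (\<lambda>z. inverse c *\<^sub>R (indicator unit_disk z *\<^sub>R f z))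
      \<longleftrightarrow> integrable lborel (\<lambda>z. indicator unit_disk z *\<^sub>R f z)" (is "integrable _ ?g \<longleftrightarrow> _")
    if "c \<noteq> 0" for c
  proof
    assume "integrable lborel ?g"
    then have "integrable lborel (\<lambda>z. c *\<^sub>R ?g z)" by (rule integrable_scaleR_right)
    then show "integrable lborel (\<lambda>z. indicator unit_disk z *\<^sub>R f z)"
      using that by (simp add: mult.assoc[symmetric])
  qed (rule integrable_scaleR_right)
  ultimately show ?thesis
    using measure_unit_disk_pos by (simp only: disk_weight_scaleR set_integrable_def)
qed

lemma nn_integral_area:
  assumes [measurable]: "f \<in> borel_measurable borel"
  shows "integral\<^sup>N area f = ennreal (inverse (measure lborel unit_disk)) * (\<integral>\<^sup>+z\<in>unit_disk. f z \<partial>lborel)"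
proof -
  have "integral\<^sup>N area f
      = (\<integral>\<^sup>+z. ennreal (indicator unit_disk z / measure lborel unit_disk) * f z \<partial>lborel)"
    unfolding area_eq_density by (rule nn_integral_density) auto
  also have "\<dots> = (\<integral>\<^sup>+z. ennreal (inverse (measure lborel unit_disk)) * (f z * indicator unit_disk z) \<partial>lborel)"
    by (intro nn_integral_cong) (auto simp: indicator_def inverse_eq_divide)
  also have "\<dots> = ennreal (inverse (measure lborel unit_disk)) * (\<integral>\<^sup>+z\<in>unit_disk. f z \<partial>lborel)"
  proof (rule nn_integral_cmult)
    have "(\<lambda>z. f z * indicator unit_disk z) \<in> borel_measurable borel"
      by (intro borel_measurable_times_ennreal assms borel_measurable_indicator) auto
    then show "(\<lambda>z. f z * indicator unit_disk z) \<in> borel_measurable lborel" by simp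
  qed
  finally show ?thesis .
qed

lemma norm_bergman_square: "(norm (f :: bergman))\<^sup>2 = (\<integral>z. (cmod (Rep_bergman f z))\<^sup>2 \<partial>area)"
  by (simp add: power2_norm_eq_inner inner_bergman_def cinner_self)

lemma bergman_eqI:
  assumes "\<And>z. z \<in> unit_disk \<Longrightarrow> Rep_bergman f z = Rep_bergman g z"
  shows "f = g"
proof -
  have "Rep_bergman f z = Rep_bergman g z" for z
    using assms[of z] Rep_bergman_outside[of z f] Rep_bergman_outside[of z g] by (cases "z \<in> unit_disk") auto
  then show ?thesis by (simp add: Rep_bergman_inject[symmetric] fun_eq_iff)
qed

text \<open>The mean value property of the holomorphic function f^2 bounds |f(w)|^2 by an integral
  of |f|^2. The radius is halved because that property is available only for disks strictly inside
  the domain of holomorphy.\<close>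

lemma bergman_eval_bound:
  assumes r: "0 < r" and sub: "ball w r \<subseteq> unit_disk"
  shows "(cmod (Rep_bergman f w))\<^sup>2 * measure lborel (ball (0::complex) (r / 2))
     \<le> measure lborel unit_disk * (norm f)\<^sup>2"
proof -
  let ?f = "Rep_bergman f"
  have hol: "(\<lambda>z. (?f z)\<^sup>2) holomorphic_on ball w r"
    by (intro holomorphic_intros holomorphic_on_subset[OF Rep_bergman_holomorphic sub])
  have ball: "ball w (r / 2) \<subseteq> unit_disk" using sub r subset_ball[of "r / 2" r w] by auto
  have eq: "(LINT z:ball w (r / 2)|lborel. (?f z)\<^sup>2) = (?f w)\<^sup>2 * measure lborel (ball (0::complex) (r / 2))"
    by (rule area_mean_value[OF hol]) (use r in auto)
  have int: "set_integrable lborel unit_disk (\<lambda>z. (cmod (?f z))\<^sup>2)"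
    using Rep_bergman_square_integrable[of f] by (subst (asm) integrable_area) auto
  have int2: "set_integrable lborel (ball w (r / 2)) (\<lambda>z. (cmod (?f z))\<^sup>2)"
    by (rule set_integrable_subset[OF int]) (use ball in auto)
  have "(cmod (?f w))\<^sup>2 * measure lborel (ball (0::complex) (r / 2))
      = cmod (LINT z:ball w (r / 2)|lborel. (?f z)\<^sup>2)"
    unfolding eq by (simp add: norm_mult norm_power)
  also have "\<dots> \<le> (LINT z:ball w (r / 2)|lborel. (cmod (?f z))\<^sup>2)"
    unfolding set_lebesgue_integral_def
    by (rule order_trans[OF integral_norm_bound]) (simp add: norm_power)
  also have "\<dots> \<le> (LINT z:unit_disk|lborel. (cmod (?f z))\<^sup>2)"
    unfolding set_lebesgue_integral_def
    by (rule integral_mono) (use int int2 ball in \<open>auto simp: set_integrable_def indicator_def\<close>)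
  also have "\<dots> = measure lborel unit_disk * (norm f)\<^sup>2"
    using measure_unit_disk_pos by (simp add: norm_bergman_square integral_area)
  finally show ?thesis .
qed

text \<open>The radius \<open>r = 1 - \<rho>\<close> serves every centre of modulus at most \<rho>,
  so the constant is uniform. As a consequence, norm convergence implies locally uniform
  convergence.\<close>

lemma bergman_eval_uniform_bound:
  assumes \<rho>: "\<rho> < 1"
  obtains C where "C > 0" "\<And>f w. cmod w \<le> \<rho> \<Longrightarrow> cmod (Rep_bergman f w) \<le> C * norm f"
proof -
  define r where "r = 1 - \<rho>"
  have r: "r > 0" using \<rho> by (simp add: r_def)
  define m where "m = measure lborel (ball (0::complex) (r / 2))"
  have m: "m > 0" unfolding m_def using content_ball_pos[of "r/2" "0::complex"] r by simp
  define C where "C = sqrt (measure lborel unit_disk / m)"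
  have C: "C > 0" using m measure_unit_disk_pos by (simp add: C_def)
  have "cmod (Rep_bergman f w) \<le> C * norm f" if w: "cmod w \<le> \<rho>" for f w
  proof -
    have "ball w r \<subseteq> unit_disk"
    proof
      fix x assume "x \<in> ball w r"
      then have "cmod (x - w) < r" by (simp add: dist_norm norm_minus_commute)
      moreover have "cmod x \<le> cmod w + cmod (x - w)" using norm_triangle_ineq[of w "x - w"] by simp
      ultimately show "x \<in> unit_disk" using w by (simp add: r_def)
    qed
    from bergman_eval_bound[OF r this, of f]
    have "(cmod (Rep_bergman f w))\<^sup>2 \<le> measure lborel unit_disk * (norm f)\<^sup>2 / m"
      unfolding m_def[symmetric] pos_le_divide_eq[OF m] .
    also have "\<dots> = (C * norm f)\<^sup>2"
      using m measure_unit_disk_pos by (simp add: C_def power_mult_distrib)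
    finally have "(cmod (Rep_bergman f w))\<^sup>2 \<le> (C * norm f)\<^sup>2" .
    then show ?thesis using C by (rule_tac power2_le_imp_le) auto
  qed
  then show ?thesis using that C by blast
qed

text \<open>A Cauchy sequence converges uniformly on each disk of radius below 1, hence to a
  holomorphic function; square integrability of the limit and convergence in norm come from Fatou's
  lemma.\<close>

instance bergman :: complete_space
proof
  fix X :: "nat \<Rightarrow> bergman"
  assume X: "Cauchy X"
  let ?X = "\<lambda>n. Rep_bergman (X n)"
  define g where "g = (\<lambda>z. lim (\<lambda>n. ?X n z))"
  have ucauchy: "uniformly_convergent_on (cball 0 \<rho>) ?X" if \<rho>: "\<rho> < 1" for \<rho>
  proof (rule Cauchy_uniformly_convergent)
    obtain C where C: "C > 0" "\<And>f w. cmod w \<le> \<rho> \<Longrightarrow> cmod (Rep_bergman f w) \<le> C * norm f"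
      using bergman_eval_uniform_bound[OF \<rho>] by metis
    show "uniformly_Cauchy_on (cball 0 \<rho>) ?X"
    proof (rule uniformly_Cauchy_onI)
      fix e :: real assume e: "e > 0"
      then obtain N where N: "\<And>m n. m \<ge> N \<Longrightarrow> n \<ge> N \<Longrightarrow> dist (X m) (X n) < e / C"
        using X C(1) unfolding Cauchy_def by (metis divide_pos_pos)
      have "dist (?X m w) (?X n w) < e" if "m \<ge> N" "n \<ge> N" "w \<in> cball 0 \<rho>" for m n w
      proof -
        have "dist (?X m w) (?X n w) = cmod (Rep_bergman (X m - X n) w)"
          by (simp add: dist_norm Rep_bergman_simps)
        also have "\<dots> \<le> C * norm (X m - X n)" by (rule C(2)) (use that in simp)
        also have "\<dots> < C * (e / C)"
          using N[OF that(1,2)] C(1) by (intro mult_strict_left_mono) (auto simp: dist_norm)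
        finally show ?thesis using C(1) by simp
      qed
      then show "\<exists>M. \<forall>x\<in>cball 0 \<rho>. \<forall>m\<ge>M. \<forall>n\<ge>M. dist (?X m x) (?X n x) < e" by blast
    qed
  qed
  have ulim: "uniform_limit (cball 0 \<rho>) ?X g sequentially" if "\<rho> < 1" for \<rho>
    using ucauchy[OF that] unfolding g_def by (simp add: uniformly_convergent_uniform_limit_iff)
  have outside: "?X n z = 0" if "z \<notin> unit_disk" for n z using that by (rule Rep_bergman_outside)
  have g0: "g z = 0" if "z \<notin> unit_disk" for z
    using that by (simp add: g_def outside)
  have lim: "(\<lambda>n. ?X n z) \<longlonglongrightarrow> g z" for z
  proof (cases "z \<in> unit_disk")
    case True
    then show ?thesis using tendsto_uniform_limitI[OF ulim[of "cmod z"], of z] by simp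
  qed (simp add: outside g0)
  have ghol: "g holomorphic_on unit_disk"
  proof (rule holomorphic_uniform_sequence[OF open_ball Rep_bergman_holomorphic])
    fix z :: complex assume "z \<in> unit_disk"
    then have z: "cmod z < 1" by simp
    define d where "d = (1 - cmod z) / 2"
    have d: "d > 0" "cmod z + d < 1" using z by (auto simp: d_def field_simps)
    have sub: "cball z d \<subseteq> cball 0 (cmod z + d)"
    proof
      fix x assume "x \<in> cball z d"
      then have "cmod (x - z) \<le> d" by (simp add: dist_norm norm_minus_commute)
      then show "x \<in> cball 0 (cmod z + d)" using norm_triangle_ineq[of z "x - z"] by simp
    qed
    have "cball (0::complex) (cmod z + d) \<subseteq> unit_disk" using d by auto
    then show "\<exists>d>0. cball z d \<subseteq> unit_disk \<and> uniform_limit (cball z d) ?X g sequentially"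
      using d sub uniform_limit_on_subset[OF ulim[OF d(2)] sub] by blast
  qed
  have gm[measurable]: "g \<in> borel_measurable borel"
    by (rule holomorphic_disk_measurable[OF ghol g0])
  \<comment> \<open>The limit is taken in n with m fixed, so that the Cauchy estimate survives as a
    bound for g - X m.\<close>
  have fatou: "(\<integral>\<^sup>+z. ennreal ((cmod (g z - ?X m z))\<^sup>2) \<partial>area) \<le> ennreal e"
    if N: "\<And>n. n \<ge> N \<Longrightarrow> (norm (X n - X m))\<^sup>2 \<le> e" and e: "e \<ge> 0" for m N e
  proof -
    have l: "(\<lambda>n. ennreal ((cmod (?X n z - ?X m z))\<^sup>2)) \<longlonglongrightarrow> ennreal ((cmod (g z - ?X m z))\<^sup>2)" for z
      by (intro tendsto_ennrealI tendsto_intros lim)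
    have "(\<integral>\<^sup>+z. ennreal ((cmod (g z - ?X m z))\<^sup>2) \<partial>area)
        = (\<integral>\<^sup>+z. liminf (\<lambda>n. ennreal ((cmod (?X n z - ?X m z))\<^sup>2)) \<partial>area)"
      by (intro nn_integral_cong lim_imp_Liminf[symmetric] l) simp
    also have "\<dots> \<le> liminf (\<lambda>n. \<integral>\<^sup>+z. ennreal ((cmod (?X n z - ?X m z))\<^sup>2) \<partial>area)"
      by (rule nn_integral_liminf) measurable
    also have "\<dots> \<le> ennreal e"
    proof (rule Liminf_le)
      have eq: "(\<integral>\<^sup>+z. ennreal ((cmod (?X n z - ?X m z))\<^sup>2) \<partial>area) = ennreal ((norm (X n - X m))\<^sup>2)" for n
        unfolding norm_bergman_square
        using Rep_bergman_square_integrable[of "X n - X m"]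
        by (subst nn_integral_eq_integral) (auto simp: Rep_bergman_simps)
      show "\<forall>\<^sub>F n in sequentially. (\<integral>\<^sup>+z. ennreal ((cmod (?X n z - ?X m z))\<^sup>2) \<partial>area) \<le> ennreal e"
        unfolding eq using N e by (auto simp: eventually_sequentially intro!: exI[of _ N] ennreal_leI)
    qed simp
    finally show ?thesis .
  qed
  have Cauchy2: "\<exists>N. \<forall>m\<ge>N. \<forall>n\<ge>N. (norm (X n - X m))\<^sup>2 \<le> e" if "e > 0" for e
  proof -
    obtain N where N: "\<And>m n. m \<ge> N \<Longrightarrow> n \<ge> N \<Longrightarrow> dist (X m) (X n) < sqrt e"
      using X \<open>e > 0\<close> unfolding Cauchy_def by (metis real_sqrt_gt_zero)
    have "(norm (X n - X m))\<^sup>2 \<le> e" if "m \<ge> N" "n \<ge> N" for m n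
    proof -
      have "norm (X n - X m) \<le> sqrt e" using N[OF that(2,1)] by (simp add: dist_norm)
      then have "(norm (X n - X m))\<^sup>2 \<le> (sqrt e)\<^sup>2" by (intro power_mono) auto
      then show ?thesis using \<open>e > 0\<close> by simp
    qed
    then show ?thesis by blast
  qed
  obtain N1 where N1: "\<And>m n. m \<ge> N1 \<Longrightarrow> n \<ge> N1 \<Longrightarrow> (norm (X n - X m))\<^sup>2 \<le> 1"
    using Cauchy2[of 1] by auto
  \<comment> \<open>Membership is shown for the difference from a single X N1, and the limit is then
    a sum of two elements of the space.\<close>
  have "integrable area (\<lambda>z. (cmod (g z - ?X N1 z))\<^sup>2)"
  proof (rule integrableI_bounded)
    have "(\<integral>\<^sup>+z. ennreal (norm ((cmod (g z - ?X N1 z))\<^sup>2)) \<partial>area) \<le> ennreal 1"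
      using fatou[of N1 N1 1] N1 by simp
    then show "(\<integral>\<^sup>+z. ennreal (norm ((cmod (g z - ?X N1 z))\<^sup>2)) \<partial>area) < \<infinity>"
      by (rule le_less_trans) simp
  qed measurable
  then have "(\<lambda>z. g z - ?X N1 z) \<in> {f. f holomorphic_on unit_disk \<and> (\<forall>z. z \<notin> unit_disk \<longrightarrow> f z = 0)
     \<and> integrable area (\<lambda>z. (cmod (f z))\<^sup>2)}"
    using g0 outside by (auto intro!: holomorphic_intros ghol Rep_bergman_holomorphic)
  then have Rh: "Rep_bergman (Abs_bergman (\<lambda>z. g z - ?X N1 z)) = (\<lambda>z. g z - ?X N1 z)"
    by (rule Abs_bergman_inverse)
  define G where "G = X N1 + Abs_bergman (\<lambda>z. g z - ?X N1 z)"
  have G: "Rep_bergman G = g" by (simp add: G_def Rep_bergman_simps Rh)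
  have "X \<longlonglongrightarrow> G"
  proof (rule metric_LIMSEQ_I)
    fix e :: real assume e: "e > 0"
    obtain N where N: "\<And>m n. m \<ge> N \<Longrightarrow> n \<ge> N \<Longrightarrow> (norm (X n - X m))\<^sup>2 \<le> (e/2)\<^sup>2"
      using Cauchy2[of "(e/2)\<^sup>2"] e by auto
    have "dist (X m) G < e" if "m \<ge> N" for m
    proof -
      have "ennreal ((norm (G - X m))\<^sup>2) = (\<integral>\<^sup>+z. ennreal ((cmod (g z - ?X m z))\<^sup>2) \<partial>area)"
        unfolding norm_bergman_square using Rep_bergman_square_integrable[of "G - X m"]
        by (subst nn_integral_eq_integral) (auto simp: Rep_bergman_simps G)
      also have "\<dots> \<le> ennreal ((e/2)\<^sup>2)" by (rule fatou[of N]) (use N that in auto)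
      finally have "(norm (G - X m))\<^sup>2 \<le> (e/2)\<^sup>2" by (subst (asm) ennreal_le_iff) auto
      then have "norm (G - X m) \<le> e/2" using e by (rule_tac power2_le_imp_le) auto
      then show ?thesis using e by (simp add: dist_norm norm_minus_commute)
    qed
    then show "\<exists>no. \<forall>n\<ge>no. dist (X n) G < e" by blast
  qed
  then show "convergent X" by (auto simp: convergent_def)
qed

section \<open>Adjoints and projections for the Hermitian inner product\<close>

lemma cinner_eqI_right:
  assumes "\<And>f. cinner f u = cinner f v"
  shows "u = v"
proof -
  have "inner f u = inner f v" for f by (simp add: inner_bergman_def assms)
  then show ?thesis using vector_eq_ldot by blast
qed

lemma Im_cinner: "Im (cinner f g) = - inner (cscale \<i> f) g"
  by (simp add: inner_bergman_def cinner_cscale_left)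

text \<open>Multiplication by i exchanges real and imaginary parts, so the real inner products with
  all complex multiples of f determine the Hermitian one. This lifts results on the real Hilbert
  space, such as the Riesz representation, to the complex one.\<close>

lemma cinner_eqI_inner:
  assumes "\<And>c. inner (cscale c f) g = inner (cscale c f') g'"
  shows "cinner f g = cinner f' g'"
proof (rule complex_eqI)
  have "cscale 1 h = h" for h by (rule bergman_eqI) (simp add: Rep_cscale)
  then show "Re (cinner f g) = Re (cinner f' g')"
    using assms[of 1] by (simp add: inner_bergman_def)
  show "Im (cinner f g) = Im (cinner f' g')" using assms[of \<i>] by (simp add: Im_cinner)
qed

lemma cinner_add_right: "cinner f (g + h) = cinner f g + cinner f h"
  by (metis cinner_add_left cinner_commute complex_cnj_add)

lemma cinner_cscale_right: "cinner f (cscale c g) = cnj c * cinner f g"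
  by (metis cinner_cscale_left cinner_commute complex_cnj_mult)

lemma scaleR_eq_cscale: "r *\<^sub>R f = cscale (of_real r) f"
  by (simp add: scaleR_bergman_def)

lemma cscale_add: "cscale c (f + g) = cscale c f + cscale c g"
  by (rule bergman_eqI) (simp add: Rep_bergman_simps algebra_simps)

lemma cscale_cscale: "cscale c (cscale d f) = cscale (c * d) f"
  by (rule bergman_eqI) (simp add: Rep_bergman_simps)

lemma cscale_add_left: "cscale (c + d) f = cscale c f + cscale d f"
  by (rule bergman_eqI) (simp add: Rep_bergman_simps algebra_simps)

lemma cscale_one [simp]: "cscale 1 f = f"
  by (rule bergman_eqI) (simp add: Rep_cscale)

lemma cscale_zero [simp]: "cscale 0 f = 0"
  by (rule bergman_eqI) (simp add: Rep_bergman_simps)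

lemma norm_cscale: "norm (cscale c f) = cmod c * norm f"
proof -
  have "(norm (cscale c f))\<^sup>2 = (cmod c * norm f)\<^sup>2"
    by (simp add: norm_bergman_square Rep_cscale norm_mult power_mult_distrib)
  then show ?thesis by (simp add: power2_eq_iff_nonneg)
qed

lemma bounded_clinearI:
  assumes add: "\<And>f g. T (f + g) = T f + T g" and scale: "\<And>c f. T (cscale c f) = cscale c (T f)"
    and bound: "\<And>f. norm (T f) \<le> K * norm f"
  shows "bounded_clinear T"
  unfolding bounded_clinear_def
proof
  show "bounded_linear T"
    by (rule bounded_linear_intro[of _ K]) (auto simp: add scale scaleR_eq_cscale bound mult.commute)
qed (simp add: scale)

lemma bounded_clinear_bounded:
  assumes "bounded_clinear T"
  obtains K where "K \<ge> 0" "\<And>f. norm (T f) \<le> K * norm f"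
  using assms unfolding bounded_clinear_def
  by (metis bounded_linear.nonneg_bounded mult.commute)

lemma bounded_clinear_add: "bounded_clinear T \<Longrightarrow> T (f + g) = T f + T g"
  unfolding bounded_clinear_def by (simp add: bounded_linear.linear linear_add)

lemma bounded_clinear_cscale: "bounded_clinear T \<Longrightarrow> T (cscale c f) = cscale c (T f)"
  unfolding bounded_clinear_def by simp

text \<open>Testing the adjoint relation on S f gives |S f|^2 = <T S f, f>, and hence the operator
  bound of T for S.\<close>

lemma adjoint_bounded_clinear:
  assumes T: "bounded_clinear T" and adj: "\<And>f g. cinner (T f) g = cinner f (S g)"
  shows "bounded_clinear S"
proof -
  obtain K where K: "K \<ge> 0" "\<And>f. norm (T f) \<le> K * norm f" using bounded_clinear_bounded[OF T] by blast
  show ?thesis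
  proof (rule bounded_clinearI[of _ K])
    show "S (f + g) = S f + S g" for f g
      by (rule cinner_eqI_right) (simp add: cinner_add_right adj[symmetric])
    show "S (cscale c f) = cscale c (S f)" for c f
      by (rule cinner_eqI_right) (simp add: cinner_cscale_right adj[symmetric])
    fix f
    have "(norm (S f))\<^sup>2 = inner (T (S f)) f"
      by (simp add: power2_norm_eq_inner inner_bergman_def adj)
    also have "\<dots> \<le> norm (T (S f)) * norm f" by (rule norm_cauchy_schwarz)
    also have "\<dots> \<le> K * norm (S f) * norm f" by (intro mult_right_mono K) simp
    finally have "norm (S f) * norm (S f) \<le> (K * norm f) * norm (S f)"
      by (simp add: power2_eq_square mult_ac)
    then show "norm (S f) \<le> K * norm f"
      using K(1) by (cases "norm (S f) = 0") (auto simp: mult_le_cancel_right)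
  qed
qed

lemma adjoint_exists:
  assumes T: "bounded_clinear T"
  obtains S where "bounded_clinear S" "\<And>f g. cinner (T f) g = cinner f (S g)"
proof -
  have "\<exists>s. \<forall>f. inner (T f) g = inner f s" for g
    by (rule riesz_representation, rule bounded_linear_inner_left_comp)
       (use T in \<open>simp add: bounded_clinear_def\<close>)
  then obtain S where S: "\<And>f g. inner (T f) g = inner f (S g)" by metis
  have "cinner (T f) g = cinner f (S g)" for f g
    by (rule cinner_eqI_inner) (use T S in \<open>simp add: bounded_clinear_def flip: S\<close>)
  then show ?thesis using that adjoint_bounded_clinear[OF T] by blast
qed

lemma cinner_cadjoint:
  assumes T: "bounded_clinear T"
  shows "cinner (T f) g = cinner f (cadjoint T g)"
proof -
  obtain S where S: "\<And>f g. cinner (T f) g = cinner f (S g)" using adjoint_exists[OF T] by metis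
  have "cadjoint T = S"
    unfolding cadjoint_def
  proof (rule the_equality)
    fix S' assume "\<forall>f g. cinner (T f) g = cinner f (S' g)"
    then show "S' = S" by (intro ext cinner_eqI_right) (simp add: S)
  qed (simp add: S)
  then show ?thesis by (simp add: S)
qed

lemma bounded_clinear_cadjoint: "bounded_clinear T \<Longrightarrow> bounded_clinear (cadjoint T)"
  using adjoint_bounded_clinear cinner_cadjoint by blast

text \<open>Passing to adjoints reverses the order of products. Membership in the algebra thus
  becomes a condition on T and its adjoint S relative to M alone; M will be a multiplication, which
  acts pointwise, unlike its adjoint.\<close>

lemma commutant_cadjoint_iff:
  assumes M: "bounded_clinear M" and T: "bounded_clinear T"
    and S: "\<And>f g. cinner (T f) g = cinner f (S g)"
  shows "T \<circ> cadjoint M = cadjoint M \<circ> T \<longleftrightarrow> S \<circ> M = M \<circ> S"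
proof -
  note adj = cinner_cadjoint[OF M]
  have adj': "cinner (cadjoint M f) g = cinner f (M g)" for f g
    using adj[of g f] by (metis cinner_commute)
  have 1: "cinner (T (cadjoint M f)) g = cinner f (M (S g))" for f g by (simp add: S adj')
  have 2: "cinner (cadjoint M (T f)) g = cinner f (S (M g))" for f g by (simp add: S adj')
  have "(\<forall>f g. cinner (T (cadjoint M f)) g = cinner (cadjoint M (T f)) g) \<longleftrightarrow> T \<circ> cadjoint M = cadjoint M \<circ> T"
  proof
    assume *: "\<forall>f g. cinner (T (cadjoint M f)) g = cinner (cadjoint M (T f)) g"
    show "T \<circ> cadjoint M = cadjoint M \<circ> T"
      by (rule ext, rule cinner_eqI_right) (metis * cinner_commute comp_apply)
  qed (metis comp_apply)
  moreover have "(\<forall>f g. cinner f (M (S g)) = cinner f (S (M g))) \<longleftrightarrow> S \<circ> M = M \<circ> S"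
  proof
    assume *: "\<forall>f g. cinner f (M (S g)) = cinner f (S (M g))"
    show "S \<circ> M = M \<circ> S"
      by (rule ext, rule cinner_eqI_right) (simp add: *)
  qed (metis comp_apply)
  ultimately show ?thesis unfolding 1 2 by blast
qed

lemma orthogonal_projection_exists:
  assumes M: "csubspace M" "closed M"
  obtains P where "bounded_clinear P" "\<And>f. P f \<in> M" "\<And>f. f \<in> M \<Longrightarrow> P f = f"
    "\<And>f g. cinner (P f) g = cinner f (P g)"
proof -
  have sub: "subspace M" and sc: "\<And>c f. f \<in> M \<Longrightarrow> cscale c f \<in> M"
    using M(1) by (auto simp: csubspace_def)
  have "\<exists>m. m \<in> M \<and> (\<forall>y\<in>M. inner (f - m) y = 0)" for f
    using orthogonal_decomposition_exists[OF sub, of f] M(2) complete_eq_closed by blast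
  then obtain P where P: "\<And>f. P f \<in> M" "\<And>f y. y \<in> M \<Longrightarrow> inner (f - P f) y = 0" by metis
  \<comment> \<open>The nearest point gives only real orthogonality; invariance of M under complex
    scalars upgrades it to the Hermitian one.\<close>
  have orth: "cinner y (f - P f) = 0" if "y \<in> M" for f y
  proof -
    have "cinner y (f - P f) = cinner y 0"
      by (rule cinner_eqI_inner) (use P(2)[OF sc[OF that]] in \<open>simp add: inner_commute\<close>)
    then show ?thesis by (simp add: cinner_def Rep_zero_bergman)
  qed
  have uniq: "P f = m" if "m \<in> M" "\<And>y. y \<in> M \<Longrightarrow> cinner y (f - m) = 0" for f m
  proof -
    have d: "P f - m \<in> M" using P(1) that(1) sub by (simp add: subspace_diff)
    have "cinner (P f - m) (P f - m) = cinner (P f - m) ((f - m) + cscale (-1) (f - P f))"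
      by (simp add: uminus_bergman_def[symmetric])
    also have "\<dots> = 0" unfolding cinner_add_right cinner_cscale_right orth[OF d] that(2)[OF d] by simp
    finally show ?thesis using cinner_self_eq_0 by force
  qed
  have sym: "cinner (P f) g = cinner f (P g)" for f g
  proof -
    have "cinner (P f) g = cinner (P f) (P g)"
      using orth[OF P(1)[of f], of g] cinner_add_right[of "P f" "g - P g" "P g"] by simp
    moreover have "cinner (P g) f = cinner (P g) (P f)"
      using orth[OF P(1)[of g], of f] cinner_add_right[of "P g" "f - P f" "P f"] by simp
    ultimately show ?thesis by (metis cinner_commute)
  qed
  have "bounded_clinear P"
  proof (rule bounded_clinearI[of _ 1])
    show "P (f + g) = P f + P g" for f g
      by (rule cinner_eqI_right) (simp add: sym[symmetric] cinner_add_right)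
    show "P (cscale c f) = cscale c (P f)" for c f
      by (rule cinner_eqI_right) (simp add: sym[symmetric] cinner_cscale_right)
    fix f
    have "inner (f - P f) (P f) = 0" using P by simp
    then have "(norm (P f))\<^sup>2 = inner f (P f)" by (simp add: power2_norm_eq_inner inner_diff)
    also have "\<dots> \<le> norm f * norm (P f)" by (rule norm_cauchy_schwarz)
    finally have "norm (P f) * norm (P f) \<le> norm f * norm (P f)" by (simp add: power2_eq_square)
    then show "norm (P f) \<le> 1 * norm f"
      by (cases "norm (P f) = 0") (auto simp: mult_le_cancel_right)
  qed
  moreover have "P f = f" if "f \<in> M" for f
    by (rule uniq) (use that in \<open>auto simp: cinner_def Rep_zero_bergman\<close>)
  ultimately show ?thesis using that P(1) sym by blast
qed

definition bergman_of :: "(complex \<Rightarrow> complex) \<Rightarrow> bergman"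
  where "bergman_of f = Abs_bergman (\<lambda>z. if z \<in> unit_disk then f z else 0)"

lemma integrable_area_const: "integrable area (\<lambda>z. c :: real)"
proof -
  have "emeasure area (space area) < \<infinity>"
    unfolding area_def by (subst emeasure_uniform_measure) (auto simp: emeasure_unit_disk divide_ennreal measure_unit_disk_pos)
  then have "finite_measure area" by (intro finite_measureI) auto
  then show ?thesis by (rule finite_measure.integrable_const)
qed

lemma Rep_bergman_of:
  assumes f: "f holomorphic_on unit_disk" and b: "\<And>z. z \<in> unit_disk \<Longrightarrow> cmod (f z) \<le> B"
    and z: "z \<in> unit_disk"
  shows "Rep_bergman (bergman_of f) z = f z"
proof -
  have "Rep_bergman (bergman_of f) = (\<lambda>z. if z \<in> unit_disk then f z else 0)"
    unfolding bergman_of_def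
  proof (rule Abs_bergman_inverse, rule bergman_memI)
    show "(\<lambda>z. if z \<in> unit_disk then f z else 0) holomorphic_on unit_disk"
      by (subst holomorphic_cong[OF refl, of _ _ f]) (use f in auto)
    show "integrable area (\<lambda>z. B\<^sup>2)" by (rule integrable_area_const)
    show "(cmod (if z \<in> unit_disk then f z else 0))\<^sup>2 \<le> B\<^sup>2" for z
      using b[of z] by (auto intro: power_mono)
  qed auto
  then show ?thesis using z by simp
qed

section \<open>Blaschke products\<close>

text \<open>The Noshiro-Warschawski theorem: along the segment from x to y the real part of f
  divided by y - x has derivative Re f' > 0, so the values at the endpoints differ.\<close>

lemma inj_on_Re_deriv_pos:
  assumes S: "convex S" "open S" and f: "f holomorphic_on S"
    and pos: "\<And>z. z \<in> S \<Longrightarrow> Re (deriv f z) > 0"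
  shows "inj_on f S"
proof (rule inj_onI, rule ccontr)
  fix x y assume xy: "x \<in> S" "y \<in> S" "f x = f y" "x \<noteq> y"
  define v where "v = y - x"
  have v: "v \<noteq> 0" using xy by (simp add: v_def)
  have in_S: "x + of_real t * v \<in> S" if "0 \<le> t" "t \<le> 1" for t
  proof -
    have "x + of_real t * v = (1 - t) *\<^sub>R x + t *\<^sub>R y" by (simp add: v_def scaleR_conv_of_real algebra_simps)
    then show ?thesis using convexD_alt[OF S(1) xy(1,2) that] by simp
  qed
  define F where "F = (\<lambda>t. Re (f (x + of_real t * v) / v))"
  have der: "(F has_real_derivative Re (deriv f (x + of_real t * v))) (at t)" if "0 \<le> t" "t \<le> 1" for t
  proof -
    have "(f has_field_derivative deriv f (x + of_real t * v)) (at (x + of_real t * v))"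
      using f S(2) in_S[OF that] holomorphic_derivI by blast
    moreover have "((\<lambda>t. x + of_real t * v) has_vector_derivative v) (at t)"
      by (auto intro!: derivative_eq_intros)
    ultimately have "((\<lambda>t. f (x + of_real t * v)) has_vector_derivative v * deriv f (x + of_real t * v)) (at t)"
      using field_vector_diff_chain_at[of "\<lambda>t. x + of_real t * v" v t f] by (simp add: o_def)
    then have "((\<lambda>t. f (x + of_real t * v) / v) has_vector_derivative (v * deriv f (x + of_real t * v)) / v) (at t)"
      by (rule has_vector_derivative_divide)
    then have "((\<lambda>t. f (x + of_real t * v) / v) has_vector_derivative deriv f (x + of_real t * v)) (at t)"
      using v by simp
    then show ?thesis unfolding F_def
      by (rule has_field_derivative_Re)
  qed
  have "F 0 < F 1"
    by (rule DERIV_pos_imp_increasing) (use der pos in_S in auto)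
  moreover have "F 0 = F 1" using xy by (simp add: F_def v_def)
  ultimately show False by simp
qed

text \<open>The sign of the right-hand side decides on which side of the unit circle a Blaschke
  factor takes its value.\<close>

lemma moebius_identity:
  "(cmod (1 - cnj a * z))\<^sup>2 - (cmod (z - a))\<^sup>2 = (1 - (cmod a)\<^sup>2) * (1 - (cmod z)\<^sup>2)"
  unfolding cmod_power2 by (simp add: power2_eq_square algebra_simps)

lemma moebius_lt:
  assumes "cmod a < 1" "cmod z < 1"
  shows "cmod ((z - a) / (1 - cnj a * z)) < 1"
proof -
  have "(cmod a)\<^sup>2 < 1" "(cmod z)\<^sup>2 < 1" using assms by (auto simp: power_less_one_iff)
  then have "(cmod (z - a))\<^sup>2 < (cmod (1 - cnj a * z))\<^sup>2"
    using moebius_identity[of a z] by (smt (verit) mult_pos_pos)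
  then have "cmod (z - a) < cmod (1 - cnj a * z)" by (rule power2_less_imp_less) simp
  moreover from this have "0 < cmod (1 - cnj a * z)" by (metis norm_ge_zero le_less_trans)
  ultimately show ?thesis by (simp add: norm_divide)
qed

lemma moebius_eq:
  assumes "cmod a < 1" "cmod z = 1"
  shows "cmod ((z - a) / (1 - cnj a * z)) = 1"
proof -
  have "(cmod (z - a))\<^sup>2 = (cmod (1 - cnj a * z))\<^sup>2"
    using moebius_identity[of a z] assms by simp
  then have eq: "cmod (z - a) = cmod (1 - cnj a * z)" by (simp add: power2_eq_iff_nonneg)
  moreover from assms have "z - a \<noteq> 0" by auto
  ultimately have "cmod (1 - cnj a * z) \<noteq> 0" by (metis norm_eq_zero)
  then show ?thesis using eq by (simp add: norm_divide)
qed

lemma prod_lt_one: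
  fixes f :: "'a \<Rightarrow> real"
  assumes "finite A" "A \<noteq> {}" "\<And>i. i \<in> A \<Longrightarrow> 0 \<le> f i \<and> f i < 1"
  shows "prod f A < 1"
  using assms
proof (induction A rule: finite_ne_induct)
  case (insert x F)
  have "prod f F \<ge> 0" using insert.prems by (intro prod_nonneg) auto
  moreover have "prod f F < 1" using insert by auto
  ultimately have "f x * prod f F < 1"
    using insert.prems[of x] by (metis insertI1 mult_le_one mult_less_cancel_left2 order_less_le less_le_not_le mult_cancel_right1 linorder_not_less mult_left_le)
  then show ?case using insert by simp
qed auto

locale blaschke_product =
  fixes n :: nat and a :: "nat \<Rightarrow> complex" and \<phi> :: "complex \<Rightarrow> complex"
  assumes n: "1 \<le> n" and a: "\<And>j. j \<in> {1..n} \<Longrightarrow> cmod (a j) < 1" and \<phi>: "\<phi> = blaschke n a"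
begin

definition fibre :: "complex \<Rightarrow> complex set"
  where "fibre l = {w \<in> unit_disk. \<phi> w = l}"

definition regular_values :: "complex set"
  where "regular_values = unit_disk - \<phi> ` critical_points \<phi>"

definition regular_points :: "complex set"
  where "regular_points = unit_disk - branch_fibres \<phi>"

lemma \<phi>_eq: "\<phi> z = (\<Prod>j=1..n. (z - a j) / (1 - cnj (a j) * z))"
  by (simp add: \<phi> blaschke_def)

lemma denom_nonzero: "j \<in> {1..n} \<Longrightarrow> cmod z \<le> 1 \<Longrightarrow> 1 - cnj (a j) * z \<noteq> 0"
  using blaschke_denom_nonzero[of "a j" z] a by simp

lemma \<phi>_lt: "cmod z < 1 \<Longrightarrow> cmod (\<phi> z) < 1"
  unfolding \<phi>_eq prod_norm[symmetric]
  by (rule prod_lt_one) (use n a moebius_lt in auto)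

lemma \<phi>_eq_1: "cmod z = 1 \<Longrightarrow> cmod (\<phi> z) = 1"
  unfolding \<phi>_eq prod_norm[symmetric]
  by (rule prod.neutral) (use a moebius_eq in auto)

lemma continuous_on_\<phi>: "continuous_on (cball 0 1) \<phi>"
proof -
  have "continuous_on (cball 0 1) (\<lambda>z. \<Prod>j=1..n. (z - a j) / (1 - cnj (a j) * z))"
    by (intro continuous_intros) (use denom_nonzero in auto)
  then show ?thesis by (simp add: \<phi>_eq[abs_def])
qed

lemma holomorphic_on_\<phi>: "\<phi> holomorphic_on unit_disk"
proof -
  have "(\<lambda>z. \<Prod>j=1..n. (z - a j) / (1 - cnj (a j) * z)) holomorphic_on unit_disk"
    by (intro holomorphic_intros) (use denom_nonzero in auto)
  then show ?thesis by (simp add: \<phi>_eq[abs_def])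
qed

text \<open>Clearing denominators turns the fibre into zeros of a polynomial of degree at most n.
  Only the upper bound is obtained here; fibres with exactly n points are exhibited near the
  circle.\<close>

lemma fibre_finite_card:
  assumes l: "cmod l < 1"
  shows "finite (fibre l)" "card (fibre l) \<le> n"
proof -
  define P where "P = (\<Prod>j=1..n. [:- a j, 1:])"
  define Q where "Q = (\<Prod>j=1..n. [:1, - cnj (a j):])"
  have P: "poly P z = (\<Prod>j=1..n. z - a j)" for z by (simp add: P_def poly_prod)
  have Q: "poly Q z = (\<Prod>j=1..n. 1 - cnj (a j) * z)" for z
    by (simp add: Q_def poly_prod mult.commute)
  have Q0: "poly Q z \<noteq> 0" if "cmod z \<le> 1" for z
    unfolding Q using denom_nonzero that by (simp add: prod_zero_iff)
  have PQ: "\<phi> z = poly P z / poly Q z" for z by (simp add: \<phi>_eq P Q prod_dividef)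
  define p where "p = P - smult l Q"
  \<comment> \<open>Leading coefficients might cancel, so p is seen to be nonzero at a point: on the
    unit circle |\<phi>| = 1, which excludes \<phi> 1 = l.\<close>
  have "poly p 1 \<noteq> 0"
  proof
    assume "poly p 1 = 0"
    then have "\<phi> 1 = l" using Q0[of 1] by (simp add: PQ p_def field_simps)
    then show False using \<phi>_eq_1[of 1] l by simp
  qed
  then have p0: "p \<noteq> 0" by auto
  have "degree P \<le> n" "degree Q \<le> n"
  proof -
    have "degree P \<le> (\<Sum>j=1..n. degree [:- a j, 1:])"
      unfolding P_def by (rule order_trans[OF degree_prod_sum_le]) auto
    then show "degree P \<le> n" by simp
    have "degree Q \<le> (\<Sum>j=1..n. degree [:1, - cnj (a j):])"
      unfolding Q_def by (rule order_trans[OF degree_prod_sum_le]) auto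
    also have "\<dots> \<le> (\<Sum>j=1..n. 1)" by (intro sum_mono) auto
    finally show "degree Q \<le> n" by simp
  qed
  then have deg: "degree p \<le> n"
    unfolding p_def by (intro degree_diff_le) (auto intro: order_trans[OF degree_smult_le])
  have sub: "fibre l \<subseteq> {z. poly p z = 0}"
    using Q0 by (auto simp: fibre_def PQ p_def field_simps)
  have fin: "finite {z. poly p z = 0}" by (rule poly_roots_finite[OF p0])
  show "finite (fibre l)" by (rule finite_subset[OF sub fin])
  show "card (fibre l) \<le> n"
    using card_mono[OF fin sub] card_poly_roots_bound[OF p0] deg by linarith
qed

text \<open>A branch of \<open>log (\<phi> (exp s))\<close> near the imaginary axis.\<close>

definition strip_log :: "complex \<Rightarrow> complex"
  where "strip_log s = of_nat n * s + (\<Sum>j=1..n. Ln (1 - a j * exp (- s)) - Ln (1 - cnj (a j) * exp s))"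

text \<open>The logarithmic derivative z \<phi>'(z) / \<phi>(z). Keeping \<open>a j / z\<close> in
  the denominator makes each summand a Poisson kernel on the unit circle.\<close>

definition strip_deriv :: "complex \<Rightarrow> complex"
  where "strip_deriv z = (\<Sum>j=1..n. (1 - a j * cnj (a j)) / ((1 - a j / z) * (1 - cnj (a j) * z)))"

section \<open>Behaviour of \<phi> near the unit circle\<close>

lemma zeros_bound: obtains \<rho> where "0 < \<rho>" "\<rho> < 1" "\<And>j. j \<in> {1..n} \<Longrightarrow> cmod (a j) < \<rho>"
proof -
  define m where "m = Max ((\<lambda>j. cmod (a j)) ` {1..n})"
  have m: "m < 1" unfolding m_def using n a by (subst Max_less_iff) auto
  have le: "cmod (a j) \<le> m" if "j \<in> {1..n}" for j unfolding m_def using that by (intro Max_ge) auto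
  have "0 \<le> m" using le[of 1] n order_trans[OF norm_ge_zero[of "a 1"]] by auto
  show ?thesis
  proof (rule that)
    show "0 < (1 + m) / 2" using \<open>0 \<le> m\<close> by auto
    show "(1 + m) / 2 < 1" using m by simp
    show "cmod (a j) < (1 + m) / 2" if "j \<in> {1..n}" for j using le[OF that] m by simp
  qed
qed

lemma Ln_one_minus:
  assumes "cmod w < 1"
  shows "Re (1 - w) > 0" "1 - w \<noteq> 0" "1 - w \<notin> \<real>\<^sub>\<le>\<^sub>0"
proof -
  have "\<bar>Re w\<bar> < 1" using assms abs_Re_le_cmod[of w] by linarith
  then show *: "Re (1 - w) > 0" by simp
  then show "1 - w \<noteq> 0" "1 - w \<notin> \<real>\<^sub>\<le>\<^sub>0" by (auto simp: complex_nonpos_Reals_iff)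
qed

text \<open>With z = exp s, each factor z - a is written as z (1 - a / z); both 1 - a / z and 1 -
  cnj a * z then lie in the right half plane, where the principal logarithm is holomorphic. The last
  claim holds as each principal logarithm has imaginary part of modulus at most \<pi>; it will
  confine points s whose images stay bounded.\<close>

lemma strip_log_facts:
  assumes s: "\<And>j. j \<in> {1..n} \<Longrightarrow> cmod (a j * exp (- s)) < 1 \<and> cmod (cnj (a j) * exp s) < 1"
  shows "exp (strip_log s) = \<phi> (exp s)"
    and "(strip_log has_field_derivative strip_deriv (exp s)) (at s)"
    and "\<bar>Im (strip_log s) - real n * Im s\<bar> \<le> 2 * pi * real n"
proof -
  have "exp (strip_log s) = exp (of_nat n * s) * (\<Prod>j=1..n. (1 - a j * exp (- s)) / (1 - cnj (a j) * exp s))"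
  proof -
    have "exp (Ln (1 - a j * exp (- s)) - Ln (1 - cnj (a j) * exp s))
        = (1 - a j * exp (- s)) / (1 - cnj (a j) * exp s)" if "j \<in> {1..n}" for j
      using s[OF that] Ln_one_minus(2) by (simp only: exp_diff) (subst exp_Ln, blast, subst exp_Ln, auto)
    then have "(\<Prod>j=1..n. exp (Ln (1 - a j * exp (- s)) - Ln (1 - cnj (a j) * exp s)))
        = (\<Prod>j=1..n. (1 - a j * exp (- s)) / (1 - cnj (a j) * exp s))"
      by (rule prod.cong[OF refl])
    then show ?thesis unfolding strip_log_def by (simp only: exp_add exp_sum finite_atLeastAtMost)
  qed
  also have "exp (of_nat n * s) = (\<Prod>j=1..n. exp s)" by (simp add: exp_of_nat_mult)
  also have "(\<Prod>j=1..n. exp s) * (\<Prod>j=1..n. (1 - a j * exp (- s)) / (1 - cnj (a j) * exp s)) = \<phi> (exp s)"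
    unfolding \<phi>_eq prod.distrib[symmetric]
    by (intro prod.cong) (auto simp: algebra_simps exp_minus)
  finally show "exp (strip_log s) = \<phi> (exp s)" .
  have "(strip_log has_field_derivative
      of_nat n + (\<Sum>j=1..n. (a j * exp (- s)) / (1 - a j * exp (- s)) - (- cnj (a j) * exp s) / (1 - cnj (a j) * exp s))) (at s)"
  proof -
    have "((\<lambda>s. Ln (1 - a j * exp (- s)) - Ln (1 - cnj (a j) * exp s)) has_field_derivative
        (a j * exp (- s)) / (1 - a j * exp (- s)) - (- cnj (a j) * exp s) / (1 - cnj (a j) * exp s)) (at s)"
      if "j \<in> {1..n}" for j
    proof -
      have nz: "1 - a j * exp (- s) \<notin> \<real>\<^sub>\<le>\<^sub>0" "1 - cnj (a j) * exp s \<notin> \<real>\<^sub>\<le>\<^sub>0"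
        using s[OF that] Ln_one_minus(3) by blast+
      have "((\<lambda>s. Ln (1 - a j * exp (- s))) has_field_derivative (a j * exp (- s)) / (1 - a j * exp (- s))) (at s)"
        by (rule derivative_eq_intros refl nz(1))+ (simp add: divide_inverse mult.commute)
      moreover have "((\<lambda>s. Ln (1 - cnj (a j) * exp s)) has_field_derivative (- cnj (a j) * exp s) / (1 - cnj (a j) * exp s)) (at s)"
        by (rule derivative_eq_intros refl nz(2))+ (simp add: divide_inverse mult.commute)
      ultimately show ?thesis by (rule DERIV_diff)
    qed
    moreover have "((*) (of_nat n) has_field_derivative of_nat n) (at s)"
      by (auto intro!: derivative_eq_intros)
    ultimately show ?thesis unfolding strip_log_def[abs_def] by (intro DERIV_add DERIV_sum) auto
  qed
  also have "of_nat n + (\<Sum>j=1..n. (a j * exp (- s)) / (1 - a j * exp (- s)) - (- cnj (a j) * exp s) / (1 - cnj (a j) * exp s))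
     = (\<Sum>j=1..n. 1 + ((a j * exp (- s)) / (1 - a j * exp (- s)) - (- cnj (a j) * exp s) / (1 - cnj (a j) * exp s)))"
    by (simp add: sum.distrib)
  also have "\<dots> = strip_deriv (exp s)"
    unfolding strip_deriv_def
  proof (intro sum.cong refl)
    fix j assume j: "j \<in> {1..n}"
    define x where "x = a j * exp (- s)"
    define y where "y = cnj (a j) * exp s"
    have nz: "1 - x \<noteq> 0" "1 - y \<noteq> 0" using s[OF j] Ln_one_minus(2) by (auto simp: x_def y_def)
    have xy: "x * y = a j * cnj (a j)" by (simp add: x_def y_def exp_minus)
    \<comment> \<open>The identity behind the Poisson kernel; the product x * y no longer depends on
      s.\<close>
    have "1 + (x / (1 - x) - (- y) / (1 - y)) = (1 - x * y) / ((1 - x) * (1 - y))"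
    proof -
      have "1 + ((1 - u) / u - (- (1 - v)) / v) = (1 - (1 - u) * (1 - v)) / (u * v)"
        if "u \<noteq> 0" "v \<noteq> 0" for u v :: complex
        using that by (simp add: field_simps)
      from this[OF nz] show ?thesis by simp
    qed
    then show "1 + ((a j * exp (- s)) / (1 - a j * exp (- s)) - (- cnj (a j) * exp s) / (1 - cnj (a j) * exp s))
      = (1 - a j * cnj (a j)) / ((1 - a j / exp s) * (1 - cnj (a j) * exp s))"
      unfolding xy by (simp add: x_def y_def exp_minus divide_inverse)
  qed
  finally show "(strip_log has_field_derivative strip_deriv (exp s)) (at s)" .
  have "\<bar>Im (Ln (1 - a j * exp (- s)) - Ln (1 - cnj (a j) * exp s))\<bar> \<le> 2 * pi" if "j \<in> {1..n}" for j
  proof -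
    have nz: "1 - a j * exp (- s) \<noteq> 0" "1 - cnj (a j) * exp s \<noteq> 0"
      using s[OF that] Ln_one_minus(2) by blast+
    show ?thesis
      using Im_Ln_le_pi[OF nz(1)] Im_Ln_le_pi[OF nz(2)] mpi_less_Im_Ln[OF nz(1)] mpi_less_Im_Ln[OF nz(2)]
      unfolding minus_complex.sel by linarith
  qed
  then have "\<bar>\<Sum>j=1..n. Im (Ln (1 - a j * exp (- s)) - Ln (1 - cnj (a j) * exp s))\<bar> \<le> (\<Sum>j=1..n. 2 * pi)"
    by (intro order_trans[OF sum_abs] sum_mono) auto
  then show "\<bar>Im (strip_log s) - real n * Im s\<bar> \<le> 2 * pi * real n"
    by (simp add: strip_log_def Im_sum mult_ac del: minus_complex.sel)
qed

text \<open>On the circle 1 / z is the conjugate of z, so each denominator is |1 - cnj a * z|^2.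
  Geometrically, \<phi> runs round the circle in the positive direction.\<close>

lemma strip_deriv_circle:
  assumes z: "cmod z = 1"
  shows "Re (strip_deriv z) > 0"
proof -
  have "Re ((1 - a j * cnj (a j)) / ((1 - a j / z) * (1 - cnj (a j) * z))) > 0" if j: "j \<in> {1..n}" for j
  proof -
    have zz: "z * cnj z = 1" using z by (simp add: complex_norm_square[symmetric])
    then have "inverse z = cnj z" by (rule inverse_unique)
    then have "1 - a j / z = cnj (1 - cnj (a j) * z)" by (simp add: divide_inverse)
    then have "(1 - a j / z) * (1 - cnj (a j) * z) = of_real ((cmod (1 - cnj (a j) * z))\<^sup>2)"
      using complex_norm_square[of "1 - cnj (a j) * z"] by (simp only: mult.commute of_real_power)
    moreover have "1 - a j * cnj (a j) = of_real (1 - (cmod (a j))\<^sup>2)"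
      by (simp add: complex_norm_square[symmetric])
    moreover have "cmod (1 - cnj (a j) * z) > 0" using denom_nonzero[OF j, of z] z by simp
    moreover have "(cmod (a j))\<^sup>2 < 1" using a[OF j] by (simp add: power_less_one_iff)
    ultimately show ?thesis by (simp only: of_real_divide[symmetric] Re_complex_of_real) simp
  qed
  then show ?thesis
    unfolding strip_deriv_def Re_sum using n by (intro sum_pos) auto
qed

text \<open>Positivity spreads inwards by compactness: the closed disk without the open set
  \<open>Ob\<close> is compact and misses the circle, so the moduli of its points have a maximum
  below 1.\<close>

lemma boundary_annulus:
  obtains t where "0 < t" "t < 1" "\<And>j. j \<in> {1..n} \<Longrightarrow> cmod (a j) < t"
    "\<And>z. t \<le> cmod z \<Longrightarrow> cmod z \<le> 1 \<Longrightarrow> Re (strip_deriv z) > 0"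
proof -
  obtain \<rho> where \<rho>: "0 < \<rho>" "\<rho> < 1" "\<And>j. j \<in> {1..n} \<Longrightarrow> cmod (a j) < \<rho>" using zeros_bound by blast
  define W where "W = {z. \<rho> < cmod z} \<inter> {z. cmod z < 1 / \<rho>}"
  have W: "open W" unfolding W_def by (intro open_Int open_Collect_less continuous_intros)
  have nz: "z \<noteq> 0 \<and> 1 - a j / z \<noteq> 0 \<and> 1 - cnj (a j) * z \<noteq> 0" if "z \<in> W" "j \<in> {1..n}" for z j
  proof -
    have z: "\<rho> < cmod z" "cmod z < 1 / \<rho>" using that by (auto simp: W_def)
    have z0: "z \<noteq> 0" using z \<rho>(1) by auto
    have "cmod (a j / z) < 1" using \<rho>(3)[OF that(2)] z z0 by (simp add: norm_divide)
    moreover have "cmod (cnj (a j) * z) < 1"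
    proof -
      have "cmod (a j) * cmod z \<le> \<rho> * cmod z" using \<rho>(3)[OF that(2)] by (intro mult_right_mono) auto
      also have "\<dots> < 1" using z \<rho>(1) by (simp add: field_simps)
      finally show ?thesis by (simp add: norm_mult)
    qed
    ultimately show ?thesis using Ln_one_minus(2) z0 by blast
  qed
  have cont: "continuous_on W (\<lambda>z. Re (strip_deriv z))"
    unfolding strip_deriv_def by (intro continuous_intros) (use nz in auto)
  define Ob where "Ob = {z \<in> W. Re (strip_deriv z) > 0}"
  have "open Ob"
    using continuous_open_preimage[OF cont W, of "{0<..}"] by (simp add: Ob_def vimage_def Int_def)
  then have comp: "compact (cball 0 1 - Ob)" by (intro compact_diff) auto
  \<comment> \<open>The annulus W excludes the origin; this makes the set nonempty, as the existence
    of a maximum requires.\<close>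
  have "0 \<in> cball 0 1 - Ob" using \<rho> by (auto simp: Ob_def W_def)
  then obtain z0 where z0: "z0 \<in> cball 0 1 - Ob" "\<And>z. z \<in> cball 0 1 - Ob \<Longrightarrow> cmod z \<le> cmod z0"
    using continuous_attains_sup[OF comp _ continuous_on_norm_id] by blast
  have "cmod z0 \<noteq> 1"
  proof
    assume "cmod z0 = 1"
    then have "z0 \<in> Ob" using strip_deriv_circle[of z0] \<rho> by (auto simp: Ob_def W_def)
    then show False using z0 by simp
  qed
  then have z01: "cmod z0 < 1" using z0(1) by auto
  define t where "t = (1 + cmod z0) / 2"
  have t: "cmod z0 < t" "t < 1" using z01 by (auto simp: t_def)
  have inO: "z \<in> Ob" if "t \<le> cmod z" "cmod z \<le> 1" for z
    using z0(2)[of z] that t(1) by force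
  have t0: "0 < t" using t(1) norm_ge_zero[of z0] by linarith
  \<comment> \<open>Membership in \<open>Ob\<close> puts t into the annulus W, so that t exceeds
    every |a j|.\<close>
  have "of_real t \<in> Ob" by (rule inO) (use t t0 in auto)
  then have "\<rho> < t" using t0 by (auto simp: Ob_def W_def)
  show ?thesis
  proof (rule that[OF t0 t(2)])
    show "cmod (a j) < t" if "j \<in> {1..n}" for j using \<rho>(3)[OF that] \<open>\<rho> < t\<close> by linarith
    show "Re (strip_deriv z) > 0" if "t \<le> cmod z" "cmod z \<le> 1" for z
      using inO[OF that] by (simp add: Ob_def)
  qed
qed

text \<open>Near the circle z \<phi>' / \<phi> does not vanish. The zeros of \<phi>' are therefore
  confined to a compact smaller disk, where a nonconstant holomorphic function has finitely
  many.\<close>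

lemma finite_critical_points: "finite (critical_points \<phi>)"
proof -
  obtain t where t: "0 < t" "t < 1" "\<And>j. j \<in> {1..n} \<Longrightarrow> cmod (a j) < t"
    "\<And>z. t \<le> cmod z \<Longrightarrow> cmod z \<le> 1 \<Longrightarrow> Re (strip_deriv z) > 0"
    using boundary_annulus by metis
  have nz: "deriv \<phi> z \<noteq> 0" if z: "t \<le> cmod z" "cmod z < 1" for z
  proof
    assume 0: "deriv \<phi> z = 0"
    have z0: "z \<noteq> 0" using z t(1) by auto
    \<comment> \<open>The derivative of \<phi> (exp s) is computed twice, through
      \<open>strip_log\<close> and by the chain rule with \<phi>' = 0.\<close>
    define s where "s = Ln z"
    have es: "exp s = z" using z0 by (simp add: s_def)
    have s: "cmod (a j * exp (- s)) < 1 \<and> cmod (cnj (a j) * exp s) < 1" if "j \<in> {1..n}" for j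
    proof
      show "cmod (a j * exp (- s)) < 1"
        using t(3)[OF that] z z0 by (simp add: exp_minus es norm_divide divide_inverse[symmetric])
      show "cmod (cnj (a j) * exp s) < 1"
        unfolding es norm_mult using t(3)[OF that] z t(2)
        by (intro le_less_trans[OF mult_left_le[of "cmod z"]]) auto
    qed
    have ev: "\<forall>\<^sub>F s in nhds s. \<forall>j\<in>{1..n}. cmod (a j * exp (- s)) < 1 \<and> cmod (cnj (a j) * exp s) < 1"
    proof (rule eventually_ball_finite)
      show "\<forall>j\<in>{1..n}. \<forall>\<^sub>F s in nhds s. cmod (a j * exp (- s)) < 1 \<and> cmod (cnj (a j) * exp s) < 1"
      proof
        fix j assume j: "j \<in> {1..n}"
        have "open ({s. cmod (a j * exp (- s)) < 1} \<inter> {s. cmod (cnj (a j) * exp s) < 1})"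
          by (intro open_Int open_Collect_less continuous_intros)
        from eventually_nhds_in_open[OF this, of s] s[OF j]
        show "\<forall>\<^sub>F s in nhds s. cmod (a j * exp (- s)) < 1 \<and> cmod (cnj (a j) * exp s) < 1"
          by (simp only: Int_iff mem_Collect_eq simp_thms)
      qed
    qed simp
    have "((\<lambda>s. exp (strip_log s)) has_field_derivative exp (strip_log s) * strip_deriv z) (at s)"
      by (rule DERIV_chain2[OF DERIV_exp], subst es[symmetric], rule strip_log_facts(2)) (rule s)
    moreover have "\<forall>\<^sub>F s in nhds s. exp (strip_log s) = \<phi> (exp s)"
      using ev by eventually_elim (rule strip_log_facts(1), blast)
    ultimately have 1: "((\<lambda>s. \<phi> (exp s)) has_field_derivative exp (strip_log s) * strip_deriv z) (at s)"
      using DERIV_cong_ev[OF refl _ refl] by fast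
    have "(\<phi> has_field_derivative 0) (at (exp s))"
      using holomorphic_derivI[OF holomorphic_on_\<phi>, of z] z 0 by (simp add: es)
    from DERIV_chain2[OF this DERIV_exp] have "((\<lambda>s. \<phi> (exp s)) has_field_derivative 0) (at s)" by simp
    from DERIV_unique[OF 1 this] have "strip_deriv z = 0" by simp
    then show False using t(4)[of z] z by simp
  qed
  have sub: "critical_points \<phi> \<subseteq> {z \<in> cball 0 t. deriv \<phi> z = 0}"
  proof
    fix z assume "z \<in> critical_points \<phi>"
    then have z: "cmod z < 1" "deriv \<phi> z = 0" by (auto simp: critical_points_def)
    then have "\<not> t \<le> cmod z" using nz by blast
    then show "z \<in> {z \<in> cball 0 t. deriv \<phi> z = 0}" using z by simp
  qed
  show ?thesis
  proof (cases "deriv \<phi> constant_on unit_disk")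
    case True
    then obtain c where c: "\<And>z. z \<in> unit_disk \<Longrightarrow> deriv \<phi> z = c" unfolding constant_on_def by blast
    have tm: "of_real t \<in> unit_disk" using t(1,2) by simp
    have "deriv \<phi> (of_real t) \<noteq> 0" by (rule nz) (use t(1,2) in auto)
    then have "c \<noteq> 0" using c[OF tm] by simp
    then have "critical_points \<phi> = {}" unfolding critical_points_def using c by blast
    then show ?thesis by simp
  next
    case False
    have "finite {z \<in> cball 0 t. deriv \<phi> z = 0}"
    proof (rule holomorphic_compact_finite_zeros)
      show "deriv \<phi> holomorphic_on unit_disk" by (rule holomorphic_deriv[OF holomorphic_on_\<phi> open_ball])
      show "cball 0 t \<subseteq> unit_disk" using t(2) by auto
    qed (use False in auto)
    then show ?thesis using sub finite_subset by blast
  qed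
qed

lemma regular_points_iff: "z \<in> regular_points \<longleftrightarrow> z \<in> unit_disk \<and> \<phi> z \<in> regular_values"
proof -
  have "z \<in> unit_disk \<Longrightarrow> \<phi> z \<in> unit_disk" using \<phi>_lt[of z] by simp
  then show ?thesis unfolding regular_points_def regular_values_def branch_fibres_def by blast
qed

lemma regular_value_lt: "l \<in> regular_values \<Longrightarrow> cmod l < 1"
  by (simp add: regular_values_def)

lemma fibre_regular: "l \<in> regular_values \<Longrightarrow> w \<in> fibre l \<Longrightarrow> w \<in> regular_points"
  by (simp add: regular_points_iff fibre_def)

lemma deriv_nonzero: "w \<in> regular_points \<Longrightarrow> deriv \<phi> w \<noteq> 0"
  unfolding regular_points_def branch_fibres_def critical_points_def by blast

lemma open_regular_values: "open regular_values"
  unfolding regular_values_def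
  by (intro open_Diff open_ball finite_imp_closed finite_imageI finite_critical_points)

lemma finite_branch_fibres: "finite (branch_fibres \<phi>)"
proof -
  have "branch_fibres \<phi> \<subseteq> (\<Union>l\<in>\<phi> ` critical_points \<phi>. fibre l)"
    unfolding branch_fibres_def fibre_def by blast
  moreover have "finite (\<Union>l\<in>\<phi> ` critical_points \<phi>. fibre l)"
  proof (intro finite_UN_I finite_imageI finite_critical_points)
    fix l assume "l \<in> \<phi> ` critical_points \<phi>"
    then have "cmod l < 1" using \<phi>_lt by (auto simp: critical_points_def)
    then show "finite (fibre l)" by (rule fibre_finite_card)
  qed
  ultimately show ?thesis by (rule finite_subset)
qed

lemma open_regular_points: "open regular_points"
  unfolding regular_points_def
  by (intro open_Diff open_ball finite_imp_closed finite_branch_fibres)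

lemma connected_regular_points: "connected regular_points"
  unfolding regular_points_def
  by (rule connected_open_delete_finite[OF open_ball connected_ball _ finite_branch_fibres]) simp

text \<open>The function h is a logarithm of \<phi> in the coordinate s with z = exp s. It is
  injective on a strip and its image contains a whole vertical line Re = p, which lifts the circle
  of radius exp p: \<phi> (\<gamma> x) = exp (p + i x). Since h (s + 2 \<pi> i) = h s + 2 \<pi> n i,
  the lift closes up only after n turns, and its positions after the single turns are the points of
  the fibre.\<close>

lemma boundary_cycle:
  obtains \<gamma> :: "real \<Rightarrow> complex" where
    "continuous_on UNIV \<gamma>" "\<And>t. \<gamma> t \<in> regular_points"
    "\<And>t. \<phi> (\<gamma> (t + 2 * pi)) = \<phi> (\<gamma> t)" "\<And>t. \<gamma> (t + 2 * pi * real n) = \<gamma> t"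
    "\<And>t. bij_betw (\<lambda>k. \<gamma> (t + 2 * pi * real k)) {..<n} (fibre (\<phi> (\<gamma> t)))"
proof -
  obtain t where t: "0 < t" "t < 1" "\<And>j. j \<in> {1..n} \<Longrightarrow> cmod (a j) < t"
    "\<And>z. t \<le> cmod z \<Longrightarrow> cmod z \<le> 1 \<Longrightarrow> Re (strip_deriv z) > 0"
    using boundary_annulus by metis
  \<comment> \<open>Under exp the strip -\<delta> < Re s < 0 corresponds to the annulus t < |z| <
    1.\<close>
  define \<delta> where "\<delta> = - ln t"
  have \<delta>: "\<delta> > 0" using t by (simp add: \<delta>_def)
  have exp_\<delta>: "exp (- \<delta>) = t" using t by (simp add: \<delta>_def)
  define St where "St = {s. Re s > - \<delta>} \<inter> {s. Re s < 0}"
  define St' where "St' = {s. Re s \<ge> - \<delta>} \<inter> {s. Re s \<le> 0}"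
  have strip': "t \<le> cmod (exp s)" "cmod (exp s) \<le> 1" if "s \<in> St'" for s
    using that t by (auto simp: St'_def exp_\<delta>[symmetric])
  have small: "cmod (a j * exp (- s)) < 1 \<and> cmod (cnj (a j) * exp s) < 1" if s: "s \<in> St'" and j: "j \<in> {1..n}" for s j
  proof
    have "cmod (a j) < cmod (exp s)" using t(3)[OF j] strip'(1)[OF s] by linarith
    then show "cmod (a j * exp (- s)) < 1"
      by (simp add: exp_minus norm_divide divide_inverse[symmetric] del: norm_exp_eq_Re)
    show "cmod (cnj (a j) * exp s) < 1"
      unfolding norm_mult complex_mod_cnj using a[OF j] strip'(2)[OF s]
      by (intro le_less_trans[OF mult_left_le[of "cmod (exp s)"]]) auto
  qed
  define h where "h = strip_log"
  have exp_h: "exp (h s) = \<phi> (exp s)" if "s \<in> St'" for s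
    unfolding h_def by (rule strip_log_facts(1)) (rule small[OF that])
  have der_h: "(h has_field_derivative strip_deriv (exp s)) (at s)" if "s \<in> St'" for s
    unfolding h_def by (rule strip_log_facts(2)) (rule small[OF that])
  have Im_h: "\<bar>Im (h s) - real n * Im s\<bar> \<le> 2 * pi * real n" if "s \<in> St'" for s
    unfolding h_def by (rule strip_log_facts(3)) (rule small[OF that])
  have St_sub: "St \<subseteq> St'" by (auto simp: St_def St'_def)
  have openSt: "open St" unfolding St_def by (intro open_Int open_halfspace_Re_gt open_halfspace_Re_lt)
  have convSt: "convex St" unfolding St_def by (intro convex_Int convex_halfspace_Re_gt convex_halfspace_Re_lt)
  have closedSt': "closed St'" unfolding St'_def by (intro closed_Int closed_halfspace_Re_ge closed_halfspace_Re_le)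
  have conth: "continuous_on St' h"
    using der_h by (meson DERIV_isCont continuous_at_imp_continuous_on)
  have holh: "h holomorphic_on St"
    unfolding holomorphic_on_def field_differentiable_def
    using der_h St_sub by (meson has_field_derivative_at_within subsetD)
  have injh: "inj_on h St"
  proof (rule inj_on_Re_deriv_pos[OF convSt openSt holh])
    fix s assume "s \<in> St"
    then have s: "s \<in> St'" using St_sub by auto
    show "Re (deriv h s) > 0"
      unfolding DERIV_imp_deriv[OF der_h[OF s]] by (rule t(4)) (use strip'[OF s] in auto)
  qed
  have h_per: "h (s + 2 * pi * of_int m * \<i>) = h s + 2 * pi * of_int (int n * m) * \<i>" for s m
  proof -
    have e: "exp (s + 2 * pi * of_int m * \<i>) = exp s" for s
      using exp_plus_2pin[of s m] by (simp add: mult_ac)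
    have e': "exp (- (s + 2 * pi * of_int m * \<i>)) = exp (- s)"
      using e[of s] by (simp only: exp_minus)
    show ?thesis unfolding h_def strip_log_def e e' by (simp add: algebra_simps)
  qed
  obtain z1 where z1: "z1 \<in> sphere 0 t" "\<And>z. z \<in> sphere 0 t \<Longrightarrow> cmod (\<phi> z) \<le> cmod (\<phi> z1)"
  proof -
    have "continuous_on (sphere 0 t) (\<lambda>z. cmod (\<phi> z))"
      by (intro continuous_intros continuous_on_subset[OF continuous_on_\<phi>]) (use t(2) in auto)
    moreover have "of_real t \<in> sphere (0::complex) t" using t(1) by simp
    ultimately show ?thesis
      using continuous_attains_sup[of "sphere 0 t" "\<lambda>z. cmod (\<phi> z)"] that by (metis compact_sphere empty_iff)
  qed
  \<comment> \<open>The radius r has to exceed |\<phi>| on the inner circle, so that the level curve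
    cannot leave the strip there, and the modulus of every critical value, so that the curve
    consists of regular points.\<close>
  define R where "R = insert (cmod (\<phi> z1)) ((\<lambda>z. cmod (\<phi> z)) ` critical_points \<phi>)"
  have finR: "finite R" using finite_critical_points by (simp add: R_def)
  have "Max R < 1"
    using finR z1(1) t(2) \<phi>_lt by (subst Max_less_iff) (auto simp: R_def critical_points_def)
  then obtain r where r: "Max R < r" "r < 1" using dense by blast
  have Rr: "x < r" if "x \<in> R" for x using r(1) Max_ge[OF finR that] by linarith
  have r0: "0 < r" using le_less_trans[OF norm_ge_zero Rr[of "cmod (\<phi> z1)"]] by (simp add: R_def)
  define p where "p = ln r"
  have exp_p: "exp p = r" using r0 by (simp add: p_def)
  have Re_h: "exp (Re (h s)) = cmod (\<phi> (exp s))" if "s \<in> St'" for s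
    using exp_h[OF that] by (metis norm_exp_eq_Re)
  \<comment> \<open>The level set Re h = p avoids both edges of the strip: |\<phi>| is 1 on the
    outer circle and below r on the inner one.\<close>
  have edge: "s \<in> St" if s: "s \<in> St'" and Reh: "Re (h s) = p" for s
  proof -
    have c: "cmod (\<phi> (exp s)) = r" using Re_h[OF s] Reh exp_p by simp
    have "Re s \<noteq> 0"
    proof
      assume "Re s = 0"
      then have "cmod (exp s) = 1" by simp
      then show False using \<phi>_eq_1 c r(2) by force
    qed
    moreover have "Re s \<noteq> - \<delta>"
    proof
      assume "Re s = - \<delta>"
      then have "exp s \<in> sphere 0 t" by (simp add: exp_\<delta>)
      then have "r \<le> cmod (\<phi> z1)" using z1(2) c by metis
      moreover have "cmod (\<phi> z1) < r" by (rule Rr) (simp add: R_def)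
      ultimately show False by simp
    qed
    ultimately show ?thesis using s by (auto simp: St_def St'_def)
  qed
  \<comment> \<open>A is shown to be open, closed and nonempty, so that the whole line lies in the
    image of the strip.\<close>
  define A where "A = {x::real. Complex p x \<in> h ` St}"
  have "open A"
  proof -
    have o: "open (h ` St)" by (rule open_mapping_thm3[OF holh openSt injh])
    have "continuous_on UNIV (\<lambda>x. Complex p x)"
      by (simp add: Complex_eq continuous_intros)
    from open_vimage[OF o this] show ?thesis by (simp add: A_def vimage_def)
  qed
  moreover have "closed A"
    unfolding closed_sequential_limits
  proof (intro allI impI)
    fix x l assume xl: "(\<forall>k. x k \<in> A) \<and> x \<longlonglongrightarrow> l"
    then have "\<forall>k. \<exists>s\<in>St. h s = Complex p (x k)" by (auto simp: A_def image_iff) metis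
    then obtain s where s: "\<And>k. s k \<in> St" "\<And>k. h (s k) = Complex p (x k)" by metis
    have s': "s k \<in> St'" for k using s St_sub by auto
    obtain B where B: "\<And>k. \<bar>x k\<bar> \<le> B"
      using convergent_imp_bounded[of x] xl by (metis bounded_iff rangeI real_norm_def)
    \<comment> \<open>Im h differs from n Im s by a bounded amount, so bounded images keep the
      preimages bounded; a limit point exists, and \<open>edge\<close> puts it into the open
      strip.\<close>
    have "cmod (s k) \<le> \<delta> + (B + 2 * pi * real n)" for k
    proof -
      have "\<bar>x k - real n * Im (s k)\<bar> \<le> 2 * pi * real n" using Im_h[OF s'[of k]] s(2)[of k] by simp
      then have "\<bar>real n * Im (s k)\<bar> \<le> B + 2 * pi * real n" using B[of k] by linarith
      moreover have "\<bar>Im (s k)\<bar> \<le> \<bar>real n * Im (s k)\<bar>"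
        using n by (simp add: abs_mult mult_le_cancel_right1)
      moreover have "\<bar>Re (s k)\<bar> \<le> \<delta>" using s'[of k] by (auto simp: St'_def)
      ultimately show ?thesis using cmod_le[of "s k"] by linarith
    qed
    then have bnd: "bounded (range s)" by (auto simp: bounded_iff)
    obtain q u where q: "strict_mono (u :: nat \<Rightarrow> nat)" "(s \<circ> u) \<longlonglongrightarrow> q"
      using bounded_imp_convergent_subsequence[OF bnd] by blast
    have qS: "q \<in> St'" by (rule closed_sequentially[OF closedSt' _ q(2)]) (simp add: s')
    have "(\<lambda>k. h ((s \<circ> u) k)) \<longlonglongrightarrow> h q"
      by (rule continuous_on_tendsto_compose[OF conth q(2) qS]) (simp add: s')
    moreover have "(\<lambda>k. h ((s \<circ> u) k)) \<longlonglongrightarrow> Complex p l"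
    proof -
      have "(\<lambda>k. Complex p ((x \<circ> u) k)) \<longlonglongrightarrow> Complex p l"
        by (intro tendsto_Complex tendsto_const LIMSEQ_subseq_LIMSEQ q(1)) (use xl in simp)
      then show ?thesis by (simp add: s(2))
    qed
    ultimately have hq: "h q = Complex p l" using LIMSEQ_unique by blast
    then have "q \<in> St" by (intro edge[OF qS]) simp
    then show "l \<in> A" unfolding A_def using hq by (metis (mono_tags, lifting) image_eqI mem_Collect_eq)
  qed
  \<comment> \<open>Intermediate values along the real axis: Re h is at most p at -\<delta> and
    equals 0 at the origin, while p < 0.\<close>
  moreover have "A \<noteq> {}"
  proof -
    have on: "of_real y \<in> St'" if "- \<delta> \<le> y" "y \<le> 0" for y using that by (simp add: St'_def)
    have c: "continuous_on {-\<delta>..0} (\<lambda>y. Re (h (of_real y)))"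
      by (intro continuous_intros continuous_on_compose2[OF conth]) (use on in auto)
    have "Re (h (of_real (-\<delta>))) \<le> p"
    proof -
      have "exp (of_real (- \<delta>)) \<in> sphere (0::complex) t" using t(1) by (simp add: exp_\<delta> exp_of_real del: of_real_minus)
      then have "cmod (\<phi> (exp (of_real (-\<delta>)))) \<le> cmod (\<phi> z1)" by (rule z1(2))
      also have "\<dots> \<le> r" using Rr[of "cmod (\<phi> z1)"] by (simp add: R_def)
      finally have "exp (Re (h (of_real (-\<delta>)))) \<le> exp p"
        using Re_h[OF on[of "-\<delta>"]] \<delta> by (simp add: exp_p del: of_real_minus)
      then show ?thesis by simp
    qed
    moreover have "p \<le> Re (h (of_real 0))"
    proof -
      have "exp (Re (h (of_real 0))) = 1" using Re_h[OF on[of 0]] \<delta> \<phi>_eq_1[of 1] by simp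
      then have "exp p \<le> exp (Re (h (of_real 0)))" using r(2) by (simp add: exp_p)
      then show ?thesis by simp
    qed
    ultimately obtain y where y: "-\<delta> \<le> y" "y \<le> 0" "Re (h (of_real y)) = p"
      using IVT'[OF _ _ _ c, of p] \<delta> by auto
    have "of_real y \<in> St" by (rule edge[OF on[OF y(1,2)] y(3)])
    moreover have "h (of_real y) = Complex p (Im (h (of_real y)))" using y(3) by (simp add: complex_eq_iff)
    ultimately have "Im (h (of_real y)) \<in> A" unfolding A_def by (metis (mono_tags, lifting) image_eqI mem_Collect_eq)
    then show ?thesis by blast
  qed
  ultimately have "A = UNIV" using clopen by blast
  then have line: "Complex p x \<in> h ` St" for x by (auto simp: A_def)
  obtain g where g: "g holomorphic_on (h ` St)" "\<And>s. s \<in> St \<Longrightarrow> g (h s) = s"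
    using holomorphic_has_inverse[OF holh openSt injh] by metis
  have gx: "g (Complex p x) \<in> St \<and> h (g (Complex p x)) = Complex p x" for x
    using line[of x] g(2) by auto
  define \<gamma> where "\<gamma> = (\<lambda>x. exp (g (Complex p x)))"
  have \<phi>_\<gamma>: "\<phi> (\<gamma> x) = exp (Complex p x)" for x
    unfolding \<gamma>_def using exp_h[of "g (Complex p x)"] gx[of x] St_sub by auto
  have in_disk: "\<gamma> x \<in> unit_disk" for x
    using gx[of x] by (simp add: \<gamma>_def St_def)
  have norm_\<gamma>: "cmod (\<phi> (\<gamma> x)) = r" for x by (simp add: \<phi>_\<gamma> exp_p)
  have per: "\<phi> (\<gamma> (x + 2 * pi * of_int m)) = \<phi> (\<gamma> x)" for x m
  proof -
    have "Complex p (x + 2 * pi * of_int m) = Complex p x + \<i> * (of_int m * (of_real pi * 2))"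
      by (simp add: complex_eq_iff)
    then show ?thesis unfolding \<phi>_\<gamma> using exp_plus_2pin[of "Complex p x" m] by simp
  qed
  have shift: "g (Complex p (x + 2 * pi * real n * of_int m)) = g (Complex p x) + 2 * pi * of_int m * \<i>" for x m
  proof -
    have "g (Complex p x) + 2 * pi * of_int m * \<i> \<in> St" using gx[of x] by (simp add: St_def)
    moreover have "h (g (Complex p x) + 2 * pi * of_int m * \<i>) = Complex p (x + 2 * pi * real n * of_int m)"
      unfolding h_per using gx[of x] by (simp add: complex_eq_iff)
    ultimately show ?thesis using g(2) by metis
  qed
  show ?thesis
  proof (rule that[of \<gamma>])
    show "continuous_on UNIV \<gamma>"
      unfolding \<gamma>_def
      by (intro continuous_intros continuous_on_compose2[OF holomorphic_on_imp_continuous_on[OF g(1)]])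
         (use line in \<open>auto simp: Complex_eq intro!: continuous_intros\<close>)
    show "\<gamma> x \<in> regular_points" for x
    proof -
      have "\<phi> (\<gamma> x) \<notin> \<phi> ` critical_points \<phi>"
      proof
        assume "\<phi> (\<gamma> x) \<in> \<phi> ` critical_points \<phi>"
        then have "cmod (\<phi> (\<gamma> x)) \<in> R" by (auto simp: R_def)
        then show False using Rr norm_\<gamma> by force
      qed
      then show ?thesis
        using in_disk[of x] by (auto simp: regular_points_def branch_fibres_def)
    qed
    show "\<phi> (\<gamma> (x + 2 * pi)) = \<phi> (\<gamma> x)" for x using per[of x 1] by simp
    show "\<gamma> (x + 2 * pi * real n) = \<gamma> x" for x
      using shift[of x 1] by (simp add: \<gamma>_def exp_add exp_two_pi_i' exp_two_pi_i)
    show "bij_betw (\<lambda>k. \<gamma> (x + 2 * pi * real k)) {..<n} (fibre (\<phi> (\<gamma> x)))" for x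
    proof -
      have inj: "inj_on (\<lambda>k. \<gamma> (x + 2 * pi * real k)) {..<n}"
      proof (rule inj_onI)
        \<comment> \<open>Equal values of exp mean that the logarithms differ by 2 \<pi> i m; by the
          period of h the arguments differ by 2 \<pi> n m, so k and l agree modulo n.\<close>
        fix k l assume kl: "k \<in> {..<n}" "l \<in> {..<n}" "\<gamma> (x + 2 * pi * real k) = \<gamma> (x + 2 * pi * real l)"
        then obtain m :: int where m: "g (Complex p (x + 2 * pi * real k))
            = g (Complex p (x + 2 * pi * real l)) + (of_int (2 * m) * pi) * \<i>"
          unfolding \<gamma>_def exp_eq by blast
        then have "g (Complex p (x + 2 * pi * real k)) = g (Complex p (x + 2 * pi * real l + 2 * pi * real n * of_int m))"
          unfolding shift by (simp add: mult_ac)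
        then have "Complex p (x + 2 * pi * real k) = Complex p (x + 2 * pi * real l + 2 * pi * real n * of_int m)"
          using gx by metis
        then have "pi * real k = pi * (real l + real n * of_int m)" by (simp add: algebra_simps)
        then have "real_of_int (int k) = real_of_int (int l + int n * m)" by simp
        then have "int k = int l + int n * m" by linarith
        then have "int k mod int n = int l mod int n" by simp
        then show "k = l" using kl(1,2) by simp
      qed
      have sub: "(\<lambda>k. \<gamma> (x + 2 * pi * real k)) ` {..<n} \<subseteq> fibre (\<phi> (\<gamma> x))"
        using in_disk per[of x "int _"] by (auto simp: fibre_def)
      have lt: "cmod (\<phi> (\<gamma> x)) < 1" using norm_\<gamma> r(2) by simp
      \<comment> \<open>These are n distinct points in a fibre that has at most n.\<close>
      have "(\<lambda>k. \<gamma> (x + 2 * pi * real k)) ` {..<n} = fibre (\<phi> (\<gamma> x))"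
        by (rule card_seteq[OF fibre_finite_card(1)[OF lt] sub])
           (use fibre_finite_card(2)[OF lt] card_image[OF inj] in simp)
      then show ?thesis using inj by (simp add: bij_betw_def)
    qed
  qed
qed

section \<open>Local branches of the inverse of \<phi>\<close>

definition local_branches :: "complex \<Rightarrow> real \<Rightarrow> (complex \<Rightarrow> complex \<Rightarrow> complex) \<Rightarrow> bool"
  where "local_branches l e \<beta> \<longleftrightarrow> e > 0 \<and> ball l e \<subseteq> regular_values \<and>
    (\<forall>w\<in>fibre l. \<beta> w holomorphic_on ball l e \<and> \<beta> w l = w \<and> (\<forall>m\<in>ball l e. \<phi> (\<beta> w m) = m)) \<and>
    (\<forall>m\<in>ball l e. bij_betw (\<lambda>w. \<beta> w m) (fibre l) (fibre m))"

lemma local_branchesD: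
  assumes "local_branches l e \<beta>"
  shows "e > 0" "ball l e \<subseteq> regular_values"
    "\<And>w. w \<in> fibre l \<Longrightarrow> \<beta> w holomorphic_on ball l e"
    "\<And>w. w \<in> fibre l \<Longrightarrow> \<beta> w l = w"
    "\<And>w m. w \<in> fibre l \<Longrightarrow> m \<in> ball l e \<Longrightarrow> \<phi> (\<beta> w m) = m"
    "\<And>m. m \<in> ball l e \<Longrightarrow> bij_betw (\<lambda>w. \<beta> w m) (fibre l) (fibre m)"
    "\<And>w m. w \<in> fibre l \<Longrightarrow> m \<in> ball l e \<Longrightarrow> \<beta> w m \<in> unit_disk"
proof -
  show *: "\<And>m. m \<in> ball l e \<Longrightarrow> bij_betw (\<lambda>w. \<beta> w m) (fibre l) (fibre m)"
    using assms unfolding local_branches_def by blast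
  show "\<And>w m. w \<in> fibre l \<Longrightarrow> m \<in> ball l e \<Longrightarrow> \<beta> w m \<in> unit_disk"
    using bij_betw_apply[OF *] by (simp add: fibre_def)
qed (use assms in \<open>unfold local_branches_def, blast+\<close>)

text \<open>Injectivity near each point of the fibre gives the branches. That nearby values have no
  further preimages is properness: K, the closed disk without the small balls, is compact, so its
  image is closed and stays away from l.\<close>

lemma local_branches_exist:
  assumes l: "l \<in> regular_values"
  obtains e \<beta> where "local_branches l e \<beta>"
proof -
  have l1: "cmod l < 1" using l by (rule regular_value_lt)
  have fin: "finite (fibre l)" by (rule fibre_finite_card[OF l1])
  \<comment> \<open>The factor 2 makes the balls around different points of the fibre
    disjoint.\<close>
  have "\<exists>r>0. ball w r \<subseteq> unit_disk \<and> inj_on \<phi> (ball w r) \<and> (\<forall>w'\<in>fibre l. w' \<noteq> w \<longrightarrow> 2 * r \<le> dist w w')"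
    if w: "w \<in> fibre l" for w
  proof -
    have "deriv \<phi> w \<noteq> 0" by (rule deriv_nonzero[OF fibre_regular[OF l w]])
    moreover have "w \<in> unit_disk" using w by (simp add: fibre_def)
    ultimately obtain r where r: "r > 0" "ball w r \<subseteq> unit_disk" "inj_on \<phi> (ball w r)"
      using has_complex_derivative_locally_injective[OF holomorphic_on_\<phi> _ open_ball] by metis
    obtain d where d: "d > 0" "\<forall>w'\<in>fibre l. w' \<noteq> w \<longrightarrow> d \<le> dist w w'"
      using finite_set_avoid[OF fin, of w] by blast
    have sub: "ball w (min r (d / 2)) \<subseteq> ball w r" by (rule subset_ball) simp
    have "2 * min r (d / 2) \<le> dist w w'" if "w' \<in> fibre l" "w' \<noteq> w" for w'
      using d(2) that by (auto intro: order_trans[of _ d])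
    then show ?thesis
      using r(1) d(1) order_trans[OF sub r(2)] inj_on_subset[OF r(3) sub]
      by (intro exI[of _ "min r (d / 2)"]) simp
  qed
  then obtain r where r: "\<And>w. w \<in> fibre l \<Longrightarrow> r w > 0" "\<And>w. w \<in> fibre l \<Longrightarrow> ball w (r w) \<subseteq> unit_disk"
    "\<And>w. w \<in> fibre l \<Longrightarrow> inj_on \<phi> (ball w (r w))"
    "\<And>w w'. w \<in> fibre l \<Longrightarrow> w' \<in> fibre l \<Longrightarrow> w' \<noteq> w \<Longrightarrow> 2 * r w \<le> dist w w'"
    by metis
  have hol: "\<phi> holomorphic_on ball w (r w)" if "w \<in> fibre l" for w
    by (rule holomorphic_on_subset[OF holomorphic_on_\<phi> r(2)[OF that]])
  have disj: "w = w'" if "w \<in> fibre l" "w' \<in> fibre l" "v \<in> ball w (r w)" "v \<in> ball w' (r w')" for w w' v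
  proof (rule ccontr)
    assume "w \<noteq> w'"
    then have "2 * r w \<le> dist w w'" "2 * r w' \<le> dist w w'"
      using r(4)[OF that(1,2)] r(4)[OF that(2,1)] by (auto simp: dist_commute)
    moreover have "dist w w' \<le> dist w v + dist w' v" by (rule dist_triangle2)
    ultimately show False using that(3,4) by simp
  qed
  have "\<exists>g. g holomorphic_on (\<phi> ` ball w (r w)) \<and> (\<forall>z\<in>ball w (r w). g (\<phi> z) = z)" if "w \<in> fibre l" for w
    using holomorphic_has_inverse[OF hol[OF that] open_ball r(3)[OF that]] by metis
  then obtain \<beta> where \<beta>: "\<And>w. w \<in> fibre l \<Longrightarrow> \<beta> w holomorphic_on (\<phi> ` ball w (r w))"
    "\<And>w z. w \<in> fibre l \<Longrightarrow> z \<in> ball w (r w) \<Longrightarrow> \<beta> w (\<phi> z) = z"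
    by metis
  define K where "K = cball 0 1 - (\<Union>w\<in>fibre l. ball w (r w))"
  have K: "compact K" unfolding K_def by (intro compact_diff compact_cball open_UN) auto
  have "continuous_on K \<phi>" by (rule continuous_on_subset[OF continuous_on_\<phi>]) (auto simp: K_def)
  then have "closed (\<phi> ` K)" using K by (intro compact_imp_closed compact_continuous_image)
  have lK: "l \<notin> \<phi> ` K"
  proof
    assume "l \<in> \<phi> ` K"
    then obtain v where v: "v \<in> K" "\<phi> v = l" by auto
    \<comment> \<open>K contains the unit circle, which cannot contribute to l as |\<phi>| = 1
      there.\<close>
    have "cmod v \<noteq> 1" using \<phi>_eq_1[of v] v(2) l1 by auto
    moreover have "cmod v \<le> 1" using v(1) by (simp add: K_def)
    ultimately have "v \<in> fibre l" using v(2) by (simp add: fibre_def)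
    then show False using v(1) r(1) by (auto simp: K_def)
  qed
  define Ob where "Ob = regular_values \<inter> (\<Inter>w\<in>fibre l. \<phi> ` ball w (r w)) \<inter> - (\<phi> ` K)"
  have "open Ob"
    unfolding Ob_def
    by (intro open_Int open_INT open_regular_values fin ballI open_mapping_thm3[OF hol open_ball r(3)]
        open_Compl \<open>closed (\<phi> ` K)\<close>)
  moreover have "l \<in> Ob"
  proof -
    have "l \<in> \<phi> ` ball w (r w)" if "w \<in> fibre l" for w
      by (rule image_eqI[of _ _ w]) (use that r(1)[OF that] in \<open>simp_all add: fibre_def\<close>)
    then show ?thesis unfolding Ob_def using l lK by blast
  qed
  ultimately obtain e where e: "e > 0" "ball l e \<subseteq> Ob" using open_contains_ball by blast
  have in_ball: "\<beta> w m \<in> ball w (r w) \<and> \<phi> (\<beta> w m) = m" if "w \<in> fibre l" "m \<in> ball l e" for w m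
  proof -
    have "m \<in> \<phi> ` ball w (r w)" using e(2) that by (auto simp: Ob_def)
    then show ?thesis using \<beta>(2)[OF that(1)] by auto
  qed
  have "local_branches l e \<beta>"
    unfolding local_branches_def
  proof (intro conjI ballI e(1))
    show "ball l e \<subseteq> regular_values" using e(2) by (auto simp: Ob_def)
    show "\<beta> w holomorphic_on ball l e" if "w \<in> fibre l" for w
      by (rule holomorphic_on_subset[OF \<beta>(1)[OF that]]) (use e(2) that in \<open>auto simp: Ob_def\<close>)
    show "\<beta> w l = w" if "w \<in> fibre l" for w
      using \<beta>(2)[OF that, of w] r(1)[OF that] that by (simp add: fibre_def)
    show "\<phi> (\<beta> w m) = m" if "w \<in> fibre l" "m \<in> ball l e" for w m using in_ball[OF that] by simp
    show "bij_betw (\<lambda>w. \<beta> w m) (fibre l) (fibre m)" if m: "m \<in> ball l e" for m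
      unfolding bij_betw_def
    proof
      show "inj_on (\<lambda>w. \<beta> w m) (fibre l)"
      proof (rule inj_onI)
        fix w w' assume w: "w \<in> fibre l" "w' \<in> fibre l" "\<beta> w m = \<beta> w' m"
        show "w = w'"
          using disj[OF w(1,2), of "\<beta> w m"] in_ball[OF w(1) m] in_ball[OF w(2) m] w(3) by simp
      qed
      show "(\<lambda>w. \<beta> w m) ` fibre l = fibre m"
      proof
        show "(\<lambda>w. \<beta> w m) ` fibre l \<subseteq> fibre m"
          using in_ball[OF _ m] r(2) by (auto simp: fibre_def subset_iff)
        show "fibre m \<subseteq> (\<lambda>w. \<beta> w m) ` fibre l"
        proof
          fix v assume v: "v \<in> fibre m"
          then have "\<phi> v \<notin> \<phi> ` K" using e(2) m by (auto simp: Ob_def fibre_def)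
          then have "v \<notin> K" by blast
          then obtain w where w: "w \<in> fibre l" "v \<in> ball w (r w)"
            using v by (auto simp: K_def fibre_def)
          then have "\<beta> w m = v" using \<beta>(2)[OF w] v by (simp add: fibre_def)
          then show "v \<in> (\<lambda>w. \<beta> w m) ` fibre l" using w by blast
        qed
      qed
    qed
  qed
  then show ?thesis by (rule that)
qed

section \<open>Integration over the fibres\<close>

text \<open>The weight is the Jacobian of the local inverses: this is the density at l of the image
  under \<phi> of the measure g dA.\<close>

definition fibre_sum :: "(complex \<Rightarrow> 'b::real_vector) \<Rightarrow> complex \<Rightarrow> 'b"
  where "fibre_sum g l = (\<Sum>w\<in>fibre l. (1 / (cmod (deriv \<phi> w))\<^sup>2) *\<^sub>R g w)"

definition fibre_nn_sum :: "(complex \<Rightarrow> ennreal) \<Rightarrow> complex \<Rightarrow> ennreal"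
  where "fibre_nn_sum g l = (\<Sum>w\<in>fibre l. ennreal (1 / (cmod (deriv \<phi> w))\<^sup>2) * g w)"

text \<open>The branches carry an arbitrary finite index set, so that no centre has to be remembered
  when a countable subcover is chosen, and the empty set may pad that subcover.\<close>

definition evenly_covered :: "complex set \<Rightarrow> bool"
  where "evenly_covered B \<longleftrightarrow> open B \<and> B \<subseteq> regular_values \<and>
    (\<exists>I \<beta>. finite I \<and> (\<forall>i\<in>I. \<beta> i holomorphic_on B) \<and> (\<forall>i\<in>I. \<forall>m\<in>B. \<phi> (\<beta> i m) = m) \<and>
      (\<forall>m\<in>B. bij_betw (\<lambda>i. \<beta> i m) (I :: complex set) (fibre m)))"

lemma evenly_covered_exists:
  assumes "l \<in> regular_values"
  shows "\<exists>B. l \<in> B \<and> evenly_covered B"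
proof -
  obtain e \<beta> where lb: "local_branches l e \<beta>" using local_branches_exist[OF assms] by blast
  note b = local_branchesD[OF lb]
  have "finite (fibre l)" by (rule fibre_finite_card[OF regular_value_lt[OF assms]])
  then have "evenly_covered (ball l e)"
    unfolding evenly_covered_def
    by (intro conjI exI[of _ "fibre l"] exI[of _ \<beta>] ballI open_ball b) auto
  then show ?thesis using b(1) by (intro exI[of _ "ball l e"]) simp
qed

lemma evenly_covered_imp: "evenly_covered B \<Longrightarrow> open B \<and> B \<subseteq> regular_values"
  by (simp add: evenly_covered_def)

lemma branch_deriv:
  assumes B: "open B" "\<beta> holomorphic_on B" "\<And>m. m \<in> B \<Longrightarrow> \<phi> (\<beta> m) = m"
    "\<And>m. m \<in> B \<Longrightarrow> \<beta> m \<in> unit_disk" and m: "m \<in> B"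
  shows "deriv \<phi> (\<beta> m) * deriv \<beta> m = 1"
proof -
  have "(\<beta> has_field_derivative deriv \<beta> m) (at m)" using B(1,2) m holomorphic_derivI by blast
  moreover have "(\<phi> has_field_derivative deriv \<phi> (\<beta> m)) (at (\<beta> m))"
    using holomorphic_on_\<phi> B(4)[OF m] holomorphic_derivI[OF _ open_ball] by blast
  ultimately have "((\<lambda>m. \<phi> (\<beta> m)) has_field_derivative deriv \<phi> (\<beta> m) * deriv \<beta> m) (at m)"
    using DERIV_chain2 by blast
  moreover have "((\<lambda>m. m) has_field_derivative 1) (at m)" by (rule DERIV_ident)
  then have "((\<lambda>m. \<phi> (\<beta> m)) has_field_derivative 1) (at m)"
    by (rule has_field_derivative_transform_within_open[OF _ B(1) m]) (simp add: B(3))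
  ultimately show ?thesis by (rule DERIV_unique)
qed

lemma borel_preimage:
  assumes A: "A \<in> sets borel"
  shows "unit_disk \<inter> \<phi> -` A \<in> sets borel"
proof -
  have m: "(\<lambda>z. indicator unit_disk z *\<^sub>R \<phi> z) \<in> borel_measurable borel"
    by (intro borel_measurable_continuous_on_indicator holomorphic_on_imp_continuous_on holomorphic_on_\<phi>) auto
  have "unit_disk \<inter> \<phi> -` A = unit_disk \<inter> (\<lambda>z. indicator unit_disk z *\<^sub>R \<phi> z) -` A"
    by (auto simp del: mem_ball_0)
  also have "\<dots> \<in> sets borel" by (intro sets.Int measurable_sets_borel[OF m] A) auto
  finally show ?thesis .
qed

text \<open>The part of the disk over A is a disjoint union of pieces, one in the image of each
  branch, and on each piece the change of variables produces the weight |\<beta>'|^2 =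
  1/|\<phi>'|^2.\<close>

lemma evenly_covered_nn_integral:
  assumes B: "evenly_covered B" and A[measurable]: "A \<in> sets borel" and AB: "A \<subseteq> B"
    and g[measurable]: "g \<in> borel_measurable borel"
  shows "(\<lambda>l. fibre_nn_sum g l * indicator A l) \<in> borel_measurable borel"
    and "(\<integral>\<^sup>+z\<in>unit_disk \<inter> \<phi> -` A. g z \<partial>lborel) = (\<integral>\<^sup>+l\<in>A. fibre_nn_sum g l \<partial>lborel)"
proof -
  from B obtain I :: "complex set" and \<beta> where "open B" "finite I" "\<forall>i\<in>I. \<beta> i holomorphic_on B"
    "\<forall>i\<in>I. \<forall>m\<in>B. \<phi> (\<beta> i m) = m" "\<forall>m\<in>B. bij_betw (\<lambda>i. \<beta> i m) I (fibre m)"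
    unfolding evenly_covered_def by (elim conjE exE)
  then have I: "open B" "finite I" "\<And>i. i \<in> I \<Longrightarrow> \<beta> i holomorphic_on B"
    "\<And>i m. i \<in> I \<Longrightarrow> m \<in> B \<Longrightarrow> \<phi> (\<beta> i m) = m" "\<And>m. m \<in> B \<Longrightarrow> bij_betw (\<lambda>i. \<beta> i m) I (fibre m)"
    by simp_all
  have Bm[measurable]: "B \<in> sets borel" using I(1) by simp
  have in_disk: "\<beta> i m \<in> unit_disk" if "i \<in> I" "m \<in> B" for i m
    using bij_betw_apply[OF I(5)[OF that(2)] that(1)] by (simp add: fibre_def)
  have inj: "inj_on (\<beta> i) B" if "i \<in> I" for i
    using I(4)[OF that] by (metis inj_onI)
  have der: "(cmod (deriv (\<beta> i) m))\<^sup>2 = 1 / (cmod (deriv \<phi> (\<beta> i m)))\<^sup>2" if "i \<in> I" "m \<in> B" for i m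
  proof -
    have "deriv \<phi> (\<beta> i m) * deriv (\<beta> i) m = 1"
      by (rule branch_deriv[OF I(1) I(3)]) (use that I(4) in_disk in auto)
    then have "cmod (deriv \<phi> (\<beta> i m)) * cmod (deriv (\<beta> i) m) = 1" by (metis norm_mult norm_one)
    then have "cmod (deriv (\<beta> i) m) = 1 / cmod (deriv \<phi> (\<beta> i m))"
      by (metis mult.commute nonzero_eq_divide_eq mult_zero_left zero_neq_one)
    then show ?thesis by (simp add: power_divide)
  qed
  have sum: "fibre_nn_sum g m = (\<Sum>i\<in>I. ennreal ((cmod (deriv (\<beta> i) m))\<^sup>2) * g (\<beta> i m))" if m: "m \<in> B" for m
  proof -
    have "fibre_nn_sum g m = (\<Sum>i\<in>I. ennreal (1 / (cmod (deriv \<phi> (\<beta> i m)))\<^sup>2) * g (\<beta> i m))"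
      unfolding fibre_nn_sum_def by (rule sum.reindex_bij_betw[OF I(5)[OF m], symmetric])
    then show ?thesis using der m by simp
  qed
  have cont: "(\<lambda>m. indicator B m *\<^sub>R f m) \<in> borel_measurable borel"
    if "f holomorphic_on B" for f :: "complex \<Rightarrow> complex"
    by (intro borel_measurable_continuous_on_indicator holomorphic_on_imp_continuous_on that) auto
  define T where "T = (\<lambda>i m. ennreal ((cmod (deriv (\<beta> i) m))\<^sup>2) * g (\<beta> i m) * indicator A m)"
  have T[measurable]: "T i \<in> borel_measurable borel" if "i \<in> I" for i
  proof -
    have [measurable]: "(\<lambda>m. indicator B m *\<^sub>R \<beta> i m) \<in> borel_measurable borel"
      "(\<lambda>m. indicator B m *\<^sub>R deriv (\<beta> i) m) \<in> borel_measurable borel"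
      by (intro cont holomorphic_deriv I(1) I(3)[OF that])+
    have "(\<lambda>m. ennreal ((cmod (indicator B m *\<^sub>R deriv (\<beta> i) m))\<^sup>2) * g (indicator B m *\<^sub>R \<beta> i m) * indicator A m)
        \<in> borel_measurable borel" by measurable
    also have "(\<lambda>m. ennreal ((cmod (indicator B m *\<^sub>R deriv (\<beta> i) m))\<^sup>2) * g (indicator B m *\<^sub>R \<beta> i m) * indicator A m) = T i"
      using AB by (auto simp: T_def fun_eq_iff indicator_def)
    finally show ?thesis .
  qed
  have eq: "fibre_nn_sum g m * indicator A m = (\<Sum>i\<in>I. T i m)" for m
    using sum AB by (cases "m \<in> A") (auto simp: T_def)
  show "(\<lambda>l. fibre_nn_sum g l * indicator A l) \<in> borel_measurable borel"
    unfolding eq by measurable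
  define X where "X = unit_disk \<inter> \<phi> -` A"
  have X[measurable]: "X \<in> sets borel" unfolding X_def by (rule borel_preimage[OF A])
  have img[measurable]: "\<beta> i ` B \<in> sets borel" if "i \<in> I" for i
    using open_mapping_thm3[OF I(3)[OF that] I(1) inj[OF that]] by simp
  \<comment> \<open>Exactly one branch passes through z, namely the one with value z at \<phi>
    z.\<close>
  have ind: "(\<Sum>i\<in>I. indicator (\<beta> i ` B) z) = (1::ennreal)" if "z \<in> X" for z
  proof -
    have z: "\<phi> z \<in> B" "z \<in> fibre (\<phi> z)" using that AB by (auto simp: X_def fibre_def)
    obtain i where i: "i \<in> I" "\<beta> i (\<phi> z) = z"
      using z(2) bij_betw_imp_surj_on[OF I(5)[OF z(1)]] by (metis imageE)
    have "z \<notin> \<beta> j ` B" if "j \<in> I" "j \<noteq> i" for j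
    proof
      assume "z \<in> \<beta> j ` B"
      then obtain m where m: "m \<in> B" "z = \<beta> j m" by auto
      then have "m = \<phi> z" using I(4)[OF that(1)] by simp
      then have "\<beta> j (\<phi> z) = \<beta> i (\<phi> z)" using m i by simp
      then show False using I(5)[OF z(1)] that i(1) by (auto simp: bij_betw_def inj_on_def)
    qed
    moreover have "z \<in> \<beta> i ` B" using i z by (metis imageI)
    ultimately have "(\<Sum>j\<in>I. indicator (\<beta> j ` B) z) = (\<Sum>j\<in>I. if j = i then 1 else (0::ennreal))"
      by (intro sum.cong) (auto simp: indicator_def)
    then show ?thesis using i(1) I(2) by simp
  qed
  have "(\<integral>\<^sup>+z\<in>X. g z \<partial>lborel) = (\<integral>\<^sup>+z. (\<Sum>i\<in>I. g z * indicator X z * indicator (\<beta> i ` B) z) \<partial>lborel)"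
  proof (rule nn_integral_cong)
    fix z show "g z * indicator X z = (\<Sum>i\<in>I. g z * indicator X z * indicator (\<beta> i ` B) z)"
      unfolding sum_distrib_left[symmetric] by (cases "z \<in> X") (simp_all add: ind)
  qed
  also have "\<dots> = (\<Sum>i\<in>I. \<integral>\<^sup>+z\<in>\<beta> i ` B. g z * indicator X z \<partial>lborel)"
    by (rule nn_integral_sum) measurable
  also have "\<dots> = (\<Sum>i\<in>I. \<integral>\<^sup>+m. T i m \<partial>lborel)"
  proof (rule sum.cong[OF refl])
    fix i assume i: "i \<in> I"
    have "(\<integral>\<^sup>+z\<in>\<beta> i ` B. g z * indicator X z \<partial>lborel)
       = (\<integral>\<^sup>+m\<in>B. ennreal ((cmod (deriv (\<beta> i) m))\<^sup>2) * (g (\<beta> i m) * indicator X (\<beta> i m)) \<partial>lborel)"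
      by (rule holomorphic_image_nn_integral[OF I(3)[OF i] I(1) inj[OF i]]) measurable
    also have "\<dots> = (\<integral>\<^sup>+m. T i m \<partial>lborel)"
    proof (rule nn_integral_cong)
      fix m
      have "indicator X (\<beta> i m) = (indicator A m :: ennreal)" if "m \<in> B"
        using I(4)[OF i that] in_disk[OF i that] by (auto simp: X_def indicator_def)
      then show "ennreal ((cmod (deriv (\<beta> i) m))\<^sup>2) * (g (\<beta> i m) * indicator X (\<beta> i m)) * indicator B m = T i m"
        using AB by (cases "m \<in> B"; cases "m \<in> A") (auto simp: T_def mult_ac)
    qed
    finally show "(\<integral>\<^sup>+z\<in>\<beta> i ` B. g z * indicator X z \<partial>lborel) = (\<integral>\<^sup>+m. T i m \<partial>lborel)" .
  qed
  also have "\<dots> = (\<integral>\<^sup>+m. (\<Sum>i\<in>I. T i m) \<partial>lborel)"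
    by (rule nn_integral_sum[symmetric]) measurable
  finally show "(\<integral>\<^sup>+z\<in>unit_disk \<inter> \<phi> -` A. g z \<partial>lborel) = (\<integral>\<^sup>+l\<in>A. fibre_nn_sum g l \<partial>lborel)"
    unfolding X_def[symmetric] eq .
qed

text \<open>A countable subcover by evenly covered sets, made disjoint, reduces this to the local
  formula; the finitely many points over critical values form a null set. Nonnegativity permits the
  exchange of the countable sum with the integral.\<close>

lemma fibre_nn_integral:
  assumes g[measurable]: "g \<in> borel_measurable borel"
  shows "(\<lambda>l. fibre_nn_sum g l * indicator regular_values l) \<in> borel_measurable borel"
    and "(\<integral>\<^sup>+z\<in>unit_disk. g z \<partial>lborel) = (\<integral>\<^sup>+l\<in>regular_values. fibre_nn_sum g l \<partial>lborel)"
proof -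
  have cover: "\<Union>(Collect evenly_covered) = regular_values"
    using evenly_covered_exists evenly_covered_imp by blast
  obtain F where F: "F \<subseteq> Collect evenly_covered" "countable F" "\<Union>F = regular_values"
    using Lindelof[of "Collect evenly_covered"] evenly_covered_imp unfolding cover
    by (metis mem_Collect_eq)
  have evempty: "evenly_covered {}"
    unfolding evenly_covered_def by (intro conjI exI[of _ "{}"]) auto
  define B where "B = from_nat_into (insert {} F)"
  have rB: "range B = insert {} F" unfolding B_def using F(2) by (intro range_from_nat_into) auto
  have evB: "evenly_covered (B k)" for k using rB F(1) evempty by (metis insertE mem_Collect_eq rangeI subsetD)
  have UB: "(\<Union>k. B k) = regular_values" unfolding rB by (simp add: F(3))
  define A where "A = disjointed B"
  have Bm: "B k \<in> sets borel" for k using evenly_covered_imp[OF evB[of k]] by simp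
  have Am[measurable]: "A k \<in> sets borel" for k
    unfolding A_def using Bm by (auto simp: disjointed_def)
  have AB: "A k \<subseteq> B k" for k unfolding A_def by (rule disjointed_subset)
  have UA: "(\<Union>k. A k) = regular_values" unfolding A_def using UB by (simp add: UN_disjointed_eq)
  have disjA: "disjoint_family A" unfolding A_def by (rule disjoint_family_disjointed)
  have indV: "(\<Sum>k. indicator (A k) l) = (indicator regular_values l :: ennreal)" for l
    using suminf_indicator[OF disjA, of l] by (simp add: UA)
  have split: "fibre_nn_sum g l * indicator regular_values l = (\<Sum>k. fibre_nn_sum g l * indicator (A k) l)" for l
    by (simp add: indV[symmetric])
  note m1 = evenly_covered_nn_integral(1)[OF evB Am AB g]
  note m2 = evenly_covered_nn_integral(2)[OF evB Am AB g]
  show "(\<lambda>l. fibre_nn_sum g l * indicator regular_values l) \<in> borel_measurable borel"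
    unfolding split by (intro borel_measurable_suminf_order m1)
  define X where "X = (\<lambda>k. unit_disk \<inter> \<phi> -` A k)"
  have Xm[measurable]: "X k \<in> sets borel" for k unfolding X_def by (rule borel_preimage[OF Am])
  have disjX: "disjoint_family X"
    using disjA by (auto simp: disjoint_family_on_def X_def)
  have UX: "(\<Union>k. X k) = regular_points"
  proof -
    have "(\<Union>k. X k) = unit_disk \<inter> \<phi> -` (\<Union>k. A k)" by (auto simp: X_def)
    then show ?thesis unfolding UA using regular_points_iff by blast
  qed
  have null: "AE z in lborel. indicator unit_disk z = (indicator regular_points z :: ennreal)"
  proof -
    have "branch_fibres \<phi> \<in> null_sets lborel"
      by (rule finite_imp_null_set_lborel[OF finite_branch_fibres])
    then show ?thesis
      by (rule AE_I') (auto simp: regular_points_def indicator_def)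
  qed
  have "(\<integral>\<^sup>+z\<in>unit_disk. g z \<partial>lborel) = (\<integral>\<^sup>+z\<in>regular_points. g z \<partial>lborel)"
    by (rule nn_integral_cong_AE) (use null in eventually_elim, simp)
  also have "\<dots> = (\<integral>\<^sup>+z. (\<Sum>k. g z * indicator (X k) z) \<partial>lborel)"
    using suminf_indicator[OF disjX] by (intro nn_integral_cong) (simp add: UX)
  also have "\<dots> = (\<Sum>k. \<integral>\<^sup>+z\<in>X k. g z \<partial>lborel)"
    by (rule nn_integral_suminf) measurable
  also have "\<dots> = (\<Sum>k. \<integral>\<^sup>+l\<in>A k. fibre_nn_sum g l \<partial>lborel)"
    unfolding X_def m2 ..
  also have "\<dots> = (\<integral>\<^sup>+l. (\<Sum>k. fibre_nn_sum g l * indicator (A k) l) \<partial>lborel)"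
    by (rule nn_integral_suminf[symmetric]) (simp add: m1)
  finally show "(\<integral>\<^sup>+z\<in>unit_disk. g z \<partial>lborel) = (\<integral>\<^sup>+l\<in>regular_values. fibre_nn_sum g l \<partial>lborel)"
    unfolding split .
qed

lemma fibre_nn_sum_ennreal:
  assumes "\<And>z. 0 \<le> g z"
  shows "fibre_nn_sum (\<lambda>z. ennreal (g z)) l = ennreal (fibre_sum g l)"
  unfolding fibre_nn_sum_def fibre_sum_def
  by (subst sum_ennreal[symmetric]) (auto simp: assms ennreal_mult'[symmetric])

lemma fibre_integral_nonneg:
  fixes g :: "complex \<Rightarrow> real"
  assumes g[measurable]: "g \<in> borel_measurable borel" and g0: "\<And>z. 0 \<le> g z"
    and int: "has_bochner_integral lborel (\<lambda>z. indicator unit_disk z *\<^sub>R g z) x"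
  shows "has_bochner_integral lborel (\<lambda>l. indicator regular_values l *\<^sub>R fibre_sum g l) x"
proof -
  note eq = fibre_nn_sum_ennreal[of g, OF g0]
  have f0: "0 \<le> fibre_sum g l" for l
    unfolding fibre_sum_def by (intro sum_nonneg) (auto simp: g0)
  have e: "ennreal (indicator A l *\<^sub>R u) = ennreal u * indicator A l" for A :: "complex set" and l u
    by (auto simp: indicator_def)
  have "(\<lambda>l. enn2real (fibre_nn_sum (\<lambda>z. ennreal (g z)) l * indicator regular_values l)) \<in> borel_measurable borel"
    using fibre_nn_integral(1)[of "\<lambda>z. ennreal (g z)"] by measurable
  also have "(\<lambda>l. enn2real (fibre_nn_sum (\<lambda>z. ennreal (g z)) l * indicator regular_values l))
     = (\<lambda>l. indicator regular_values l *\<^sub>R fibre_sum g l)"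
    unfolding eq using f0 by (auto simp: fun_eq_iff indicator_def)
  finally have m: "(\<lambda>l. indicator regular_values l *\<^sub>R fibre_sum g l) \<in> borel_measurable lborel" by simp
  have x: "0 \<le> x" using int g0 by (auto simp: has_bochner_integral_iff intro!: integral_nonneg_AE)
  have "(\<integral>\<^sup>+l. ennreal (indicator regular_values l *\<^sub>R fibre_sum g l) \<partial>lborel)
     = (\<integral>\<^sup>+z\<in>unit_disk. ennreal (g z) \<partial>lborel)"
    unfolding e by (subst fibre_nn_integral(2)) (auto simp: eq)
  also have "\<dots> = (\<integral>\<^sup>+z. ennreal (indicator unit_disk z *\<^sub>R g z) \<partial>lborel)" unfolding e ..
  also have "\<dots> = ennreal x"
    using int g0 by (subst nn_integral_eq_integral) (auto simp: has_bochner_integral_iff)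
  finally show ?thesis
    by (intro has_bochner_integral_nn_integral m) (auto simp: f0 x)
qed

text \<open>Positive and negative parts are dominated by |g|, hence integrable, and the fibre sum is
  linear.\<close>

lemma fibre_integral_real:
  fixes g :: "complex \<Rightarrow> real"
  assumes g[measurable]: "g \<in> borel_measurable borel"
    and int: "has_bochner_integral lborel (\<lambda>z. indicator unit_disk z *\<^sub>R g z) x"
  shows "has_bochner_integral lborel (\<lambda>l. indicator regular_values l *\<^sub>R fibre_sum g l) x"
proof -
  define p where "p = (\<lambda>z. max 0 (g z))"
  define q where "q = (\<lambda>z. max 0 (- g z))"
  have [measurable]: "p \<in> borel_measurable borel" "q \<in> borel_measurable borel"
    unfolding p_def q_def by measurable
  have I: "integrable lborel (\<lambda>z. indicator unit_disk z *\<^sub>R g z)" using int by (simp add: has_bochner_integral_iff)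
  have ip: "integrable lborel (\<lambda>z. indicator unit_disk z *\<^sub>R p z)"
    by (rule Bochner_Integration.integrable_bound[OF I]) (auto simp: p_def indicator_def)
  have iq: "integrable lborel (\<lambda>z. indicator unit_disk z *\<^sub>R q z)"
    by (rule Bochner_Integration.integrable_bound[OF I]) (auto simp: q_def indicator_def)
  have gpq: "g z = p z - q z" for z by (auto simp: p_def q_def)
  have hp: "has_bochner_integral lborel (\<lambda>l. indicator regular_values l *\<^sub>R fibre_sum p l)
      (\<integral>z. indicator unit_disk z *\<^sub>R p z \<partial>lborel)"
    by (rule fibre_integral_nonneg) (use ip in \<open>auto simp: has_bochner_integral_iff p_def\<close>)
  have hq: "has_bochner_integral lborel (\<lambda>l. indicator regular_values l *\<^sub>R fibre_sum q l)
      (\<integral>z. indicator unit_disk z *\<^sub>R q z \<partial>lborel)"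
    by (rule fibre_integral_nonneg) (use iq in \<open>auto simp: has_bochner_integral_iff q_def\<close>)
  have "fibre_sum g l = fibre_sum p l - fibre_sum q l" for l
    by (simp add: fibre_sum_def gpq right_diff_distrib sum_subtractf diff_divide_distrib)
  moreover have "x = (\<integral>z. indicator unit_disk z *\<^sub>R p z \<partial>lborel) - (\<integral>z. indicator unit_disk z *\<^sub>R q z \<partial>lborel)"
  proof -
    have "x = (\<integral>z. indicator unit_disk z *\<^sub>R g z \<partial>lborel)"
      using int by (simp only: has_bochner_integral_iff)
    also have "(\<lambda>z. indicator unit_disk z *\<^sub>R g z)
        = (\<lambda>z. indicator unit_disk z *\<^sub>R p z - indicator unit_disk z *\<^sub>R q z)"
      by (simp only: gpq scaleR_right_diff_distrib)
    finally show ?thesis by (simp only: Bochner_Integration.integral_diff[OF ip iq])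
  qed
  ultimately show ?thesis
    using has_bochner_integral_diff[OF hp hq] by (simp add: right_diff_distrib)
qed

lemma fibre_integral:
  fixes g :: "complex \<Rightarrow> complex"
  assumes g[measurable]: "g \<in> borel_measurable borel"
    and int: "has_bochner_integral lborel (\<lambda>z. indicator unit_disk z *\<^sub>R g z) x"
  shows "has_bochner_integral lborel (\<lambda>l. indicator regular_values l *\<^sub>R fibre_sum g l) x"
proof -
  have r: "has_bochner_integral lborel (\<lambda>z. indicator unit_disk z *\<^sub>R Re (g z)) (Re x)"
    using has_bochner_integral_bounded_linear[OF bounded_linear_Re int] by simp
  have i: "has_bochner_integral lborel (\<lambda>z. indicator unit_disk z *\<^sub>R Im (g z)) (Im x)"
    using has_bochner_integral_bounded_linear[OF bounded_linear_Im int] by simp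
  have "has_bochner_integral lborel (\<lambda>l. of_real (indicator regular_values l *\<^sub>R fibre_sum (\<lambda>z. Re (g z)) l)
      + \<i> * of_real (indicator regular_values l *\<^sub>R fibre_sum (\<lambda>z. Im (g z)) l)) (of_real (Re x) + \<i> * of_real (Im x))"
    by (intro has_bochner_integral_add has_bochner_integral_mult_right
        has_bochner_integral_bounded_linear[OF bounded_linear_of_real] fibre_integral_real r i) measurable
  moreover have "of_real (fibre_sum (\<lambda>z. Re (g z)) l) + \<i> * of_real (fibre_sum (\<lambda>z. Im (g z)) l) = fibre_sum g l" for l
    by (simp add: fibre_sum_def complex_eq_iff Re_sum Im_sum)
  moreover have "of_real (indicator A l *\<^sub>R u) + \<i> * of_real (indicator A l *\<^sub>R v)
      = indicator A l *\<^sub>R (of_real u + \<i> * of_real v)" for A :: "complex set" and l u v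
    by (simp add: indicator_def)
  ultimately show ?thesis by (simp only: complex_eq[symmetric])
qed

end

section \<open>Operators commuting with multiplication by a Blaschke product\<close>

text \<open>If u l0 were nonzero, integrating u times the conjugate of u l0 against a bump at l0
  would give a positive real part. The bump is a uniform limit of real polynomials in Re l and Im l,
  whose integrals against u are combinations of the moments.\<close>

lemma continuous_zero_if_moments_zero:
  fixes u :: "complex \<Rightarrow> complex"
  assumes V: "open V" "V \<subseteq> cball 0 1" and u: "continuous_on V u"
    and int: "integrable lborel (\<lambda>l. indicator V l *\<^sub>R u l)"
    and mom: "\<And>i j. has_bochner_integral lborel (\<lambda>l. indicator V l *\<^sub>R (l ^ i * cnj l ^ j * u l)) 0"
    and l0: "l0 \<in> V"
  shows "u l0 = 0"
proof -
  \<comment> \<open>All moments are built into the condition: multiplication by l or its conjugate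
    then only shifts an exponent, and the induction over polynomials goes through for every
    multiplier v.\<close>
  define \<U> where "\<U> = {v :: complex \<Rightarrow> complex. \<forall>i j.
    has_bochner_integral lborel (\<lambda>l. indicator V l *\<^sub>R (l ^ i * cnj l ^ j * (v l * u l))) 0}"
  have U_add: "(\<lambda>l. v l + w l) \<in> \<U>" if "v \<in> \<U>" "w \<in> \<U>" for v w
  proof -
    have "has_bochner_integral lborel (\<lambda>l. indicator V l *\<^sub>R (l ^ i * cnj l ^ j * (v l * u l))
        + indicator V l *\<^sub>R (l ^ i * cnj l ^ j * (w l * u l))) (0 + 0)" for i j
      by (rule has_bochner_integral_add) (use that in \<open>auto simp: \<U>_def\<close>)
    then show ?thesis by (simp add: \<U>_def algebra_simps)
  qed
  have U_scale: "(\<lambda>l. c * v l) \<in> \<U>" if "v \<in> \<U>" for v c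
  proof -
    have "has_bochner_integral lborel (\<lambda>l. c * (indicator V l *\<^sub>R (l ^ i * cnj l ^ j * (v l * u l)))) (c * 0)" for i j
      by (rule has_bochner_integral_mult_right) (use that in \<open>auto simp: \<U>_def\<close>)
    then show ?thesis by (simp add: \<U>_def mult_ac)
  qed
  have U_id: "(\<lambda>l. l * v l) \<in> \<U>" if v: "v \<in> \<U>" for v
  proof -
    have "has_bochner_integral lborel (\<lambda>l. indicator V l *\<^sub>R (l ^ Suc i * cnj l ^ j * (v l * u l))) 0" for i j
      using v unfolding \<U>_def by blast
    then show ?thesis by (simp add: \<U>_def mult_ac)
  qed
  have U_cnj: "(\<lambda>l. cnj l * v l) \<in> \<U>" if v: "v \<in> \<U>" for v
  proof -
    have "has_bochner_integral lborel (\<lambda>l. indicator V l *\<^sub>R (l ^ i * cnj l ^ Suc j * (v l * u l))) 0" for i j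
      using v unfolding \<U>_def by blast
    then show ?thesis by (simp add: \<U>_def mult_ac)
  qed
  have one: "(\<lambda>_. 1) \<in> \<U>" using mom by (simp add: \<U>_def)
  have poly: "(\<lambda>l. of_real (p l) * v l) \<in> \<U>" if "real_polynomial_function p" "v \<in> \<U>" for p v
    using that
  proof (induction arbitrary: v rule: real_polynomial_function.induct)
    case (linear f)
    have f: "f l = Re l * f 1 + Im l * f \<i>" for l
    proof -
      have "f (Re l *\<^sub>R 1 + Im l *\<^sub>R \<i>) = Re l * f 1 + Im l * f \<i>"
        using linear.hyps by (simp add: linear_simps)
      then show ?thesis by (simp add: scaleR_conv_of_real mult.commute complex_eq[symmetric])
    qed
    \<comment> \<open>The real linear form Re l * f 1 + Im l * f \<i> becomes c l + d cnj l.\<close>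
    define c where "c = (of_real (f 1) - \<i> * of_real (f \<i>)) / 2"
    define d where "d = (of_real (f 1) + \<i> * of_real (f \<i>)) / 2"
    have "of_real (f l) * v l = c * (l * v l) + d * (cnj l * v l)" for l
    proof -
      have "of_real (f l) = c * l + d * cnj l"
        unfolding f[of l] c_def d_def by (simp add: complex_eq_iff algebra_simps add_divide_distrib[symmetric])
      then show ?thesis by (simp add: algebra_simps)
    qed
    then show ?case
      using U_add[OF U_scale[OF U_id[OF linear.prems]] U_scale[OF U_cnj[OF linear.prems]], of c d] by simp
  next
    case (const c)
    then show ?case by (rule U_scale)
  next
    case (add f g)
    then show ?case using U_add[OF add.IH(1)[OF add.prems] add.IH(2)[OF add.prems]] by (simp add: algebra_simps)
  next
    case (mult f g)
    show ?case using mult.IH(1)[OF mult.IH(2)[OF mult.prems]] by (simp add: mult_ac)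
  qed
  have poly0: "has_bochner_integral lborel (\<lambda>l. of_real (p l) * (indicator V l *\<^sub>R u l)) 0"
    if "real_polynomial_function p" for p
  proof -
    have "\<forall>i j. has_bochner_integral lborel (\<lambda>l. indicator V l *\<^sub>R (l ^ i * cnj l ^ j * (of_real (p l) * 1 * u l))) 0"
      using poly[OF that one] unfolding \<U>_def by blast
    from this[rule_format, of 0 0] show ?thesis by (simp add: mult_ac)
  qed
  define N where "N = (\<integral>l. norm (indicator V l *\<^sub>R u l) \<partial>lborel)"
  have N0: "0 \<le> N" unfolding N_def by (rule integral_nonneg_AE) simp
  have cont0: "(\<integral>l. of_real (q l) * (indicator V l *\<^sub>R u l) \<partial>lborel) = 0"
    and cont_int: "integrable lborel (\<lambda>l. of_real (q l) * (indicator V l *\<^sub>R u l))"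
    if q: "continuous_on UNIV q" for q :: "complex \<Rightarrow> real"
  proof -
    have [measurable]: "q \<in> borel_measurable borel" by (rule borel_measurable_continuous_onI[OF q])
    have [measurable]: "(\<lambda>l. indicator V l *\<^sub>R u l) \<in> borel_measurable borel"
      using int borel_measurable_integrable by fastforce
    have "bounded (q ` cball 0 1)"
      by (intro compact_imp_bounded compact_continuous_image continuous_on_subset[OF q]) auto
    then obtain C where "\<forall>x\<in>q ` cball 0 1. norm x \<le> C" unfolding bounded_iff by blast
    then have C: "\<And>l. l \<in> cball 0 1 \<Longrightarrow> \<bar>q l\<bar> \<le> C" by simp
    show I: "integrable lborel (\<lambda>l. of_real (q l) * (indicator V l *\<^sub>R u l))"
    proof (rule Bochner_Integration.integrable_bound)
      show "integrable lborel (\<lambda>l. C * norm (indicator V l *\<^sub>R u l))"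
        by (intro integrable_mult_right integrable_norm int)
      have "norm (of_real (q l) * (indicator V l *\<^sub>R u l)) \<le> norm (C * norm (indicator V l *\<^sub>R u l))" for l
      proof (cases "l \<in> V")
        case True
        then have "\<bar>q l\<bar> \<le> \<bar>C\<bar>" using C[of l] V(2) by force
        then show ?thesis using True by (simp add: norm_mult abs_mult mult_right_mono)
      qed simp
      then show "AE l in lborel. norm (of_real (q l) * (indicator V l *\<^sub>R u l)) \<le> norm (C * norm (indicator V l *\<^sub>R u l))"
        by blast
    qed measurable
    have "norm (\<integral>l. of_real (q l) * (indicator V l *\<^sub>R u l) \<partial>lborel) \<le> e" if e: "e > 0" for e
    proof -
      \<comment> \<open>The summand 1 guards against N = 0.\<close>
      define e' where "e' = e / (N + 1)"
      have e': "e' > 0" using e N0 by (simp add: e'_def)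
      obtain p where p: "real_polynomial_function p" "\<And>l. l \<in> cball 0 1 \<Longrightarrow> \<bar>q l - p l\<bar> < e'"
        using Stone_Weierstrass_real_polynomial_function[OF compact_cball continuous_on_subset[OF q subset_UNIV] e'] by metis
      have P: "integrable lborel (\<lambda>l. of_real (p l) * (indicator V l *\<^sub>R u l))"
        "(\<integral>l. of_real (p l) * (indicator V l *\<^sub>R u l) \<partial>lborel) = 0"
        using poly0[OF p(1)] by (simp_all add: has_bochner_integral_iff)
      have "(\<integral>l. of_real (q l) * (indicator V l *\<^sub>R u l) \<partial>lborel)
          = (\<integral>l. of_real (q l) * (indicator V l *\<^sub>R u l) - of_real (p l) * (indicator V l *\<^sub>R u l) \<partial>lborel)"
        by (subst Bochner_Integration.integral_diff[OF I P(1)]) (simp only: P(2), simp)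
      also have "norm \<dots> \<le> (\<integral>l. e' * norm (indicator V l *\<^sub>R u l) \<partial>lborel)"
      proof (rule order_trans[OF integral_norm_bound integral_mono])
        show "integrable lborel (\<lambda>l. norm (of_real (q l) * (indicator V l *\<^sub>R u l) - of_real (p l) * (indicator V l *\<^sub>R u l)))"
          by (intro integrable_norm Bochner_Integration.integrable_diff I P(1))
        show "integrable lborel (\<lambda>l. e' * norm (indicator V l *\<^sub>R u l))"
          by (intro integrable_mult_right integrable_norm int)
        fix l
        show "norm (of_real (q l) * (indicator V l *\<^sub>R u l) - of_real (p l) * (indicator V l *\<^sub>R u l))
          \<le> e' * norm (indicator V l *\<^sub>R u l)"
        proof (cases "l \<in> V")
          case True
          have "norm (of_real (q l) * u l - of_real (p l) * u l) = \<bar>q l - p l\<bar> * norm (u l)"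
            by (metis left_diff_distrib norm_mult norm_of_real of_real_diff)
          also have "\<dots> \<le> e' * norm (u l)"
            using p(2)[of l] True V(2) by (intro mult_right_mono) force+
          finally show ?thesis using True by simp
        qed simp
      qed
      also have "\<dots> = e' * N" by (simp add: N_def)
      also have "\<dots> \<le> e" using e N0 by (simp add: e'_def field_simps)
      finally show ?thesis .
    qed
    then have "norm (\<integral>l. of_real (q l) * (indicator V l *\<^sub>R u l) \<partial>lborel) \<le> 0"
      by (rule field_le_epsilon) simp
    then show "(\<integral>l. of_real (q l) * (indicator V l *\<^sub>R u l) \<partial>lborel) = 0" by simp
  qed
  show "u l0 = 0"
  proof (rule ccontr)
    assume nz: "u l0 \<noteq> 0"
    define k where "k = (cmod (u l0))\<^sup>2"
    have k: "k > 0" using nz by (simp add: k_def)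
    have c: "continuous_on V (\<lambda>l. Re (cnj (u l0) * u l))" by (intro continuous_intros u)
    define W where "W = V \<inter> (\<lambda>l. Re (cnj (u l0) * u l)) -` {k / 2 <..}"
    have "open W"
      unfolding W_def by (rule continuous_open_preimage[OF c V(1)]) simp
    moreover have "Re (cnj (u l0) * u l0) = k"
      unfolding k_def cmod_power2 by (simp add: power2_eq_square)
    then have "l0 \<in> W" using l0 k unfolding W_def by simp
    ultimately obtain e where e: "e > 0" "ball l0 e \<subseteq> W"
      using open_contains_ball by blast
    \<comment> \<open>A tent supported in a ball on which Re (cnj (u l0) * u) exceeds k / 2. On the
      ball of half the radius it is at least e / 2, which yields the lower bound of the
      integral.\<close>
    define q where "q = (\<lambda>l. max 0 (e - dist l l0))"
    have q: "continuous_on UNIV q" unfolding q_def by (intro continuous_intros)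
    have "integrable lborel (\<lambda>l. cnj (u l0) * (of_real (q l) * (indicator V l *\<^sub>R u l)))"
      by (intro integrable_mult_right cont_int q)
    then have I: "integrable lborel (\<lambda>l. Re (cnj (u l0) * (of_real (q l) * (indicator V l *\<^sub>R u l))))"
      by (rule integrable_Re)
    have "(\<integral>l. cnj (u l0) * (of_real (q l) * (indicator V l *\<^sub>R u l)) \<partial>lborel) = 0"
      by (simp only: integral_mult_right_zero cont0[OF q] mult_zero_right)
    then have z: "(\<integral>l. Re (cnj (u l0) * (of_real (q l) * (indicator V l *\<^sub>R u l))) \<partial>lborel) = 0"
      using integral_Re[OF integrable_mult_right[OF cont_int[OF q]], of "cnj (u l0)"] by simp
    have b: "integrable lborel (\<lambda>l. (e / 2 * (k / 2)) * indicator (ball l0 (e / 2)) l)"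
      using emeasure_lborel_ball_finite[of l0 "e / 2"] by (intro integrable_mult_right integrable_real_indicator) auto
    have "(\<integral>l. (e / 2 * (k / 2)) * indicator (ball l0 (e / 2)) l \<partial>lborel) \<le> 0"
      unfolding z[symmetric]
    proof (rule integral_mono[OF b I])
      fix l
      have r: "Re (cnj (u l0) * (of_real (q l) * (indicator V l *\<^sub>R u l))) = q l * (indicator V l * Re (cnj (u l0) * u l))"
        by (simp add: indicator_def algebra_simps)
      show "(e / 2 * (k / 2)) * indicator (ball l0 (e / 2)) l \<le> Re (cnj (u l0) * (of_real (q l) * (indicator V l *\<^sub>R u l)))"
      proof (cases "l \<in> ball l0 e")
        case False
        then have "q l = 0" by (simp add: q_def dist_commute)
        moreover have "l \<notin> ball l0 (e / 2)" using False e(1) by auto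
        ultimately show ?thesis unfolding r by simp
      next
        case True
        then have lV: "l \<in> V" "k / 2 < Re (cnj (u l0) * u l)"
            using e(2) unfolding W_def by blast+
        have q0: "0 \<le> q l" by (simp add: q_def)
        show ?thesis
        proof (cases "l \<in> ball l0 (e / 2)")
          case True
          then have "e / 2 \<le> e - dist l l0" by (simp add: dist_commute)
          then have "e / 2 \<le> q l" unfolding q_def by (rule order_trans) simp
          then have "e / 2 * (k / 2) \<le> q l * Re (cnj (u l0) * u l)"
            using lV(2) e(1) k by (intro mult_mono) auto
          then show ?thesis unfolding r using True lV(1) by simp
        next
          case False
          have "0 \<le> q l * Re (cnj (u l0) * u l)" using q0 lV(2) k by (intro mult_nonneg_nonneg) auto
          then show ?thesis unfolding r using False lV(1) by simp
        qed
      qed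
    qed
    moreover have "(\<integral>l. (e / 2 * (k / 2)) * indicator (ball l0 (e / 2)) l \<partial>lborel)
        = e / 2 * (k / 2) * measure lborel (ball l0 (e / 2))" by simp
    moreover have "measure lborel (ball l0 (e / 2)) > 0" using content_ball_pos[of "e/2" l0] e(1) by simp
    ultimately show False using e(1) k by (auto simp: mult_le_0_iff)
  qed
qed

text \<open>On a circle \<open>|z| = \<rho>\<close> one has \<open>cnj z = \<rho>\<^sup>2 / z\<close>, which makes the identity holomorphic;
  then let \<open>\<rho>\<close> tend to 0.\<close>

lemma holomorphic_polarization:
  assumes I: "finite I" and A: "\<And>i. i \<in> I \<Longrightarrow> A i holomorphic_on ball l0 e"
    and B: "\<And>i. i \<in> I \<Longrightarrow> B i holomorphic_on ball l0 e"
    and eq: "\<And>m. m \<in> ball l0 e \<Longrightarrow> (\<Sum>i\<in>I. A i m * cnj (B i m)) = 0"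
    and m: "m \<in> ball l0 e"
  shows "(\<Sum>i\<in>I. A i m * cnj (B i l0)) = 0"
proof (cases "m = l0")
  case True
  then show ?thesis using eq[OF m] by simp
next
  case False
  define x where "x = m - l0"
  have x: "x \<noteq> 0" "cmod x < e" using False m by (auto simp: x_def dist_norm norm_minus_commute)
  have e: "e > 0" using x(2) norm_ge_zero[of x] by linarith
  \<comment> \<open>For z on the circle of radius \<rho> the argument of B is l0 + z again, so F
    \<rho> z is the given sum at l0 + z.\<close>
  define F where "F = (\<lambda>\<rho> z. \<Sum>i\<in>I. A i (l0 + z) * cnj (B i (l0 + cnj (of_real (\<rho>\<^sup>2) / z))))"
  have F0: "F \<rho> x = 0" if \<rho>: "0 < \<rho>" "\<rho> < cmod x" "\<rho>\<^sup>2 < e * cmod x" for \<rho>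
  proof (rule analytic_continuation[of "F \<rho>" "{z. \<rho>\<^sup>2 / e < cmod (z - 0) \<and> cmod (z - 0) < e}" "sphere 0 \<rho>" "of_real \<rho>" x])
    \<comment> \<open>In this annulus both z and \<rho>^2 / z have modulus below e, so the arguments
      of A and B stay in the ball.\<close>
    let ?R = "{z::complex. \<rho>\<^sup>2 / e < cmod (z - 0) \<and> cmod (z - 0) < e}"
    have \<rho>e: "\<rho> < e" using \<rho>(2) x(2) by linarith
    have \<rho>2: "\<rho>\<^sup>2 / e < \<rho>" using \<rho>(1) \<rho>e e by (simp add: power2_eq_square field_simps)
    show "open ?R" unfolding Collect_conj_eq by (intro open_Int open_Collect_less continuous_intros)
    show "connected ?R" by (rule connected_annulus) simp
    show "sphere 0 \<rho> \<subseteq> ?R" using \<rho>e \<rho>2 by auto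
    show "of_real \<rho> \<in> ?R" using \<rho>e \<rho>2 \<rho>(1) by simp
    show "x \<in> ?R" using x(2) \<rho>(3) e by (simp add: field_simps)
    show "complex_of_real \<rho> islimpt sphere 0 \<rho>"
    proof (rule connected_imp_perfect[OF connected_sphere])
      have "of_real \<rho> \<in> sphere (0::complex) \<rho>" "- of_real \<rho> \<in> sphere (0::complex) \<rho>"
        "- of_real \<rho> \<noteq> (of_real \<rho> :: complex)" using \<rho>(1) by auto
      then show "sphere (0::complex) \<rho> \<noteq> {y}" for y by (metis singletonD)
    qed (use \<rho>(1) in auto)
    have inner: "cmod (of_real (\<rho>\<^sup>2) / z) < e" "z \<noteq> 0" if "z \<in> ?R" for z
    proof -
      have z: "\<rho>\<^sup>2 / e < cmod z" using that by simp
      have "0 \<le> \<rho>\<^sup>2 / e" using e by simp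
      then show z0: "z \<noteq> 0" using z by auto
      show "cmod (of_real (\<rho>\<^sup>2) / z) < e" using z e z0 by (simp add: norm_divide norm_power field_simps)
    qed
    show "F \<rho> holomorphic_on ?R"
      unfolding F_def
    proof (intro holomorphic_on_sum holomorphic_on_mult)
      fix i assume i: "i \<in> I"
      show "(\<lambda>z. A i (l0 + z)) holomorphic_on ?R"
        by (rule holomorphic_on_compose_gen[OF _ A[OF i], unfolded o_def])
           (auto intro!: holomorphic_intros simp: dist_norm)
      have 1: "(\<lambda>y. B i (l0 + y)) holomorphic_on ball 0 e"
        by (rule holomorphic_on_compose_gen[OF _ B[OF i], unfolded o_def])
           (auto intro!: holomorphic_intros simp: dist_norm)
      have "cnj ` ball 0 e = ball 0 e"
      proof (intro equalityI subsetI)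
        fix y :: complex assume "y \<in> ball 0 e"
        then show "y \<in> cnj ` ball 0 e" by (intro image_eqI[of _ _ "cnj y"]) auto
      qed auto
      then have "(cnj \<circ> (\<lambda>y. B i (l0 + y)) \<circ> cnj) holomorphic_on ball 0 e"
        using 1 by (intro holomorphic_on_compose_cnj_cnj) auto
      then have 2: "(\<lambda>y. cnj (B i (l0 + cnj y))) holomorphic_on ball 0 e" by (simp add: o_def)
      show "(\<lambda>z. cnj (B i (l0 + cnj (of_real (\<rho>\<^sup>2) / z)))) holomorphic_on ?R"
        by (rule holomorphic_on_compose_gen[OF _ 2, unfolded o_def])
           (use inner in \<open>auto intro!: holomorphic_intros\<close>)
    qed
    fix z :: complex assume z: "z \<in> sphere 0 \<rho>"
    have "of_real (\<rho>\<^sup>2) / z = cnj z"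
    proof -
      have "of_real (\<rho>\<^sup>2) = z * cnj z" using z by (simp add: complex_norm_square[symmetric])
      moreover have "z \<noteq> 0" using z \<rho>(1) by auto
      ultimately show ?thesis by simp
    qed
    then have "cnj (of_real (\<rho>\<^sup>2) / z) = z" by simp
    then show "F \<rho> z = 0"
      unfolding F_def using eq[of "l0 + z"] z \<rho>e by (simp add: dist_norm)
  qed
  \<comment> \<open>The radii c / (k + 1) stay below both |x| and e; hence their squares are below e
    |x|, and x lies in the annulus for every k.\<close>
  define c where "c = min (cmod x) e / 2"
  have c: "c > 0" "c < cmod x" "c < e" using x e by (auto simp: c_def min_def)
  define r where "r = (\<lambda>k. c / real (Suc k))"
  have r_le: "r k \<le> c" "0 < r k" for k using c(1) by (auto simp: r_def field_simps)
  have Fr: "F (r k) x = 0" for k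
  proof (rule F0)
    show "0 < r k" "r k < cmod x" using r_le[of k] c by auto
    have "(r k)\<^sup>2 = r k * r k" by (simp add: power2_eq_square)
    also have "\<dots> < e * cmod x" using r_le[of k] c by (intro mult_strict_mono) auto
    finally show "(r k)\<^sup>2 < e * cmod x" .
  qed
  have r0: "r \<longlonglongrightarrow> 0"
    unfolding r_def using tendsto_mult[OF tendsto_const[of c] LIMSEQ_Suc[OF lim_1_over_n]] by simp
  have "(\<lambda>k. F (r k) x) \<longlonglongrightarrow> (\<Sum>i\<in>I. A i (l0 + x) * cnj (B i (l0 + cnj (of_real (0\<^sup>2) / x))))"
    unfolding F_def
  proof (intro tendsto_intros)
    fix i assume i: "i \<in> I"
    have "continuous_on (ball l0 e) (B i)" by (rule holomorphic_on_imp_continuous_on[OF B[OF i]])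
    then have "isCont (B i) l0" using e by (simp add: continuous_on_eq_continuous_at)
    moreover have "(\<lambda>k. l0 + cnj (of_real ((r k)\<^sup>2) / x)) \<longlonglongrightarrow> l0 + cnj (of_real (0\<^sup>2) / x)"
      by (intro tendsto_intros r0) (rule x(1))
    ultimately show "(\<lambda>k. B i (l0 + cnj (of_real ((r k)\<^sup>2) / x))) \<longlonglongrightarrow> B i (l0 + cnj (of_real (0\<^sup>2) / x))"
      by (intro isCont_tendsto_compose[of _ "B i"]) auto
  qed
  moreover have "(\<lambda>k. F (r k) x) \<longlonglongrightarrow> 0" by (simp add: Fr)
  ultimately have "(\<Sum>i\<in>I. A i (l0 + x) * cnj (B i (l0 + cnj (of_real (0\<^sup>2) / x)))) = 0"
    by (rule LIMSEQ_unique)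
  then show ?thesis by (simp add: x_def)
qed

lemma Rep_bergman_sum:
  "Rep_bergman (\<Sum>i\<in>I. f i) z = (\<Sum>i\<in>I. Rep_bergman (f i) z)"
  by (induction I rule: infinite_finite_induct) (auto simp: Rep_bergman_simps)

text \<open>The Lagrange polynomial is bounded on the disk and so belongs to the Bergman
  space.\<close>

lemma bergman_interpolation:
  assumes F: "finite F" and w0: "w0 \<in> F" and sub: "F \<subseteq> unit_disk"
  obtains h where "Rep_bergman h w0 = 1" "\<And>w. w \<in> F \<Longrightarrow> w \<noteq> w0 \<Longrightarrow> Rep_bergman h w = 0"
proof -
  define p where "p = (\<lambda>z. \<Prod>w\<in>F - {w0}. (z - w) / (w0 - w))"
  have c: "continuous_on (cball 0 1) p" unfolding p_def by (intro continuous_intros) auto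
  obtain B where "\<forall>x\<in>p ` cball 0 1. norm x \<le> B"
    using compact_imp_bounded[OF compact_continuous_image[OF c compact_cball]] unfolding bounded_iff by blast
  then have B: "\<And>z. z \<in> unit_disk \<Longrightarrow> cmod (p z) \<le> B" by auto
  have hol: "p holomorphic_on unit_disk" unfolding p_def by (intro holomorphic_intros) auto
  have rep: "Rep_bergman (bergman_of p) z = p z" if "z \<in> unit_disk" for z
    by (rule Rep_bergman_of[OF hol B that])
  show ?thesis
  proof (rule that[of "bergman_of p"])
    have "p w0 = 1" unfolding p_def by (rule prod.neutral) auto
    then show "Rep_bergman (bergman_of p) w0 = 1" using rep w0 sub by auto
    fix w assume w: "w \<in> F" "w \<noteq> w0"
    have "p w = 0" unfolding p_def by (rule prod_zero) (use F w in auto)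
    then show "Rep_bergman (bergman_of p) w = 0" using rep w sub by auto
  qed
qed

context blaschke_product
begin

lemma is_blaschke: "is_blaschke_product n \<phi>"
  unfolding is_blaschke_product_def using a \<phi> by (intro exI[of _ a]) simp

abbreviation M :: "bergman \<Rightarrow> bergman" where "M \<equiv> mult_op \<phi>"

lemma Rep_M: "Rep_bergman (M h) z = \<phi> z * Rep_bergman h z"
  by (simp add: Rep_mult_op[OF is_blaschke])

lemma Rep_M_power: "Rep_bergman ((M ^^ k) h) z = \<phi> z ^ k * Rep_bergman h z"
  by (induction k) (auto simp: Rep_M)

lemma bounded_clinear_M: "bounded_clinear M"
proof (rule bounded_clinearI[of _ 1])
  show "M (f + g) = M f + M g" for f g
    by (rule bergman_eqI) (simp add: Rep_M Rep_bergman_simps algebra_simps)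
  show "M (cscale c f) = cscale c (M f)" for c f
    by (rule bergman_eqI) (simp add: Rep_M Rep_bergman_simps)
  fix f
  have "(cmod (Rep_bergman (M f) z))\<^sup>2 \<le> (cmod (Rep_bergman f z))\<^sup>2" for z
  proof (cases "z \<in> unit_disk")
    case True
    then have "cmod (\<phi> z) \<le> 1" using \<phi>_lt[of z] by simp
    then have "cmod (\<phi> z) * cmod (Rep_bergman f z) \<le> cmod (Rep_bergman f z)"
      by (intro mult_left_le_one_le) auto
    then show ?thesis unfolding Rep_M norm_mult by (intro power_mono) auto
  qed (simp add: Rep_bergman_outside)
  then have "(norm (M f))\<^sup>2 \<le> (norm f)\<^sup>2"
    unfolding norm_bergman_square by (intro integral_mono Rep_bergman_square_integrable)
  then have "norm (M f) \<le> norm f" by (rule power2_le_imp_le) simp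
  then show "norm (M f) \<le> 1 * norm f" by simp
qed

lemma A_phi_iff:
  "T \<in> A_phi \<phi> \<longleftrightarrow> bounded_clinear T \<and> T \<circ> M = M \<circ> T \<and> T \<circ> cadjoint M = cadjoint M \<circ> T"
  by (auto simp: A_phi_def commutant_def)

lemma A_phi_adjoint:
  assumes "T \<in> A_phi \<phi>"
  obtains S where "bounded_clinear S" "\<And>f g. cinner (T f) g = cinner f (S g)" "S \<circ> M = M \<circ> S"
  using adjoint_exists[of T] commutant_cadjoint_iff[OF bounded_clinear_M, of T] assms
  unfolding A_phi_iff by metis

lemma A_phiI:
  assumes "bounded_clinear T" "T \<circ> M = M \<circ> T" "\<And>f g. cinner (T f) g = cinner f (S g)" "S \<circ> M = M \<circ> S"
  shows "T \<in> A_phi \<phi>"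
  using commutant_cadjoint_iff[OF bounded_clinear_M assms(1,3)] assms unfolding A_phi_iff by blast

lemma commute_power:
  assumes "S \<circ> M = M \<circ> S"
  shows "S ((M ^^ k) f) = (M ^^ k) (S f)"
proof (induction k)
  case (Suc k)
  have "S (M h) = M (S h)" for h using assms by (metis comp_apply)
  then show ?case by (simp add: Suc)
qed simp

text \<open>On a fibre \<phi> is constant, so inserting \<open>M ^^ i\<close> and
  \<open>M ^^ j\<close> multiplies the fibre sum by l^i cnj l^j. Commutation moves the powers past T
  and S, the adjoint relation makes every moment vanish, and continuity in l makes the conclusion
  pointwise.\<close>

lemma fibre_sum_zero:
  assumes T: "T \<circ> M = M \<circ> T" and S: "S \<circ> M = M \<circ> S"
    and adj: "\<And>f g. cinner (T f) g = cinner f (S g)"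
    and l0: "l0 \<in> regular_values"
  shows "fibre_sum (\<lambda>z. Rep_bergman (T f) z * cnj (Rep_bergman g z)
      - Rep_bergman f z * cnj (Rep_bergman (S g) z)) l0 = 0"
proof -
  define H where "H = (\<lambda>z. Rep_bergman (T f) z * cnj (Rep_bergman g z)
      - Rep_bergman f z * cnj (Rep_bergman (S g) z))"
  have [measurable]: "cnj \<in> borel_measurable borel"
    by (intro borel_measurable_continuous_onI continuous_intros)
  have [measurable]: "H \<in> borel_measurable borel" unfolding H_def by measurable
  have \<phi>m: "(\<lambda>z. indicator unit_disk z *\<^sub>R \<phi> z) \<in> borel_measurable borel"
    by (intro borel_measurable_continuous_on_indicator holomorphic_on_imp_continuous_on holomorphic_on_\<phi>) auto
  have mom: "has_bochner_integral lborel (\<lambda>l. indicator regular_values l *\<^sub>R (l ^ i * cnj l ^ j * fibre_sum H l)) 0" for i j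
  proof -
    define G where "G = (\<lambda>z. Rep_bergman ((M ^^ i) (T f)) z * cnj (Rep_bergman ((M ^^ j) g) z)
        - Rep_bergman ((M ^^ i) f) z * cnj (Rep_bergman ((M ^^ j) (S g)) z))"
    have [measurable]: "G \<in> borel_measurable borel" unfolding G_def by measurable
    have GH: "G z = \<phi> z ^ i * cnj (\<phi> z) ^ j * H z" for z
      by (simp add: G_def H_def Rep_M_power algebra_simps)
    have I: "integrable area G"
      unfolding G_def by (intro Bochner_Integration.integrable_diff bergman_inner_integrable)
    have "cinner ((M ^^ i) (T f)) ((M ^^ j) g) = cinner ((M ^^ i) f) ((M ^^ j) (S g))"
      by (simp add: commute_power[OF T, symmetric] commute_power[OF S, symmetric] adj)
    then have "integral\<^sup>L area G = 0"
      unfolding G_def by (subst Bochner_Integration.integral_diff) (simp_all add: bergman_inner_integrable cinner_def)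
    then have "(LINT z:unit_disk|lborel. G z) = 0"
      using measure_unit_disk_pos by (subst (asm) integral_area) auto
    moreover have "set_integrable lborel unit_disk G" using I by (subst (asm) integrable_area) auto
    ultimately have "has_bochner_integral lborel (\<lambda>z. indicator unit_disk z *\<^sub>R G z) 0"
      by (simp add: has_bochner_integral_iff set_integrable_def set_lebesgue_integral_def)
    then have "has_bochner_integral lborel (\<lambda>l. indicator regular_values l *\<^sub>R fibre_sum G l) 0"
      by (rule fibre_integral[rotated]) measurable
    moreover have "fibre_sum G l = l ^ i * cnj l ^ j * fibre_sum H l" for l
      unfolding fibre_sum_def GH sum_distrib_left by (rule sum.cong) (auto simp: fibre_def)
    ultimately show ?thesis by simp
  qed
  have Hc: "continuous_on unit_disk H"
    unfolding H_def
    by (intro continuous_intros holomorphic_on_imp_continuous_on[OF Rep_bergman_holomorphic])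
  have cont: "continuous_on regular_values (fibre_sum H)"
    unfolding continuous_on_eq_continuous_at[OF open_regular_values]
  proof
    fix l assume l: "l \<in> regular_values"
    obtain e \<beta> where lb: "local_branches l e \<beta>" using local_branches_exist[OF l] by blast
    note b = local_branchesD[OF lb]
    have reg: "\<beta> w m \<in> regular_points" if "w \<in> fibre l" "m \<in> ball l e" for w m
      using bij_betw_apply[OF b(6)[OF that(2)] that(1)] b(2) that(2) fibre_regular by blast
    have sum_eq: "fibre_sum H m = (\<Sum>w\<in>fibre l. (1 / (cmod (deriv \<phi> (\<beta> w m)))\<^sup>2) *\<^sub>R H (\<beta> w m))"
      if "m \<in> ball l e" for m
      unfolding fibre_sum_def by (rule sum.reindex_bij_betw[OF b(6)[OF that], symmetric])
    have "continuous_on (ball l e) (\<lambda>m. \<Sum>w\<in>fibre l. (1 / (cmod (deriv \<phi> (\<beta> w m)))\<^sup>2) *\<^sub>R H (\<beta> w m))"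
    proof (intro continuous_on_sum continuous_on_scaleR continuous_on_divide continuous_on_const
        continuous_on_power continuous_on_norm ballI)
      fix w assume w: "w \<in> fibre l"
      have \<beta>c: "continuous_on (ball l e) (\<beta> w)" by (rule holomorphic_on_imp_continuous_on[OF b(3)[OF w]])
      have sub: "\<beta> w ` ball l e \<subseteq> unit_disk"
        using reg[OF w] unfolding regular_points_def by blast
      show "continuous_on (ball l e) (\<lambda>m. H (\<beta> w m))"
        by (rule continuous_on_compose2[OF Hc \<beta>c sub])
      show "continuous_on (ball l e) (\<lambda>m. deriv \<phi> (\<beta> w m))"
        by (rule continuous_on_compose2[OF _ \<beta>c sub])
           (intro holomorphic_on_imp_continuous_on holomorphic_deriv holomorphic_on_\<phi> open_ball)
      fix m assume "m \<in> ball l e"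
      then show "(cmod (deriv \<phi> (\<beta> w m)))\<^sup>2 \<noteq> 0" using deriv_nonzero[OF reg[OF w]] by simp
    qed
    from continuous_on_eq[OF this sum_eq[symmetric]]
    have "continuous_on (ball l e) (fibre_sum H)" .
    then show "isCont (fibre_sum H) l" using b(1) by (simp add: continuous_on_eq_continuous_at)
  qed
  have "fibre_sum H l0 = 0"
  proof (rule continuous_zero_if_moments_zero[OF open_regular_values _ cont _ mom l0])
    show "regular_values \<subseteq> cball 0 1" by (auto simp: regular_values_def)
    show "integrable lborel (\<lambda>l. indicator regular_values l *\<^sub>R fibre_sum H l)"
      using mom[of 0 0] by (simp add: has_bochner_integral_iff)
  qed
  then show ?thesis by (simp only: H_def)
qed

lemma branch_weight:
  assumes "\<beta> holomorphic_on ball l e" "\<And>m. m \<in> ball l e \<Longrightarrow> \<phi> (\<beta> m) = m"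
    "\<And>m. m \<in> ball l e \<Longrightarrow> \<beta> m \<in> unit_disk" "m \<in> ball l e"
  shows "deriv \<beta> m = 1 / deriv \<phi> (\<beta> m)"
  using branch_deriv[OF open_ball assms(1-3) assms(4)]
  by (metis mult.commute nonzero_eq_divide_eq mult_zero_left zero_neq_one)

text \<open>The weight 1/|\<phi>'|^2 splits evenly between the two factors of the fibre identity,
  which leaves the holomorphic functions \<open>hat f w\<close>. Polarization freezes the conjugated
  factors at the centre l; a g whose \<open>hat\<close> there is 1 at w and 0 at the other points
  isolates T f on the branch of w. The coefficients then come from S g and do not involve f or
  m.\<close>

lemma locally_constant_matrix:
  assumes T: "T \<in> A_phi \<phi>" and l: "l \<in> regular_values"
    and lb: "local_branches l e \<beta>"
  shows "\<exists>t. \<forall>f. \<forall>w\<in>fibre l. \<forall>m\<in>ball l e.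
    Rep_bergman (T f) (\<beta> w m) / deriv \<phi> (\<beta> w m)
      = (\<Sum>v\<in>fibre l. t w v * (Rep_bergman f (\<beta> v m) / deriv \<phi> (\<beta> v m)))"
proof -
  note b = local_branchesD[OF lb]
  obtain S where S: "bounded_clinear S" "\<And>f g. cinner (T f) g = cinner f (S g)" "S \<circ> M = M \<circ> S"
    using A_phi_adjoint[OF T] by metis
  have TM: "T \<circ> M = M \<circ> T" using T by (simp add: A_phi_iff)
  have fin: "finite (fibre l)" by (rule fibre_finite_card[OF regular_value_lt[OF l]])
  have ll: "l \<in> ball l e" using b(1) by simp
  note in_disk = b(7)
  have reg: "deriv \<phi> (\<beta> w m) \<noteq> 0" if "w \<in> fibre l" "m \<in> ball l e" for w m
  proof (rule deriv_nonzero)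
    have "m \<in> regular_values" using that(2) b(2) by blast
    then show "\<beta> w m \<in> regular_points"
      using in_disk[OF that] b(5)[OF that] by (simp only: regular_points_iff)
  qed
  define hat where "hat = (\<lambda>f w m. Rep_bergman f (\<beta> w m) / deriv \<phi> (\<beta> w m))"
  have hat_hol: "hat f w holomorphic_on ball l e" if w: "w \<in> fibre l" for f w
  proof -
    have sub: "\<beta> w ` ball l e \<subseteq> unit_disk" using in_disk[OF w] by blast
    show ?thesis
      unfolding hat_def
    proof (rule holomorphic_on_divide)
      show "(\<lambda>m. Rep_bergman f (\<beta> w m)) holomorphic_on ball l e"
        by (rule holomorphic_on_compose_gen[OF b(3)[OF w] Rep_bergman_holomorphic sub, unfolded o_def])
      show "(\<lambda>m. deriv \<phi> (\<beta> w m)) holomorphic_on ball l e"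
        by (rule holomorphic_on_compose_gen[OF b(3)[OF w] holomorphic_deriv[OF holomorphic_on_\<phi> open_ball] sub, unfolded o_def])
    qed (use reg[OF w] in auto)
  qed
  have pol: "(\<Sum>w\<in>fibre l. hat (T f) w m * cnj (hat g w l)) = (\<Sum>w\<in>fibre l. hat f w m * cnj (hat (S g) w l))"
    if m: "m \<in> ball l e" for f g m
  proof -
    \<comment> \<open>Two copies of the fibre merge both sides into one vanishing sum; the sign of
      the second side is put into A.\<close>
    define I where "I = Pair True ` fibre l \<union> Pair False ` fibre l"
    define A where "A = (\<lambda>i m. if fst i then hat (T f) (snd i) m else - hat f (snd i) m)"
    define B where "B = (\<lambda>i m. if fst i then hat g (snd i) m else hat (S g) (snd i) m)"
    have sumI: "(\<Sum>i\<in>I. F i) = (\<Sum>w\<in>fibre l. F (True, w)) + (\<Sum>w\<in>fibre l. F (False, w))" for F :: "_ \<Rightarrow> complex"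
      unfolding I_def by (subst sum.union_disjoint) (auto simp: fin sum.reindex inj_on_def)
    have "(\<Sum>i\<in>I. A i m * cnj (B i l)) = 0"
    proof (rule holomorphic_polarization[OF _ _ _ _ m])
      show "finite I" by (simp add: I_def fin)
      show "A i holomorphic_on ball l e" if "i \<in> I" for i
        using that hat_hol unfolding I_def A_def by (cases "fst i") (auto intro!: holomorphic_intros)
      show "B i holomorphic_on ball l e" if "i \<in> I" for i
        using that hat_hol unfolding I_def B_def by (cases "fst i") auto
      fix m assume m: "m \<in> ball l e"
      then have "m \<in> regular_values" using b(2) by blast
      then have "fibre_sum (\<lambda>z. Rep_bergman (T f) z * cnj (Rep_bergman g z)
          - Rep_bergman f z * cnj (Rep_bergman (S g) z)) m = 0" (is "fibre_sum ?H m = 0")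
        by (rule fibre_sum_zero[OF TM S(3,2)])
      also have "fibre_sum ?H m = (\<Sum>w\<in>fibre l. (1 / (cmod (deriv \<phi> (\<beta> w m)))\<^sup>2) *\<^sub>R ?H (\<beta> w m))"
        unfolding fibre_sum_def by (rule sum.reindex_bij_betw[OF b(6)[OF m], symmetric])
      also have "\<dots> = (\<Sum>w\<in>fibre l. hat (T f) w m * cnj (hat g w m) - hat f w m * cnj (hat (S g) w m))"
      proof (rule sum.cong[OF refl])
        fix w assume w: "w \<in> fibre l"
        have d: "of_real ((cmod (deriv \<phi> (\<beta> w m)))\<^sup>2) = deriv \<phi> (\<beta> w m) * cnj (deriv \<phi> (\<beta> w m))"
          by (rule complex_norm_square)
        show "(1 / (cmod (deriv \<phi> (\<beta> w m)))\<^sup>2) *\<^sub>R ?H (\<beta> w m)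
           = hat (T f) w m * cnj (hat g w m) - hat f w m * cnj (hat (S g) w m)"
          unfolding hat_def scaleR_conv_of_real of_real_divide d
          by (simp add: diff_divide_distrib)
      qed
      finally show "(\<Sum>i\<in>I. A i m * cnj (B i m)) = 0"
        unfolding sumI by (simp add: A_def B_def sum_subtractf sum_negf)
    qed
    then show ?thesis unfolding sumI by (simp add: A_def B_def sum_negf)
  qed
  have "\<exists>g. hat g w l = 1 \<and> (\<forall>v\<in>fibre l. v \<noteq> w \<longrightarrow> hat g v l = 0)" if w: "w \<in> fibre l" for w
  proof -
    have "fibre l \<subseteq> unit_disk" by (auto simp: fibre_def)
    then obtain h where h: "Rep_bergman h w = 1" "\<And>v. v \<in> fibre l \<Longrightarrow> v \<noteq> w \<Longrightarrow> Rep_bergman h v = 0"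
      using bergman_interpolation[OF fin w] by metis
    have dw: "deriv \<phi> w \<noteq> 0" using reg[OF w ll] b(4)[OF w] by simp
    show ?thesis
      by (rule exI[of _ "cscale (deriv \<phi> w) h"]) (use dw w h in \<open>simp add: hat_def b(4) Rep_cscale\<close>)
  qed
  then obtain g where g: "\<And>w. w \<in> fibre l \<Longrightarrow> hat (g w) w l = 1"
    "\<And>w v. w \<in> fibre l \<Longrightarrow> v \<in> fibre l \<Longrightarrow> v \<noteq> w \<Longrightarrow> hat (g w) v l = 0" by metis
  have "hat (T f) w m = (\<Sum>v\<in>fibre l. cnj (hat (S (g w)) v l) * hat f v m)"
    if w: "w \<in> fibre l" and m: "m \<in> ball l e" for f w m
  proof -
    have "(\<Sum>v\<in>fibre l. hat (T f) v m * cnj (hat (g w) v l)) = (\<Sum>v\<in>fibre l. if v = w then hat (T f) w m else 0)"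
      by (rule sum.cong) (use g w in auto)
    also have "\<dots> = hat (T f) w m" using w fin by simp
    finally show ?thesis using pol[OF m, of f "g w"] by (simp add: mult.commute)
  qed
  then show ?thesis
    unfolding hat_def by (intro exI[of _ "\<lambda>w v. cnj (hat (S (g w)) v l)"]) (simp add: hat_def)
qed

end

section \<open>The unbranched cover\<close>

text \<open>Riemann's theorem on removable singularities at one point at a time; the limits at the
  points of F become the values of the extension.\<close>

lemma holomorphic_extension_finite:
  assumes f: "f holomorphic_on S - F" and S: "open S" and F: "finite F"
    and bnd: "\<And>p. p \<in> F \<Longrightarrow> p \<in> S \<Longrightarrow> \<exists>B. \<forall>\<^sub>F z in at p. cmod (f z) \<le> B"
  obtains g where "g holomorphic_on S" "\<And>z. z \<in> S - F \<Longrightarrow> g z = f z"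
proof -
  have "\<exists>l. (f \<longlongrightarrow> l) (at p)" if p: "p \<in> F" "p \<in> S" for p
  proof -
    have "open (S - (F - {p}))" using S F by (intro open_Diff finite_imp_closed) auto
    moreover have "p \<in> S - (F - {p})" using p by simp
    ultimately obtain r where r: "r > 0" "ball p r \<subseteq> S - (F - {p})" using open_contains_ball by blast
    have hol: "f holomorphic_on ball p r - {p}"
      by (rule holomorphic_on_subset[OF f]) (use r(2) in blast)
    obtain g where g: "g holomorphic_on ball p r" "\<forall>z\<in>ball p r - {p}. g z = f z"
      using holomorphic_on_extend_bounded[OF hol] bnd[OF p] r(1) by auto
    have "isCont g p"
      using holomorphic_on_imp_continuous_on[OF g(1)] r(1) by (simp add: continuous_on_eq_continuous_at)
    then have "(g \<longlongrightarrow> g p) (at p)" by (simp add: isCont_def)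
    then have "(f \<longlongrightarrow> g p) (at p)"
      by (rule Lim_transform_within_open[OF _ open_ball]) (use r(1) g(2) in auto)
    then show ?thesis by blast
  qed
  then obtain l where l: "\<And>p. p \<in> F \<Longrightarrow> p \<in> S \<Longrightarrow> (f \<longlongrightarrow> l p) (at p)" by metis
  define g where "g = (\<lambda>z. if z \<in> F then l z else f z)"
  have "g holomorphic_on S"
  proof (rule no_isolated_singularity'[of "F \<inter> S"])
    have "g holomorphic_on S - F"
      by (subst holomorphic_cong[OF refl, of _ _ f]) (use f in \<open>auto simp: g_def\<close>)
    then show "g holomorphic_on S - F \<inter> S" by (simp add: Diff_Int_distrib2 Diff_Int)
    fix p assume p: "p \<in> F \<inter> S"
    have "open (S - (F - {p}))" using S F by (intro open_Diff finite_imp_closed) auto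
    from Lim_transform_within_open[OF l this, of p g] p
    have "(g \<longlongrightarrow> l p) (at p)" by (auto simp: g_def)
    then show "(g \<longlongrightarrow> g p) (at p within S)" using p by (auto simp: g_def intro: tendsto_within_subset)
  qed (use S F in auto)
  then show ?thesis using that by (auto simp: g_def)
qed

section \<open>The cover and the coefficients of an operator\<close>

context blaschke_product
begin

definition cover :: "(complex \<times> complex) set"
  where "cover = unbranched_cover \<phi>"

lemma cover_iff: "(w, z) \<in> cover \<longleftrightarrow> z \<in> regular_points \<and> w \<in> fibre (\<phi> z)"
  by (auto simp: cover_def unbranched_cover_def regular_points_def fibre_def)

lemma regular_pointsD:
  assumes "z \<in> regular_points"
  shows "z \<in> unit_disk" "\<phi> z \<in> regular_values" "z \<in> fibre (\<phi> z)" "deriv \<phi> z \<noteq> 0"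
    "finite (fibre (\<phi> z))" "cmod (\<phi> z) < 1"
proof -
  show 1: "z \<in> unit_disk" "\<phi> z \<in> regular_values" using assms by (simp_all only: regular_points_iff)
  then show "z \<in> fibre (\<phi> z)" by (simp add: fibre_def)
  show "deriv \<phi> z \<noteq> 0" by (rule deriv_nonzero[OF assms])
  show "cmod (\<phi> z) < 1" by (rule regular_value_lt[OF 1(2)])
  then show "finite (fibre (\<phi> z))" by (rule fibre_finite_card)
qed

lemma cover_swap: "(w, z) \<in> cover \<longleftrightarrow> (z, w) \<in> cover"
proof -
  have "(z, w) \<in> cover" if "(w, z) \<in> cover" for w z
  proof -
    have z: "z \<in> regular_points" "w \<in> fibre (\<phi> z)" using that by (simp_all add: cover_iff)
    then have "w \<in> regular_points" using fibre_regular regular_pointsD(2) by blast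
    moreover have "z \<in> fibre (\<phi> w)" using z regular_pointsD(3)[OF z(1)] by (simp add: fibre_def)
    ultimately show ?thesis by (simp add: cover_iff)
  qed
  then show ?thesis by blast
qed

text \<open>The identity theorem on a nonempty open set; the boundary path supplies a regular point.
  Operators given by a formula off the branch points are compared in this way.\<close>

lemma bergman_eqI_regular:
  assumes "\<And>z. z \<in> regular_points \<Longrightarrow> Rep_bergman f z = Rep_bergman g z"
  shows "f = g"
proof (rule bergman_eqI)
  fix z assume z: "z \<in> unit_disk"
  obtain \<gamma> :: "real \<Rightarrow> complex" where "\<And>t. \<gamma> t \<in> regular_points" using boundary_cycle by metis
  then obtain x where x: "x \<in> regular_points" by blast
  define d where "d = (\<lambda>z. Rep_bergman f z - Rep_bergman g z)"
  have "d z = 0"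
  proof (rule analytic_continuation[of d unit_disk regular_points x])
    show "d holomorphic_on unit_disk"
      unfolding d_def by (intro holomorphic_intros Rep_bergman_holomorphic)
    show "regular_points \<subseteq> unit_disk" using regular_pointsD(1) by blast
    show "x islimpt regular_points"
      using x open_regular_points by (simp add: interior_limit_point interior_open)
    show "x \<in> unit_disk" using regular_pointsD(1)[OF x] .
  qed (use z assms in \<open>auto simp: d_def\<close>)
  then show "Rep_bergman f z = Rep_bergman g z" by (simp add: d_def)
qed

text \<open>The pair (w, z) holds the weight of w in the formula for T f at z. For T in the algebra
  the choice is harmless: the local matrices give existence, interpolation gives uniqueness on the
  fibre.\<close>

definition coef :: "(bergman \<Rightarrow> bergman) \<Rightarrow> complex \<times> complex \<Rightarrow> complex"
  where "coef T p = (SOME c. \<forall>f. Rep_bergman (T f) (snd p) / deriv \<phi> (snd p)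
     = (\<Sum>v\<in>fibre (\<phi> (snd p)). c v * (Rep_bergman f v / deriv \<phi> v))) (fst p)"

lemma fibre_functional_unique:
  assumes z: "z \<in> regular_points" and w: "w \<in> fibre (\<phi> z)"
    and eq: "\<And>f. (\<Sum>v\<in>fibre (\<phi> z). c v * (Rep_bergman f v / deriv \<phi> v))
      = (\<Sum>v\<in>fibre (\<phi> z). d v * (Rep_bergman f v / deriv \<phi> v))"
  shows "c w = d w"
proof -
  have "fibre (\<phi> z) \<subseteq> unit_disk" by (auto simp: fibre_def)
  then obtain h where h: "Rep_bergman h w = 1" "\<And>v. v \<in> fibre (\<phi> z) \<Longrightarrow> v \<noteq> w \<Longrightarrow> Rep_bergman h v = 0"
    using bergman_interpolation[OF regular_pointsD(5)[OF z] w] by metis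
  have "(\<Sum>v\<in>fibre (\<phi> z). c v * (Rep_bergman h v / deriv \<phi> v)) = c w / deriv \<phi> w" for c
  proof -
    have "(\<Sum>v\<in>fibre (\<phi> z). c v * (Rep_bergman h v / deriv \<phi> v))
       = (\<Sum>v\<in>fibre (\<phi> z). if v = w then c w / deriv \<phi> w else 0)"
      by (rule sum.cong) (use h in auto)
    then show ?thesis using w regular_pointsD(5)[OF z] by simp
  qed
  then have "c w / deriv \<phi> w = d w / deriv \<phi> w" using eq[of h] by simp
  moreover have "deriv \<phi> w \<noteq> 0"
    by (rule deriv_nonzero[OF fibre_regular[OF regular_pointsD(2)[OF z] w]])
  ultimately show ?thesis by simp
qed

lemma coef_repr:
  assumes T: "T \<in> A_phi \<phi>" and z: "z \<in> regular_points"
  shows "Rep_bergman (T f) z / deriv \<phi> z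
     = (\<Sum>v\<in>fibre (\<phi> z). coef T (v, z) * (Rep_bergman f v / deriv \<phi> v))"
proof -
  let ?P = "\<lambda>c. \<forall>f. Rep_bergman (T f) z / deriv \<phi> z
     = (\<Sum>v\<in>fibre (\<phi> z). c v * (Rep_bergman f v / deriv \<phi> v))"
  note zz = regular_pointsD[OF z]
  obtain e \<beta> where lb: "local_branches (\<phi> z) e \<beta>"
    using local_branches_exist[OF zz(2)] by blast
  note b = local_branchesD[OF lb]
  obtain t where t: "\<And>f w m. w \<in> fibre (\<phi> z) \<Longrightarrow> m \<in> ball (\<phi> z) e \<Longrightarrow>
    Rep_bergman (T f) (\<beta> w m) / deriv \<phi> (\<beta> w m)
      = (\<Sum>v\<in>fibre (\<phi> z). t w v * (Rep_bergman f (\<beta> v m) / deriv \<phi> (\<beta> v m)))"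
    using locally_constant_matrix[OF T zz(2) lb] by blast
  have "?P (t z)"
    using t[OF zz(3), of "\<phi> z"] b(1) by (simp add: b(4) zz(3) cong: sum.cong)
  then have "?P (SOME c. ?P c)" by (rule someI[of ?P])
  then show ?thesis unfolding coef_def fst_conv snd_conv by (rule spec)
qed

lemma coef_unique:
  assumes T: "T \<in> A_phi \<phi>" and wz: "(w, z) \<in> cover"
    and c: "\<And>f. Rep_bergman (T f) z / deriv \<phi> z
     = (\<Sum>v\<in>fibre (\<phi> z). c v * (Rep_bergman f v / deriv \<phi> v))"
  shows "coef T (w, z) = c w"
proof -
  have z: "z \<in> regular_points" "w \<in> fibre (\<phi> z)" using wz by (simp_all add: cover_iff)
  show ?thesis
    by (rule fibre_functional_unique[OF z, of "\<lambda>v. coef T (v, z)"])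
       (simp only: coef_repr[OF T z(1), symmetric] c)
qed

text \<open>Both coordinates are branches over the same disk of values, and \<phi> w = \<phi> z
  forces their parameters to agree. The chart is thus a continuous image of a disk.\<close>

lemma cover_chart:
  assumes wz: "(w0, z0) \<in> cover"
    and lb: "local_branches (\<phi> z0) e \<beta>"
  defines "N \<equiv> \<beta> w0 ` ball (\<phi> z0) e \<times> \<beta> z0 ` ball (\<phi> z0) e"
  shows "open N" "(w0, z0) \<in> N" "N \<inter> cover = (\<lambda>m. (\<beta> w0 m, \<beta> z0 m)) ` ball (\<phi> z0) e"
    "connected (N \<inter> cover)"
proof -
  note b = local_branchesD[OF lb]
  let ?B = "ball (\<phi> z0) e"
  have w0: "w0 \<in> fibre (\<phi> z0)" and z0: "z0 \<in> fibre (\<phi> z0)"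
    using wz regular_pointsD(3) by (simp_all add: cover_iff)
  have op: "open (\<beta> v ` ?B)" if "v \<in> fibre (\<phi> z0)" for v
  proof (rule open_mapping_thm3[OF b(3)[OF that] open_ball])
    show "inj_on (\<beta> v) ?B" using b(5)[OF that] by (metis inj_onI)
  qed
  show "open N" unfolding N_def by (intro open_Times op w0 z0)
  have cc: "\<phi> z0 \<in> ?B" using b(1) by simp
  show "(w0, z0) \<in> N"
    unfolding N_def using imageI[OF cc, of "\<beta> w0"] imageI[OF cc, of "\<beta> z0"] by (simp add: b(4) w0 z0)
  have in_cover: "(\<beta> v m, \<beta> u m) \<in> cover" if "v \<in> fibre (\<phi> z0)" "u \<in> fibre (\<phi> z0)" "m \<in> ?B" for u v m
  proof -
    have "\<beta> u m \<in> fibre m" "\<beta> v m \<in> fibre m" using bij_betw_apply[OF b(6)[OF that(3)]] that by auto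
    moreover have "m \<in> regular_values" using b(2) that(3) by blast
    ultimately show ?thesis using fibre_regular b(5)[OF that(2,3)] by (simp add: cover_iff)
  qed
  show eq: "N \<inter> cover = (\<lambda>m. (\<beta> w0 m, \<beta> z0 m)) ` ?B"
  proof (intro equalityI subsetI)
    fix p assume "p \<in> N \<inter> cover"
    then obtain m m' where m: "m \<in> ?B" "m' \<in> ?B" "p = (\<beta> w0 m, \<beta> z0 m')" "p \<in> cover"
      by (auto simp: N_def)
    then have "m = m'" using b(5)[OF w0 m(1)] b(5)[OF z0 m(2)] by (simp add: cover_iff fibre_def)
    then show "p \<in> (\<lambda>m. (\<beta> w0 m, \<beta> z0 m)) ` ?B" using m by blast
  next
    fix p assume "p \<in> (\<lambda>m. (\<beta> w0 m, \<beta> z0 m)) ` ?B"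
    then show "p \<in> N \<inter> cover" using in_cover[OF w0 z0] by (auto simp: N_def)
  qed
  show "connected (N \<inter> cover)"
    unfolding eq
    by (intro connected_continuous_image continuous_on_Pair holomorphic_on_imp_continuous_on b(3) w0 z0 connected_ball)
qed

text \<open>One matrix t serves the whole neighbourhood. Uniqueness identifies it with
  \<open>coef\<close> at each nearby point, once the fibre there is relabelled along the branches by
  \<open>inv\<close>.\<close>

lemma coef_locally_constant:
  assumes T: "T \<in> A_phi \<phi>" and p: "p \<in> cover"
  shows "\<forall>\<^sub>F q in at p within cover. coef T p = coef T q"
proof -
  obtain w0 z0 where p_eq: "p = (w0, z0)" by (cases p)
  have wz: "(w0, z0) \<in> cover" using p p_eq by simp
  have w0: "w0 \<in> fibre (\<phi> z0)" and zr: "z0 \<in> regular_points" using wz by (simp_all add: cover_iff)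
  note zz = regular_pointsD[OF zr]
  obtain e \<beta> where lb: "local_branches (\<phi> z0) e \<beta>"
    using local_branches_exist[OF zz(2)] by blast
  note b = local_branchesD[OF lb]
  note chart = cover_chart[OF wz lb]
  obtain t where t: "\<And>f w m. w \<in> fibre (\<phi> z0) \<Longrightarrow> m \<in> ball (\<phi> z0) e \<Longrightarrow>
    Rep_bergman (T f) (\<beta> w m) / deriv \<phi> (\<beta> w m)
      = (\<Sum>v\<in>fibre (\<phi> z0). t w v * (Rep_bergman f (\<beta> v m) / deriv \<phi> (\<beta> v m)))"
    using locally_constant_matrix[OF T zz(2) lb] by blast
  have const: "coef T (\<beta> w0 m, \<beta> z0 m) = t z0 w0" if m: "m \<in> ball (\<phi> z0) e" for m
  proof -
    have bij: "bij_betw (\<lambda>w. \<beta> w m) (fibre (\<phi> z0)) (fibre m)" by (rule b(6)[OF m])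
    define inv where "inv = the_inv_into (fibre (\<phi> z0)) (\<lambda>w. \<beta> w m)"
    have inv: "inv (\<beta> v m) = v" if "v \<in> fibre (\<phi> z0)" for v
      unfolding inv_def by (rule the_inv_into_f_f[OF bij_betw_imp_inj_on[OF bij] that])
    have c: "(\<beta> w0 m, \<beta> z0 m) \<in> cover" using chart(3) m by blast
    have "coef T (\<beta> w0 m, \<beta> z0 m) = t z0 (inv (\<beta> w0 m))"
    proof (rule coef_unique[OF T c])
      fix f
      have "Rep_bergman (T f) (\<beta> z0 m) / deriv \<phi> (\<beta> z0 m)
        = (\<Sum>v\<in>fibre (\<phi> z0). t z0 (inv (\<beta> v m)) * (Rep_bergman f (\<beta> v m) / deriv \<phi> (\<beta> v m)))"
        unfolding t[OF zz(3) m] by (rule sum.cong) (simp_all add: inv)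
      also have "\<dots> = (\<Sum>v\<in>fibre m. t z0 (inv v) * (Rep_bergman f v / deriv \<phi> v))"
        by (rule sum.reindex_bij_betw[OF bij])
      finally show "Rep_bergman (T f) (\<beta> z0 m) / deriv \<phi> (\<beta> z0 m)
        = (\<Sum>v\<in>fibre (\<phi> (\<beta> z0 m)). t z0 (inv v) * (Rep_bergman f v / deriv \<phi> v))"
        by (simp add: b(5)[OF zz(3) m])
    qed
    then show ?thesis by (simp add: inv[OF w0])
  qed
  have cp: "coef T p = t z0 w0"
    using const[of "\<phi> z0"] b(1) by (simp add: p_eq b(4) w0 zz(3))
  have "\<forall>\<^sub>F q in at p within cover. q \<in> \<beta> w0 ` ball (\<phi> z0) e \<times> \<beta> z0 ` ball (\<phi> z0) e"
    using chart(1,2) unfolding p_eq by (rule eventually_at_in_open[THEN eventually_mono, rotated 2] topological_tendstoD[OF tendsto_ident_at])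
  moreover have "\<forall>\<^sub>F q in at p within cover. q \<in> cover" by (simp add: eventually_at_filter)
  ultimately show ?thesis
  proof eventually_elim
    case (elim q)
    then have "q \<in> (\<lambda>m. (\<beta> w0 m, \<beta> z0 m)) ` ball (\<phi> z0) e" using chart(3) by blast
    then show ?case using const cp by auto
  qed
qed

lemma coef_constant_on_component:
  assumes T: "T \<in> A_phi \<phi>" and K: "K \<in> components cover" and pq: "p \<in> K" "q \<in> K"
  shows "coef T p = coef T q"
proof (rule connected_local_const[OF _ pq])
  show "connected K" using K by (rule in_components_connected)
  have sub: "K \<subseteq> cover" using K by (rule in_components_subset)
  show "\<forall>p\<in>K. \<forall>\<^sub>F q in at p within K. coef T p = coef T q"
  proof
    fix p assume "p \<in> K"
    then have "\<forall>\<^sub>F q in at p within cover. coef T p = coef T q" using sub coef_locally_constant[OF T] by blast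
    then show "\<forall>\<^sub>F q in at p within K. coef T p = coef T q"
      by (rule filter_leD[OF at_le[OF sub]])
  qed
qed

section \<open>Operators attached to unions of components\<close>

definition saturated :: "(complex \<times> complex) set \<Rightarrow> bool"
  where "saturated K \<longleftrightarrow> K \<subseteq> cover \<and> (\<forall>C. connected C \<longrightarrow> C \<subseteq> cover \<longrightarrow> C \<inter> K \<noteq> {} \<longrightarrow> C \<subseteq> K)"

lemma saturated_component: "K \<in> components cover \<Longrightarrow> saturated K"
  unfolding saturated_def using in_components_subset components_maximal by (metis inf_commute)

text \<open>Saturated sets are the unions of components. The exchange of coordinates is a
  homeomorphism of the cover, so it permutes them; on the operators it will correspond to the
  adjoint.\<close>

lemma saturated_swap:
  assumes K: "saturated K"
  shows "saturated (prod.swap ` K)"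
  unfolding saturated_def
proof (intro conjI allI impI)
  have *: "prod.swap ` C \<subseteq> cover" if "C \<subseteq> cover" for C
    using that cover_swap by auto
  show "prod.swap ` K \<subseteq> cover" by (rule *) (use K in \<open>simp add: saturated_def\<close>)
  fix C :: "(complex \<times> complex) set"
  assume C: "connected C" "C \<subseteq> cover" "C \<inter> prod.swap ` K \<noteq> {}"
  have "connected (prod.swap ` C)"
    by (intro connected_continuous_image continuous_on_swap C(1))
  moreover have "prod.swap ` C \<inter> K \<noteq> {}"
  proof -
    obtain p where "p \<in> K" "prod.swap p \<in> C" using C(3) by auto
    then have "prod.swap (prod.swap p) \<in> prod.swap ` C" by (rule_tac imageI)
    then show ?thesis using \<open>p \<in> K\<close> by auto
  qed
  ultimately have "prod.swap ` C \<subseteq> K" using K *[OF C(2)] by (simp add: saturated_def)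
  then have "prod.swap ` prod.swap ` C \<subseteq> prod.swap ` K" by (rule image_mono)
  then show "C \<subseteq> prod.swap ` K" by (simp add: image_image)
qed

definition sheet_sum :: "(complex \<times> complex) set \<Rightarrow> (complex \<Rightarrow> complex) \<Rightarrow> complex \<Rightarrow> complex"
  where "sheet_sum K h z = (\<Sum>w\<in>fibre (\<phi> z). if (w, z) \<in> K then h w else 0)"

text \<open>Near z0 the sum is that of F (\<beta> w (\<phi> z)) over the sheets w in K, and the
  chain rule applies with \<beta>' = 1 / \<phi>'. With F a primitive of f this yields the formula of
  the operator; with F constant it shows that the number of sheets is locally constant.\<close>

lemma sheet_sum_derivative:
  assumes K: "saturated K" and z: "z0 \<in> regular_points"
    and F: "\<And>w. w \<in> unit_disk \<Longrightarrow> (F has_field_derivative f w) (at w)"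
  shows "(sheet_sum K F has_field_derivative
    deriv \<phi> z0 * sheet_sum K (\<lambda>w. f w / deriv \<phi> w) z0) (at z0)"
proof -
  note zz = regular_pointsD[OF z]
  obtain e \<beta> where lb: "local_branches (\<phi> z0) e \<beta>"
    using local_branches_exist[OF zz(2)] by blast
  note b = local_branchesD[OF lb]
  have cc: "\<phi> z0 \<in> ball (\<phi> z0) e" using b(1) by simp
  note in_disk = b(7)
  have wz: "(w, z0) \<in> cover" if "w \<in> fibre (\<phi> z0)" for w using that z by (simp add: cover_iff)
  \<comment> \<open>The chart is connected and K saturated, so the sheets belonging to K do not
    change near z0.\<close>
  have K_iff: "(\<beta> w m, \<beta> z0 m) \<in> K \<longleftrightarrow> (w, z0) \<in> K" if w: "w \<in> fibre (\<phi> z0)" and m: "m \<in> ball (\<phi> z0) e" for w m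
  proof -
    note chart = cover_chart[OF wz[OF w] lb]
    let ?C = "\<beta> w ` ball (\<phi> z0) e \<times> \<beta> z0 ` ball (\<phi> z0) e \<inter> cover"
    have "(w, z0) \<in> ?C" "(\<beta> w m, \<beta> z0 m) \<in> ?C" using chart(2,3) wz[OF w] m by blast+
    then show ?thesis using K chart(4) unfolding saturated_def by blast
  qed
  define N where "N = \<beta> z0 ` ball (\<phi> z0) e"
  have N: "open N"
    unfolding N_def
  proof (rule open_mapping_thm3[OF b(3)[OF zz(3)] open_ball])
    show "inj_on (\<beta> z0) (ball (\<phi> z0) e)" using b(5)[OF zz(3)] by (metis inj_onI)
  qed
  have zN: "z0 \<in> N" unfolding N_def using imageI[OF cc, of "\<beta> z0"] by (simp add: b(4) zz(3))
  have eq: "(\<Sum>w\<in>fibre (\<phi> z0). if (w, z0) \<in> K then F (\<beta> w (\<phi> z)) else 0) = sheet_sum K F z" if zN': "z \<in> N" for z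
  proof -
    obtain m where m: "m \<in> ball (\<phi> z0) e" "z = \<beta> z0 m" using zN' unfolding N_def by blast
    then have \<phi>z: "\<phi> z = m" using b(5)[OF zz(3)] by simp
    have "sheet_sum K F z = (\<Sum>w\<in>fibre (\<phi> z0). if (\<beta> w m, z) \<in> K then F (\<beta> w m) else 0)"
      unfolding sheet_sum_def \<phi>z by (rule sum.reindex_bij_betw[OF b(6)[OF m(1)], symmetric])
    also have "\<dots> = (\<Sum>w\<in>fibre (\<phi> z0). if (w, z0) \<in> K then F (\<beta> w (\<phi> z)) else 0)"
      unfolding m(2) using K_iff m(1) by (intro sum.cong) (auto simp: b(5)[OF zz(3) m(1)])
    finally show ?thesis by simp
  qed
  have dw: "((\<lambda>z. if (w, z0) \<in> K then F (\<beta> w (\<phi> z)) else 0) has_field_derivative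
      deriv \<phi> z0 * (if (w, z0) \<in> K then f w / deriv \<phi> w else 0)) (at z0)" if w: "w \<in> fibre (\<phi> z0)" for w
  proof (cases "(w, z0) \<in> K")
    case True
    have d1: "(\<phi> has_field_derivative deriv \<phi> z0) (at z0)"
      by (rule holomorphic_derivI[OF holomorphic_on_\<phi> open_ball zz(1)])
    have d2: "(\<beta> w has_field_derivative 1 / deriv \<phi> w) (at (\<phi> z0))"
      using holomorphic_derivI[OF b(3)[OF w] open_ball cc]
        branch_weight[OF b(3)[OF w] b(5)[OF w] in_disk[OF w] cc] by (simp add: b(4)[OF w])
    have "(F has_field_derivative f w) (at (\<beta> w (\<phi> z0)))"
      using F[of w] w by (simp add: b(4)[OF w] fibre_def)
    from DERIV_chain2[OF DERIV_chain2[OF this d2] d1]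
    show ?thesis using True by (simp add: mult_ac)
  qed simp
  have "((\<lambda>z. \<Sum>w\<in>fibre (\<phi> z0). if (w, z0) \<in> K then F (\<beta> w (\<phi> z)) else 0) has_field_derivative
      (\<Sum>w\<in>fibre (\<phi> z0). deriv \<phi> z0 * (if (w, z0) \<in> K then f w / deriv \<phi> w else 0))) (at z0)"
    by (rule DERIV_sum) (rule dw)
  then have "(sheet_sum K F has_field_derivative
      (\<Sum>w\<in>fibre (\<phi> z0). deriv \<phi> z0 * (if (w, z0) \<in> K then f w / deriv \<phi> w else 0))) (at z0)"
    by (rule has_field_derivative_transform_within_open[OF _ N zN eq])
  then show ?thesis by (simp add: sheet_sum_def sum_distrib_left)
qed

text \<open>Properness confines the fibres: on a disk of radius R < 1 the modulus of \<phi> is at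
  most some s < 1, and the points of the closed disk with |\<phi>| \<le> s form a compact set that
  misses the circle, where |\<phi>| = 1. The sum has at most n terms, each bounded on that
  set.\<close>

lemma sheet_sum_bounded_near:
  assumes p: "p \<in> unit_disk" and F: "continuous_on unit_disk F"
  shows "\<exists>B. \<forall>\<^sub>F z in at p. cmod (sheet_sum K F z) \<le> B"
proof -
  obtain R where R: "cmod p < R" "R < 1" using p dense by (metis mem_ball_0)
  have sub: "cball 0 R \<subseteq> unit_disk" using R(2) by auto
  have "continuous_on (cball 0 R) (\<lambda>z. cmod (\<phi> z))"
    by (intro continuous_on_norm continuous_on_subset[OF continuous_on_\<phi>]) (use R(2) in auto)
  moreover have "cball (0::complex) R \<noteq> {}" using le_less_trans[OF norm_ge_zero R(1)] by simp
  ultimately obtain z1 where z1: "z1 \<in> cball 0 R" "\<And>z. z \<in> cball 0 R \<Longrightarrow> cmod (\<phi> z) \<le> cmod (\<phi> z1)"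
    using continuous_attains_sup[OF compact_cball] by metis
  define s where "s = cmod (\<phi> z1)"
  have s: "s < 1" unfolding s_def by (rule \<phi>_lt) (use z1(1) R(2) in auto)
  define Q where "Q = {w \<in> cball 0 1. cmod (\<phi> w) \<le> s}"
  have "closed Q"
  proof -
    have "closed (cball 0 1 \<inter> (\<lambda>w. cmod (\<phi> w)) -` {..s})"
      by (intro continuous_closed_preimage continuous_intros continuous_on_\<phi>) auto
    moreover have "Q = cball 0 1 \<inter> (\<lambda>w. cmod (\<phi> w)) -` {..s}" by (auto simp: Q_def)
    ultimately show ?thesis by simp
  qed
  moreover have "bounded Q" by (rule bounded_subset[OF bounded_cball[of 0 1]]) (auto simp: Q_def)
  ultimately have Qc: "compact Q" by (simp add: compact_eq_bounded_closed)
  have Qsub: "Q \<subseteq> unit_disk"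
  proof
    fix w assume w: "w \<in> Q"
    have "cmod w \<noteq> 1" using \<phi>_eq_1[of w] w s by (auto simp: Q_def)
    then show "w \<in> unit_disk" using w by (simp add: Q_def)
  qed
  have "bounded (F ` Q)"
    by (intro compact_imp_bounded compact_continuous_image continuous_on_subset[OF F] Qc Qsub)
  then obtain B where B: "\<And>w. w \<in> Q \<Longrightarrow> cmod (F w) \<le> B" unfolding bounded_iff by blast
  have "cmod (sheet_sum K F z) \<le> real n * \<bar>B\<bar>" if z: "z \<in> ball 0 R" for z
  proof -
    have zc: "z \<in> cball 0 R" using z by simp
    have lt: "cmod (\<phi> z) < 1" using z1(2)[OF zc] s by (simp add: s_def)
    have "cmod (sheet_sum K F z) \<le> (\<Sum>w\<in>fibre (\<phi> z). \<bar>B\<bar>)"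
      unfolding sheet_sum_def
    proof (rule sum_norm_le)
      fix w assume w: "w \<in> fibre (\<phi> z)"
      then have "w \<in> Q" using z1(2)[OF zc] by (simp add: Q_def fibre_def s_def)
      then show "cmod (if (w, z) \<in> K then F w else 0) \<le> \<bar>B\<bar>" using B by force
    qed
    also have "\<dots> = real (card (fibre (\<phi> z))) * \<bar>B\<bar>" by simp
    also have "\<dots> \<le> real n * \<bar>B\<bar>" using fibre_finite_card(2)[OF lt] by (intro mult_right_mono) auto
    finally show ?thesis .
  qed
  moreover have "\<forall>\<^sub>F z in at p. z \<in> ball 0 R" by (rule eventually_at_in_open') (use R(1) in auto)
  ultimately show ?thesis by (intro exI[of _ "real n * \<bar>B\<bar>"]) (auto elim: eventually_mono)
qed

text \<open>Cauchy-Schwarz over the at most n points of the fibre, after the sheets outside K have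
  been added to the bound.\<close>

lemma sheet_sum_square_le:
  assumes l: "l \<in> regular_values" and z: "z \<in> fibre l"
  shows "(cmod (sheet_sum K h z))\<^sup>2 \<le> real n * (\<Sum>w\<in>fibre l. (cmod (h w))\<^sup>2)"
proof -
  have \<phi>z: "\<phi> z = l" using z by (simp add: fibre_def)
  have "cmod (sheet_sum K h z) \<le> (\<Sum>w\<in>fibre l. cmod (h w))"
    unfolding sheet_sum_def \<phi>z by (rule sum_norm_le) auto
  then have "(cmod (sheet_sum K h z))\<^sup>2 \<le> (\<Sum>w\<in>fibre l. cmod (h w))\<^sup>2"
    by (intro power_mono) auto
  also have "\<dots> \<le> (\<Sum>w\<in>fibre l. (cmod (h w))\<^sup>2) * real (card (fibre l))"
    by (rule sum_squared_le_sum_of_squares)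
  also have "\<dots> \<le> (\<Sum>w\<in>fibre l. (cmod (h w))\<^sup>2) * real n"
    using fibre_finite_card(2)[OF regular_value_lt[OF l]] by (intro mult_left_mono sum_nonneg) auto
  finally show ?thesis by (simp add: mult.commute)
qed

text \<open>The formula divides by \<phi>' and is meaningless where \<phi>' vanishes on the fibre.
  The sum of primitives is bounded there and extends; the derivative of the extension is the
  required function. The norm bound is an inequality between fibre sums, integrated over the regular
  values.\<close>

lemma sheet_op_exists:
  assumes K: "saturated K"
  shows "\<exists>h. (\<forall>z\<in>regular_points. Rep_bergman h z
      = deriv \<phi> z * sheet_sum K (\<lambda>w. Rep_bergman f w / deriv \<phi> w) z)
    \<and> norm h \<le> real n * norm f"
proof -
  define s where "s = sheet_sum K (\<lambda>w. Rep_bergman f w / deriv \<phi> w)"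
  obtain F where "\<And>x. x \<in> unit_disk \<Longrightarrow> (F has_field_derivative Rep_bergman f x) (at x within unit_disk)"
    using holomorphic_convex_primitive'[OF convex_ball open_ball Rep_bergman_holomorphic] by metis
  then have F: "\<And>x. x \<in> unit_disk \<Longrightarrow> (F has_field_derivative Rep_bergman f x) (at x)"
    by (metis at_within_open open_ball)
  have Fc: "continuous_on unit_disk F"
    using F by (meson DERIV_isCont continuous_at_imp_continuous_on)
  note der = sheet_sum_derivative[OF K _ F, folded s_def]
  have "sheet_sum K F holomorphic_on unit_disk - branch_fibres \<phi>"
    unfolding regular_points_def[symmetric] holomorphic_on_open[OF open_regular_points]
    using der by blast
  moreover have "\<exists>B. \<forall>\<^sub>F z in at p. cmod (sheet_sum K F z) \<le> B" if "p \<in> unit_disk" for p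
    by (rule sheet_sum_bounded_near[OF that Fc])
  ultimately obtain g where g: "g holomorphic_on unit_disk" "\<And>z. z \<in> unit_disk - branch_fibres \<phi> \<Longrightarrow> g z = sheet_sum K F z"
    using holomorphic_extension_finite[OF _ open_ball finite_branch_fibres] by metis
  have dg: "deriv g z = deriv \<phi> z * s z" if z: "z \<in> regular_points" for z
  proof (rule DERIV_imp_deriv)
    show "(g has_field_derivative deriv \<phi> z * s z) (at z)"
      by (rule has_field_derivative_transform_within_open[OF der[OF z] open_regular_points z])
         (assumption, rule g(2)[symmetric], simp only: regular_points_def)
  qed
  define e where "e = (\<lambda>z. if z \<in> unit_disk then deriv g z else 0)"
  have e_hol: "e holomorphic_on unit_disk"
    by (subst holomorphic_cong[OF refl, of _ _ "deriv g"])
       (simp_all add: e_def holomorphic_deriv[OF g(1) open_ball])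
  have e0: "e z = 0" if "z \<notin> unit_disk" for z using that by (simp add: e_def)
  have em[measurable]: "e \<in> borel_measurable borel"
    by (rule holomorphic_disk_measurable[OF e_hol e0])
  have e_reg: "e z = deriv \<phi> z * s z" if "z \<in> regular_points" for z
    using dg[OF that] regular_pointsD(1)[OF that] by (simp add: e_def)
  \<comment> \<open>One factor n comes from Cauchy-Schwarz at each z, the other from summing over
    the at most n points z of the fibre; the square root gives the norm bound n.\<close>
  have pointwise: "fibre_sum (\<lambda>z. (cmod (e z))\<^sup>2) l \<le> (real n)\<^sup>2 * fibre_sum (\<lambda>z. (cmod (Rep_bergman f z))\<^sup>2) l"
    if l: "l \<in> regular_values" for l
  proof -
    define A where "A = (\<Sum>w\<in>fibre l. (cmod (Rep_bergman f w / deriv \<phi> w))\<^sup>2)"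
    have A0: "0 \<le> A" unfolding A_def by (rule sum_nonneg) simp
    have "fibre_sum (\<lambda>z. (cmod (e z))\<^sup>2) l = (\<Sum>z\<in>fibre l. (cmod (s z))\<^sup>2)"
      unfolding fibre_sum_def
    proof (rule sum.cong[OF refl])
      fix z assume "z \<in> fibre l"
      then have z: "z \<in> regular_points" by (rule fibre_regular[OF l])
      show "(1 / (cmod (deriv \<phi> z))\<^sup>2) *\<^sub>R (cmod (e z))\<^sup>2 = (cmod (s z))\<^sup>2"
        using deriv_nonzero[OF z] by (simp add: e_reg[OF z] norm_mult power_mult_distrib)
    qed
    also have "\<dots> \<le> (\<Sum>z\<in>fibre l. real n * A)"
      unfolding s_def A_def by (intro sum_mono sheet_sum_square_le[OF l])
    also have "\<dots> = real (card (fibre l)) * (real n * A)" by simp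
    also have "\<dots> \<le> real n * (real n * A)"
      using fibre_finite_card(2)[OF regular_value_lt[OF l]] A0 by (intro mult_right_mono) auto
    also have "A = fibre_sum (\<lambda>z. (cmod (Rep_bergman f z))\<^sup>2) l"
      unfolding A_def fibre_sum_def by (rule sum.cong) (simp_all add: norm_divide power_divide)
    finally show ?thesis by (simp add: power2_eq_square mult.assoc)
  qed
  have "(\<integral>\<^sup>+z\<in>unit_disk. ennreal ((cmod (e z))\<^sup>2) \<partial>lborel)
      = (\<integral>\<^sup>+l\<in>regular_values. ennreal (fibre_sum (\<lambda>z. (cmod (e z))\<^sup>2) l) \<partial>lborel)"
    by (subst fibre_nn_integral(2)) (simp_all add: fibre_nn_sum_ennreal)
  also have "\<dots> \<le> (\<integral>\<^sup>+l. ennreal ((real n)\<^sup>2) * (fibre_nn_sum (\<lambda>z. ennreal ((cmod (Rep_bergman f z))\<^sup>2)) l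
      * indicator regular_values l) \<partial>lborel)"
  proof (rule nn_integral_mono)
    fix l
    show "ennreal (fibre_sum (\<lambda>z. (cmod (e z))\<^sup>2) l) * indicator regular_values l
      \<le> ennreal ((real n)\<^sup>2) * (fibre_nn_sum (\<lambda>z. ennreal ((cmod (Rep_bergman f z))\<^sup>2)) l * indicator regular_values l)"
    proof (cases "l \<in> regular_values")
      case True
      have "ennreal (fibre_sum (\<lambda>z. (cmod (e z))\<^sup>2) l)
          \<le> ennreal ((real n)\<^sup>2 * fibre_sum (\<lambda>z. (cmod (Rep_bergman f z))\<^sup>2) l)"
        by (rule ennreal_leI[OF pointwise[OF True]])
      then show ?thesis using True by (simp add: fibre_nn_sum_ennreal ennreal_mult')
    qed simp
  qed
  also have "\<dots> = ennreal ((real n)\<^sup>2) * (\<integral>\<^sup>+z\<in>unit_disk. ennreal ((cmod (Rep_bergman f z))\<^sup>2) \<partial>lborel)"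
  proof -
    have m: "(\<lambda>z. ennreal ((cmod (Rep_bergman f z))\<^sup>2)) \<in> borel_measurable borel" by measurable
    show ?thesis
      using fibre_nn_integral(1)[OF m] unfolding fibre_nn_integral(2)[OF m]
      by (intro nn_integral_cmult) simp
  qed
  finally have le: "(\<integral>\<^sup>+z\<in>unit_disk. ennreal ((cmod (e z))\<^sup>2) \<partial>lborel)
      \<le> ennreal ((real n)\<^sup>2) * (\<integral>\<^sup>+z\<in>unit_disk. ennreal ((cmod (Rep_bergman f z))\<^sup>2) \<partial>lborel)" .
  have "(\<integral>\<^sup>+z. ennreal ((cmod (e z))\<^sup>2) \<partial>area) \<le> ennreal ((real n)\<^sup>2) * (\<integral>\<^sup>+z. ennreal ((cmod (Rep_bergman f z))\<^sup>2) \<partial>area)"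
    using mult_left_mono[OF le, of "ennreal (inverse (measure lborel unit_disk))"]
    by (subst (1 2) nn_integral_area) (simp_all add: mult.left_commute)
  also have "(\<integral>\<^sup>+z. ennreal ((cmod (Rep_bergman f z))\<^sup>2) \<partial>area) = ennreal ((norm f)\<^sup>2)"
    unfolding norm_bergman_square
    by (rule nn_integral_eq_integral) (auto simp: Rep_bergman_square_integrable)
  also have "ennreal ((real n)\<^sup>2) * ennreal ((norm f)\<^sup>2) = ennreal ((real n * norm f)\<^sup>2)"
    by (simp add: ennreal_mult'[symmetric] power_mult_distrib)
  finally have bound: "(\<integral>\<^sup>+z. ennreal ((cmod (e z))\<^sup>2) \<partial>area) \<le> ennreal ((real n * norm f)\<^sup>2)" .
  have int: "integrable area (\<lambda>z. (cmod (e z))\<^sup>2)"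
  proof (rule integrableI_bounded)
    have "(\<integral>\<^sup>+z. ennreal (norm ((cmod (e z))\<^sup>2)) \<partial>area) \<le> ennreal ((real n * norm f)\<^sup>2)" using bound by simp
    then show "(\<integral>\<^sup>+z. ennreal (norm ((cmod (e z))\<^sup>2)) \<partial>area) < \<infinity>"
      by (rule le_less_trans) simp
  qed measurable
  define h where "h = Abs_bergman e"
  have Rh: "Rep_bergman h = e"
    unfolding h_def by (rule Abs_bergman_inverse) (use e_hol e0 int in blast)
  have "ennreal ((norm h)\<^sup>2) = (\<integral>\<^sup>+z. ennreal ((cmod (e z))\<^sup>2) \<partial>area)"
    unfolding norm_bergman_square Rh
    by (rule nn_integral_eq_integral[symmetric]) (auto simp: int)
  then have "ennreal ((norm h)\<^sup>2) \<le> ennreal ((real n * norm f)\<^sup>2)" using bound by simp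
  then have "(norm h)\<^sup>2 \<le> (real n * norm f)\<^sup>2" by (subst (asm) ennreal_le_iff) auto
  then have "norm h \<le> real n * norm f" by (rule power2_le_imp_le) simp
  then show ?thesis using e_reg unfolding s_def Rh[symmetric] by blast
qed

definition sheet_op :: "(complex \<times> complex) set \<Rightarrow> bergman \<Rightarrow> bergman"
  where "sheet_op K f = (SOME h. (\<forall>z\<in>regular_points. Rep_bergman h z
      = deriv \<phi> z * sheet_sum K (\<lambda>w. Rep_bergman f w / deriv \<phi> w) z)
    \<and> norm h \<le> real n * norm f)"

lemma sheet_op_spec:
  assumes K: "saturated K"
  shows "z \<in> regular_points \<Longrightarrow> Rep_bergman (sheet_op K f) z
      = deriv \<phi> z * sheet_sum K (\<lambda>w. Rep_bergman f w / deriv \<phi> w) z"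
    and "norm (sheet_op K f) \<le> real n * norm f"
  using someI_ex[OF sheet_op_exists[OF K, of f], folded sheet_op_def] by blast+

lemma bounded_clinear_sheet_op:
  assumes K: "saturated K"
  shows "bounded_clinear (sheet_op K)"
proof (rule bounded_clinearI)
  show "sheet_op K (f + g) = sheet_op K f + sheet_op K g" for f g
  proof (rule bergman_eqI_regular)
    fix z assume z: "z \<in> regular_points"
    have "sheet_sum K (\<lambda>w. Rep_bergman (f + g) w / deriv \<phi> w) z
        = sheet_sum K (\<lambda>w. Rep_bergman f w / deriv \<phi> w) z + sheet_sum K (\<lambda>w. Rep_bergman g w / deriv \<phi> w) z"
      unfolding sheet_sum_def sum.distrib[symmetric]
      by (rule sum.cong) (auto simp: Rep_bergman_simps add_divide_distrib)
    then show "Rep_bergman (sheet_op K (f + g)) z = Rep_bergman (sheet_op K f + sheet_op K g) z"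
      by (simp add: sheet_op_spec(1)[OF K z] Rep_bergman_simps distrib_left)
  qed
  show "sheet_op K (cscale c f) = cscale c (sheet_op K f)" for c f
  proof (rule bergman_eqI_regular)
    fix z assume z: "z \<in> regular_points"
    have "sheet_sum K (\<lambda>w. Rep_bergman (cscale c f) w / deriv \<phi> w) z
        = c * sheet_sum K (\<lambda>w. Rep_bergman f w / deriv \<phi> w) z"
      unfolding sheet_sum_def sum_distrib_left by (rule sum.cong) (auto simp: Rep_cscale)
    then show "Rep_bergman (sheet_op K (cscale c f)) z = Rep_bergman (cscale c (sheet_op K f)) z"
      by (simp add: sheet_op_spec(1)[OF K z] Rep_cscale)
  qed
  show "norm (sheet_op K f) \<le> real n * norm f" for f by (rule sheet_op_spec(2)[OF K])
qed

lemma sheet_op_commutes: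
  assumes K: "saturated K"
  shows "sheet_op K \<circ> M = M \<circ> sheet_op K"
proof
  fix f
  show "(sheet_op K \<circ> M) f = (M \<circ> sheet_op K) f"
  proof (rule bergman_eqI_regular)
    fix z assume z: "z \<in> regular_points"
    have "sheet_sum K (\<lambda>w. Rep_bergman (M f) w / deriv \<phi> w) z
        = \<phi> z * sheet_sum K (\<lambda>w. Rep_bergman f w / deriv \<phi> w) z"
      unfolding sheet_sum_def sum_distrib_left by (rule sum.cong) (auto simp: Rep_M fibre_def)
    then show "Rep_bergman ((sheet_op K \<circ> M) f) z = Rep_bergman ((M \<circ> sheet_op K) f) z"
      by (simp add: sheet_op_spec(1)[OF K z] Rep_M)
  qed
qed

lemma cinner_eq_fibre_integral:
  "cinner f g = (\<integral>l. indicator regular_values l *\<^sub>R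
      fibre_sum (\<lambda>z. Rep_bergman f z * cnj (Rep_bergman g z)) l \<partial>lborel) /\<^sub>R measure lborel unit_disk"
proof -
  define G where "G = (\<lambda>z. Rep_bergman f z * cnj (Rep_bergman g z))"
  have [measurable]: "cnj \<in> borel_measurable borel"
    by (intro borel_measurable_continuous_onI continuous_intros)
  have Gm: "G \<in> borel_measurable borel" unfolding G_def by measurable
  have "integrable area G" unfolding G_def by (rule bergman_inner_integrable)
  then have "has_bochner_integral lborel (\<lambda>z. indicator unit_disk z *\<^sub>R G z) (LINT z:unit_disk|lborel. G z)"
    unfolding integrable_area[OF Gm] set_integrable_def set_lebesgue_integral_def
    by (rule has_bochner_integral_integrable)
  then have "has_bochner_integral lborel (\<lambda>l. indicator regular_values l *\<^sub>R fibre_sum G l) (LINT z:unit_disk|lborel. G z)"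
    by (rule fibre_integral[OF Gm])
  then have "(\<integral>l. indicator regular_values l *\<^sub>R fibre_sum G l \<partial>lborel) = (LINT z:unit_disk|lborel. G z)"
    by (rule has_bochner_integral_integral_eq)
  moreover have "cinner f g = (LINT z:unit_disk|lborel. G z) /\<^sub>R measure lborel unit_disk"
    unfolding cinner_def G_def[symmetric] by (rule integral_area[OF Gm])
  ultimately show ?thesis by (simp only: G_def)
qed

text \<open>In the fibre integral the operator is the incidence matrix of K acting on the quotients
  f / \<phi>'. Exchanging the two sums over the fibre transposes it.\<close>

lemma sheet_op_adjoint:
  assumes K: "saturated K"
  shows "cinner (sheet_op K f) g = cinner f (sheet_op (prod.swap ` K) g)"
proof -
  note K' = saturated_swap[OF K]
  have swap_iff: "(w, z) \<in> prod.swap ` K \<longleftrightarrow> (z, w) \<in> K" for w z by force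
  define F where "F = (\<lambda>w. Rep_bergman f w / deriv \<phi> w)"
  define G where "G = (\<lambda>w. Rep_bergman g w / deriv \<phi> w)"
  have "fibre_sum (\<lambda>z. Rep_bergman (sheet_op K f) z * cnj (Rep_bergman g z)) l
      = fibre_sum (\<lambda>z. Rep_bergman f z * cnj (Rep_bergman (sheet_op (prod.swap ` K) g) z)) l"
    if l: "l \<in> regular_values" for l
  proof -
    have reg: "z \<in> regular_points" "\<phi> z = l" "deriv \<phi> z \<noteq> 0" if "z \<in> fibre l" for z
      using fibre_regular[OF l that] that deriv_nonzero by (auto simp: fibre_def)
    have weight: "(1 / (cmod (deriv \<phi> z))\<^sup>2) *\<^sub>R (x * cnj y) = (x / deriv \<phi> z) * cnj (y / deriv \<phi> z)" for x y z
      unfolding scaleR_conv_of_real of_real_divide complex_norm_square by simp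
    have "fibre_sum (\<lambda>z. Rep_bergman (sheet_op K f) z * cnj (Rep_bergman g z)) l
        = (\<Sum>z\<in>fibre l. sheet_sum K F z * cnj (G z))"
      unfolding fibre_sum_def weight
      by (rule sum.cong) (simp_all add: sheet_op_spec(1)[OF K] reg G_def F_def)
    also have "\<dots> = (\<Sum>z\<in>fibre l. \<Sum>w\<in>fibre l. if (w, z) \<in> K then F w * cnj (G z) else 0)"
      by (intro sum.cong refl) (simp add: sheet_sum_def reg sum_distrib_right if_distrib[of "\<lambda>x. x * _"] cong: if_cong)
    also have "\<dots> = (\<Sum>w\<in>fibre l. \<Sum>z\<in>fibre l. if (w, z) \<in> K then F w * cnj (G z) else 0)"
      by (rule sum.swap)
    also have "\<dots> = (\<Sum>w\<in>fibre l. F w * cnj (sheet_sum (prod.swap ` K) G w))"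
      by (intro sum.cong refl)
         (simp add: sheet_sum_def reg sum_distrib_left cnj_sum swap_iff if_distrib[of cnj] if_distrib[of "\<lambda>x. _ * x"] cong: if_cong)
    also have "\<dots> = fibre_sum (\<lambda>z. Rep_bergman f z * cnj (Rep_bergman (sheet_op (prod.swap ` K) g) z)) l"
      unfolding fibre_sum_def weight
      by (rule sum.cong) (simp_all add: sheet_op_spec(1)[OF K'] reg G_def F_def)
    finally show ?thesis .
  qed
  then have "(\<lambda>l. indicator regular_values l *\<^sub>R fibre_sum (\<lambda>z. Rep_bergman (sheet_op K f) z * cnj (Rep_bergman g z)) l)
    = (\<lambda>l. indicator regular_values l *\<^sub>R fibre_sum (\<lambda>z. Rep_bergman f z * cnj (Rep_bergman (sheet_op (prod.swap ` K) g) z)) l)"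
    by (auto simp: fun_eq_iff indicator_def)
  then show ?thesis unfolding cinner_eq_fibre_integral by (simp only:)
qed

lemma sheet_op_in_A_phi: "saturated K \<Longrightarrow> sheet_op K \<in> A_phi \<phi>"
  by (rule A_phiI[OF bounded_clinear_sheet_op sheet_op_commutes sheet_op_adjoint
        sheet_op_commutes[OF saturated_swap]])

lemma coef_sheet_op:
  assumes K: "saturated K" and p: "p \<in> cover"
  shows "coef (sheet_op K) p = (if p \<in> K then 1 else 0)"
proof -
  obtain w z where wz: "p = (w, z)" by (cases p)
  have z: "z \<in> regular_points" using p by (simp add: wz cover_iff)
  have "coef (sheet_op K) (w, z) = (if (w, z) \<in> K then 1 else 0)"
  proof (rule coef_unique[OF sheet_op_in_A_phi[OF K], where c = "\<lambda>w. if (w, z) \<in> K then 1 else 0"])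
    show "(w, z) \<in> cover" using p wz by simp
    fix f
    show "Rep_bergman (sheet_op K f) z / deriv \<phi> z
      = (\<Sum>v\<in>fibre (\<phi> z). (if (v, z) \<in> K then 1 else 0) * (Rep_bergman f v / deriv \<phi> v))"
      using deriv_nonzero[OF z] unfolding sheet_op_spec(1)[OF K z] sheet_sum_def
      by (simp, intro sum.cong) auto
  qed
  then show ?thesis by (simp add: wz)
qed

end

section \<open>The structure of the von Neumann algebra\<close>

text \<open>Two finite bases of one span, given as injective families so that the index sets are
  what is counted.\<close>

lemma (in vector_space) card_eq_of_independent_families:
  assumes fin: "finite I" "finite J"
    and inj: "inj_on u I" "inj_on v J"
    and ind: "independent (u ` I)" "independent (v ` J)"
    and sub: "u ` I \<subseteq> span (v ` J)" "v ` J \<subseteq> span (u ` I)"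
  shows "card I = card J"
  using independent_span_bound[OF _ ind(1) sub(1)] independent_span_bound[OF _ ind(2) sub(2)]
    fin card_image[OF inj(1)] card_image[OF inj(2)] by simp

lemma vector_space_cscale: "vector_space cscale"
  by unfold_locales (simp_all add: cscale_add cscale_add_left cscale_cscale)

lemma bounded_clinear_comp:
  assumes S: "bounded_clinear S" and T: "bounded_clinear T"
  shows "bounded_clinear (S \<circ> T)"
proof -
  obtain K L where K: "K \<ge> 0" "\<And>f. norm (S f) \<le> K * norm f" and L: "L \<ge> 0" "\<And>f. norm (T f) \<le> L * norm f"
    using bounded_clinear_bounded[OF S] bounded_clinear_bounded[OF T] by metis
  show ?thesis
  proof (rule bounded_clinearI[of _ "K * L"])
    fix f
    have "norm (S (T f)) \<le> K * norm (T f)" by (rule K)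
    also have "\<dots> \<le> K * (L * norm f)" by (intro mult_left_mono K L)
    finally show "norm ((S \<circ> T) f) \<le> K * L * norm f" by (simp add: mult.assoc)
  qed (simp_all add: bounded_clinear_add[OF S] bounded_clinear_add[OF T]
      bounded_clinear_cscale[OF S] bounded_clinear_cscale[OF T])
qed

lemma bounded_clinear_lincomb:
  assumes S: "bounded_clinear S" and T: "bounded_clinear T"
  shows "bounded_clinear (\<lambda>f. cscale c (S f) + cscale d (T f))"
proof -
  obtain K L where K: "K \<ge> 0" "\<And>f. norm (S f) \<le> K * norm f" and L: "L \<ge> 0" "\<And>f. norm (T f) \<le> L * norm f"
    using bounded_clinear_bounded[OF S] bounded_clinear_bounded[OF T] by metis
  show ?thesis
  proof (rule bounded_clinearI[of _ "cmod c * K + cmod d * L"])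
    fix f
    have "norm (cscale c (S f) + cscale d (T f)) \<le> norm (cscale c (S f)) + norm (cscale d (T f))"
      by (rule norm_triangle_ineq)
    also have "\<dots> \<le> cmod c * (K * norm f) + cmod d * (L * norm f)"
      unfolding norm_cscale by (intro add_mono mult_left_mono K L norm_ge_zero)
    finally show "norm (cscale c (S f) + cscale d (T f)) \<le> (cmod c * K + cmod d * L) * norm f"
      by (simp add: algebra_simps)
  qed (simp_all add: bounded_clinear_add[OF S] bounded_clinear_add[OF T]
      bounded_clinear_cscale[OF S] bounded_clinear_cscale[OF T] cscale_add cscale_cscale mult.commute)
qed

lemma bounded_clinear_id: "bounded_clinear id"
  by (rule bounded_clinearI[of _ 1]) simp_all

context blaschke_product
begin

lemma A_phi_id: "id \<in> A_phi \<phi>"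
  by (simp add: A_phi_iff bounded_clinear_id)

lemma A_phi_comp: "S \<in> A_phi \<phi> \<Longrightarrow> T \<in> A_phi \<phi> \<Longrightarrow> S \<circ> T \<in> A_phi \<phi>"
  unfolding A_phi_iff by (metis bounded_clinear_comp comp_assoc)

lemma A_phi_lincomb:
  assumes S: "S \<in> A_phi \<phi>" and T: "T \<in> A_phi \<phi>"
  shows "(\<lambda>f. cscale c (S f) + cscale d (T f)) \<in> A_phi \<phi>"
proof -
  have L: "bounded_clinear L \<Longrightarrow> S \<circ> L = L \<circ> S \<Longrightarrow> T \<circ> L = L \<circ> T \<Longrightarrow>
      (\<lambda>f. cscale c (S f) + cscale d (T f)) \<circ> L = L \<circ> (\<lambda>f. cscale c (S f) + cscale d (T f))" for L
    by (simp add: fun_eq_iff bounded_clinear_add bounded_clinear_cscale)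
  show ?thesis
    using S T unfolding A_phi_iff
    by (auto intro: bounded_clinear_lincomb L bounded_clinear_M bounded_clinear_cadjoint)
qed

lemma A_phi_sum:
  assumes "finite I" "\<And>i. i \<in> I \<Longrightarrow> T i \<in> A_phi \<phi>"
  shows "(\<lambda>f. \<Sum>i\<in>I. cscale (c i) (T i f)) \<in> A_phi \<phi>"
  using assms
proof (induction I)
  case empty
  have "(\<lambda>f. cscale 0 (id f) + cscale 0 (id f)) \<in> A_phi \<phi>" by (intro A_phi_lincomb A_phi_id)
  then show ?case by simp
next
  case (insert i I)
  then have "(\<lambda>f. cscale (c i) (T i f) + cscale 1 (\<Sum>i\<in>I. cscale (c i) (T i f))) \<in> A_phi \<phi>"
    by (intro A_phi_lincomb) auto
  then show ?case using insert by simp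
qed

text \<open>Since P is self-adjoint, invariance of N under the adjoint of M amounts to P M = P M P,
  and invariance under M to P M P = M P.\<close>

lemma projection_in_A_phi:
  assumes N: "reducing_subspace M N"
  obtains P where "P \<in> A_phi \<phi>" "\<And>f. P f \<in> N" "\<And>f. f \<in> N \<Longrightarrow> P f = f"
proof -
  have sub: "csubspace N" "closed N" and inv: "\<And>f. f \<in> N \<Longrightarrow> M f \<in> N" "\<And>f. f \<in> N \<Longrightarrow> cadjoint M f \<in> N"
    using N by (auto simp: reducing_subspace_def)
  obtain P where P: "bounded_clinear P" "\<And>f. P f \<in> N" "\<And>f. f \<in> N \<Longrightarrow> P f = f"
    "\<And>f g. cinner (P f) g = cinner f (P g)"
    using orthogonal_projection_exists[OF sub] by metis
  note adj = cinner_cadjoint[OF bounded_clinear_M]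
  have "P (M f) = M (P f)" for f
  proof (rule cinner_eqI_right)
    fix g
    have 1: "cinner (M h) (P g) = cinner (M (P h)) (P g)" for h
    proof -
      have "cinner (M h) (P g) = cinner h (P (cadjoint M (P g)))" by (simp add: adj P(2,3) inv)
      also have "\<dots> = cinner (P h) (cadjoint M (P g))" by (rule P(4)[symmetric])
      also have "\<dots> = cinner (M (P h)) (P g)" by (rule adj[symmetric])
      finally show ?thesis .
    qed
    have "cinner (P (M f)) g = cinner (M (P f)) (P g)" unfolding P(4) by (rule 1)
    also have "\<dots> = cinner (P (M (P f))) g" by (simp only: P(4))
    also have "\<dots> = cinner (M (P f)) g" by (simp add: P(2,3) inv)
    finally show "cinner g (P (M f)) = cinner g (M (P f))" by (metis cinner_commute)
  qed
  then have "P \<circ> M = M \<circ> P" by auto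
  then have "P \<in> A_phi \<phi>" by (intro A_phiI[OF P(1) _ P(4)])
  then show ?thesis using that P by blast
qed

lemma A_phi_eqI:
  assumes S: "S \<in> A_phi \<phi>" and T: "T \<in> A_phi \<phi>" and eq: "\<And>p. p \<in> cover \<Longrightarrow> coef S p = coef T p"
  shows "S = T"
proof (rule ext, rule bergman_eqI_regular)
  fix f z assume z: "z \<in> regular_points"
  have "Rep_bergman (S f) z / deriv \<phi> z = Rep_bergman (T f) z / deriv \<phi> z"
    unfolding coef_repr[OF S z] coef_repr[OF T z]
    by (rule sum.cong) (use z in \<open>simp_all add: eq cover_iff\<close>)
  then show "Rep_bergman (S f) z = Rep_bergman (T f) z" using deriv_nonzero[OF z] by simp
qed

lemma coef_sum:
  assumes I: "finite I" and T: "\<And>i. i \<in> I \<Longrightarrow> T i \<in> A_phi \<phi>" and p: "p \<in> cover"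
  shows "coef (\<lambda>f. \<Sum>i\<in>I. cscale (c i) (T i f)) p = (\<Sum>i\<in>I. c i * coef (T i) p)"
proof -
  obtain w z where wz: "p = (w, z)" by (cases p)
  have z: "z \<in> regular_points" using p by (simp add: wz cover_iff)
  have "coef (\<lambda>f. \<Sum>i\<in>I. cscale (c i) (T i f)) (w, z) = (\<Sum>i\<in>I. c i * coef (T i) (w, z))"
  proof (rule coef_unique[OF A_phi_sum[OF I T], where c = "\<lambda>w. \<Sum>i\<in>I. c i * coef (T i) (w, z)"])
    show "(w, z) \<in> cover" using p wz by simp
    fix f
    have "Rep_bergman (\<Sum>i\<in>I. cscale (c i) (T i f)) z / deriv \<phi> z
        = (\<Sum>i\<in>I. c i * (Rep_bergman (T i f) z / deriv \<phi> z))"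
      by (simp add: Rep_bergman_sum Rep_cscale sum_divide_distrib)
    also have "\<dots> = (\<Sum>i\<in>I. \<Sum>v\<in>fibre (\<phi> z). c i * (coef (T i) (v, z) * (Rep_bergman f v / deriv \<phi> v)))"
      by (rule sum.cong) (simp_all only: coef_repr[OF T z] sum_distrib_left)
    also have "\<dots> = (\<Sum>v\<in>fibre (\<phi> z). \<Sum>i\<in>I. c i * (coef (T i) (v, z) * (Rep_bergman f v / deriv \<phi> v)))"
      by (rule sum.swap)
    finally show "Rep_bergman (\<Sum>i\<in>I. cscale (c i) (T i f)) z / deriv \<phi> z
      = (\<Sum>v\<in>fibre (\<phi> z). (\<Sum>i\<in>I. c i * coef (T i) (v, z)) * (Rep_bergman f v / deriv \<phi> v))"
      by (simp only: sum_distrib_right mult.assoc)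
  qed
  then show ?thesis by (simp add: wz)
qed

text \<open>The number of points of \<open>K\<close> over \<open>z\<close> is the sheet sum of the constant 1, whose derivative vanishes.\<close>

lemma component_meets_fibre:
  assumes K: "K \<in> components cover" and z: "z \<in> regular_points"
  obtains w where "(w, z) \<in> K"
proof -
  have F: "((\<lambda>_. 1) has_field_derivative 0) (at w)" for w :: complex by simp
  have zero: "sheet_sum K (\<lambda>w. 0 / deriv \<phi> w) x = 0" for x by (simp add: sheet_sum_def)
  have "(sheet_sum K (\<lambda>_. 1) has_field_derivative 0) (at x)" if "x \<in> regular_points" for x
    using sheet_sum_derivative[OF saturated_component[OF K] that F] unfolding zero by simp
  \<comment> \<open>The constant c is the number of sheets of K, the same over all regular points
    because these form a connected open set.\<close>
  then obtain c where c: "\<And>x. x \<in> regular_points \<Longrightarrow> sheet_sum K (\<lambda>_. 1) x = c"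
    using DERIV_zero_connected_constant[OF connected_regular_points open_regular_points, of "{}" "sheet_sum K (\<lambda>_. 1)"]
    by (metis DERIV_isCont Diff_empty continuous_at_imp_continuous_on finite.emptyI)
  have count: "sheet_sum K (\<lambda>_. 1) x = of_nat (card {w \<in> fibre (\<phi> x). (w, x) \<in> K})" if "x \<in> regular_points" for x
    unfolding sheet_sum_def using regular_pointsD(5)[OF that]
    by (subst sum.inter_filter[symmetric]) simp_all
  obtain w0 x0 where wx: "(w0, x0) \<in> K" using in_components_nonempty[OF K] by force
  have "(w0, x0) \<in> cover" using wx in_components_subset[OF K] by blast
  then have x0: "x0 \<in> regular_points" "w0 \<in> fibre (\<phi> x0)" by (simp_all add: cover_iff)
  have "card {w \<in> fibre (\<phi> x0). (w, x0) \<in> K} \<noteq> 0"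
    using wx x0(2) regular_pointsD(5)[OF x0(1)] by auto
  then have "of_nat (card {w \<in> fibre (\<phi> x0). (w, x0) \<in> K}) \<noteq> (0 :: complex)"
    by (subst of_nat_eq_0_iff)
  then have "c \<noteq> 0" unfolding c[OF x0(1), symmetric] count[OF x0(1)] .
  then have "card {w \<in> fibre (\<phi> z). (w, z) \<in> K} \<noteq> 0" using c[OF z] count[OF z] by auto
  then have "{w \<in> fibre (\<phi> z). (w, z) \<in> K} \<noteq> {}" by force
  then show ?thesis using that by blast
qed

end

section \<open>The boundary fibre and its circulant matrices\<close>

locale blaschke_cycle = blaschke_product +
  fixes \<gamma> :: "real \<Rightarrow> complex"
  assumes \<gamma>_cont: "continuous_on UNIV \<gamma>" and \<gamma>_regular: "\<And>t. \<gamma> t \<in> regular_points"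
    and \<gamma>_fibre: "\<And>t. \<phi> (\<gamma> (t + 2 * pi)) = \<phi> (\<gamma> t)"
    and \<gamma>_period: "\<And>t. \<gamma> (t + 2 * pi * real n) = \<gamma> t"
    and \<gamma>_bij: "\<And>t. bij_betw (\<lambda>k. \<gamma> (t + 2 * pi * real k)) {..<n} (fibre (\<phi> (\<gamma> t)))"
begin

text \<open>The points over \<phi> (\<gamma> 0) in the cyclic order of the boundary path. The index
  ranges over all naturals and counts modulo n, so that indices can be added without
  reduction.\<close>

definition pt :: "nat \<Rightarrow> complex" where "pt k = \<gamma> (2 * pi * real k)"

lemma \<gamma>_fibre_nat: "\<phi> (\<gamma> (t + 2 * pi * real k)) = \<phi> (\<gamma> t)"
proof (induction k)
  case (Suc k)
  have "t + 2 * pi * real (Suc k) = (t + 2 * pi * real k) + 2 * pi" by (simp add: algebra_simps)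
  then show ?case using \<gamma>_fibre Suc by metis
qed simp

lemma pt_regular: "pt k \<in> regular_points" by (simp add: pt_def \<gamma>_regular)

lemma \<phi>_pt: "\<phi> (pt k) = \<phi> (pt 0)"
  using \<gamma>_fibre_nat[of 0 k] by (simp add: pt_def)

lemma pt_period: "pt (k + n) = pt k"
  using \<gamma>_period[of "2 * pi * real k"] by (simp add: pt_def algebra_simps)

lemma pt_mod: "pt (k mod n) = pt k"
proof (induction k rule: less_induct)
  case (less k)
  show ?case
  proof (cases "k < n")
    case False
    then have "pt k = pt (k - n)" using pt_period[of "k - n"] by simp
    moreover have "(k - n) mod n = k mod n" using False by (simp add: le_mod_geq)
    ultimately show ?thesis using less[of "k - n"] False n by simp
  qed simp
qed

lemma pt_bij: "bij_betw (\<lambda>k. pt (i + k)) {..<n} (fibre (\<phi> (pt 0)))"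
proof -
  have "\<gamma> (2 * pi * real i + 2 * pi * real k) = pt (i + k)" for k by (simp add: pt_def algebra_simps)
  then show ?thesis
    using \<gamma>_bij[of "2 * pi * real i"] \<phi>_pt[of i] by (simp add: pt_def[of i, symmetric])
qed

lemma pt_bij0: "bij_betw pt {..<n} (fibre (\<phi> (pt 0)))"
  using pt_bij[of 0] by simp

text \<open>Two points that stay k turns apart while moving along \<gamma> trace a connected subset
  of the cover containing both pairs. Hence coefficients depend only on the difference of the
  indices.\<close>

lemma pt_path_component:
  obtains K where "K \<in> components cover" "(pt (i + k), pt i) \<in> K" "(pt k, pt 0) \<in> K"
proof -
  define C where "C = range (\<lambda>t. (\<gamma> (t + 2 * pi * real k), \<gamma> t))"
  have "connected C"
    unfolding C_def
    by (intro connected_continuous_image continuous_on_Pair \<gamma>_cont connected_UNIV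
        continuous_on_compose2[OF \<gamma>_cont] continuous_intros) auto
  moreover have sub: "C \<subseteq> cover"
  proof
    fix p assume "p \<in> C"
    then obtain t where t: "p = (\<gamma> (t + 2 * pi * real k), \<gamma> t)" by (auto simp: C_def)
    show "p \<in> cover"
      unfolding t cover_iff using \<gamma>_regular regular_pointsD(1)[OF \<gamma>_regular] \<gamma>_fibre_nat
      by (simp add: fibre_def)
  qed
  moreover have "cover \<noteq> {}" using sub by (auto simp: C_def)
  ultimately obtain K where K: "K \<in> components cover" "C \<subseteq> K" using exists_component_superset by metis
  have "(pt (i + k), pt i) = (\<gamma> (2 * pi * real i + 2 * pi * real k), \<gamma> (2 * pi * real i))"
    by (simp add: pt_def algebra_simps)
  then have "(pt (i + k), pt i) \<in> C" unfolding C_def by blast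
  moreover have "(pt k, pt 0) = (\<gamma> (0 + 2 * pi * real k), \<gamma> 0)" by (simp add: pt_def)
  then have "(pt k, pt 0) \<in> C" unfolding C_def by blast
  ultimately show ?thesis using that K by blast
qed

lemma coef_circulant: "T \<in> A_phi \<phi> \<Longrightarrow> coef T (pt (i + k), pt i) = coef T (pt k, pt 0)"
  using coef_constant_on_component pt_path_component[of i k] by metis

text \<open>On the quotients f / \<phi>' along the cycle the operator acts by its circulant matrix,
  written as a cyclic correlation with the row of \<open>pt 0\<close>.\<close>

lemma A_phi_pt:
  assumes T: "T \<in> A_phi \<phi>"
  shows "Rep_bergman (T f) (pt i) / deriv \<phi> (pt i)
    = (\<Sum>k<n. coef T (pt k, pt 0) * (Rep_bergman f (pt (i + k)) / deriv \<phi> (pt (i + k))))"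
proof -
  have "Rep_bergman (T f) (pt i) / deriv \<phi> (pt i)
    = (\<Sum>v\<in>fibre (\<phi> (pt 0)). coef T (v, pt i) * (Rep_bergman f v / deriv \<phi> v))"
    using coef_repr[OF T pt_regular, of f i] by (simp only: \<phi>_pt[of i])
  also have "\<dots> = (\<Sum>k<n. coef T (pt (i + k), pt i) * (Rep_bergman f (pt (i + k)) / deriv \<phi> (pt (i + k))))"
    by (rule sum.reindex_bij_betw[OF pt_bij, symmetric])
  finally show ?thesis by (simp only: coef_circulant[OF T])
qed

text \<open>Every component has a point over \<open>pt 0\<close>, so the row of \<open>pt 0\<close>
  contains the constant value on each component.\<close>

lemma A_phi_eqI_pt:
  assumes S: "S \<in> A_phi \<phi>" and T: "T \<in> A_phi \<phi>"
    and eq: "\<And>k. k < n \<Longrightarrow> coef S (pt k, pt 0) = coef T (pt k, pt 0)"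
  shows "S = T"
proof (rule A_phi_eqI[OF S T])
  fix p assume p: "p \<in> cover"
  then obtain K where K: "K \<in> components cover" "p \<in> K"
    using Union_components by (metis UnionE)
  obtain w where w: "(w, pt 0) \<in> K" using component_meets_fibre[OF K(1) pt_regular] by metis
  then have "(w, pt 0) \<in> cover" using in_components_subset[OF K(1)] by blast
  then have "w \<in> fibre (\<phi> (pt 0))" by (simp add: cover_iff)
  then obtain k where k: "k < n" "w = pt k" using pt_bij0 by (metis bij_betw_imp_surj_on imageE lessThan_iff)
  have "coef S p = coef S (pt k, pt 0)" "coef T p = coef T (pt k, pt 0)"
    using coef_constant_on_component[OF _ K(1) K(2)] S T w k(2) by auto
  then show "coef S p = coef T p" using eq[OF k(1)] by simp
qed

lemma interpolation_pt:
  obtains f where "\<And>k. k < n \<Longrightarrow> Rep_bergman f (pt k) / deriv \<phi> (pt k) = c k"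
proof -
  have sub: "fibre (\<phi> (pt 0)) \<subseteq> unit_disk" by (auto simp: fibre_def)
  have mem: "pt k \<in> fibre (\<phi> (pt 0))" if "k < n" for k using bij_betw_apply[OF pt_bij0] that by simp
  have "\<exists>h. Rep_bergman h (pt k) = 1 \<and> (\<forall>w\<in>fibre (\<phi> (pt 0)). w \<noteq> pt k \<longrightarrow> Rep_bergman h w = 0)" if "k < n" for k
    using bergman_interpolation[OF regular_pointsD(5)[OF pt_regular] mem[OF that] sub] by metis
  then obtain h where h: "\<And>k. k < n \<Longrightarrow> Rep_bergman (h k) (pt k) = 1"
    "\<And>k w. k < n \<Longrightarrow> w \<in> fibre (\<phi> (pt 0)) \<Longrightarrow> w \<noteq> pt k \<Longrightarrow> Rep_bergman (h k) w = 0" by metis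
  define f where "f = (\<Sum>k<n. cscale (c k * deriv \<phi> (pt k)) (h k))"
  have "Rep_bergman f (pt j) / deriv \<phi> (pt j) = c j" if j: "j < n" for j
  proof -
    have "Rep_bergman f (pt j) = (\<Sum>k<n. if k = j then c j * deriv \<phi> (pt j) else 0)"
      unfolding f_def Rep_bergman_sum
    proof (rule sum.cong[OF refl])
      fix k assume k: "k \<in> {..<n}"
      have "pt j \<noteq> pt k" if "k \<noteq> j"
        using bij_betw_imp_inj_on[OF pt_bij0] that k j by (auto simp: inj_on_def)
      then show "Rep_bergman (cscale (c k * deriv \<phi> (pt k)) (h k)) (pt j) = (if k = j then c j * deriv \<phi> (pt j) else 0)"
        using h(1)[of k] h(2)[of k "pt j"] mem[OF j] k by (auto simp: Rep_cscale)
    qed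
    then show ?thesis using j deriv_nonzero[OF pt_regular] by simp
  qed
  then show ?thesis using that by blast
qed

definition \<omega> :: complex where "\<omega> = cis (2 * pi / real n)"

lemma \<omega>_power_n: "\<omega> ^ n = 1"
  using n by (simp add: \<omega>_def Complex.DeMoivre)

text \<open>A geometric sum over powers of an n-th root of unity, which is 1 only if the two indices
  agree modulo n.\<close>

lemma \<omega>_orthogonal:
  assumes "j < n" "k < n"
  shows "(\<Sum>m<n. cnj (\<omega> ^ (m * j)) * \<omega> ^ (m * k)) = (if j = k then of_nat n else 0)"
proof -
  define x where "x = cnj (\<omega> ^ j) * \<omega> ^ k"
  have x_cis: "x = cis (2 * pi / real n * (real k - real j))"
    by (simp add: x_def \<omega>_def Complex.DeMoivre cis_cnj cis_mult algebra_simps diff_divide_distrib)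
  have "(\<Sum>m<n. cnj (\<omega> ^ (m * j)) * \<omega> ^ (m * k)) = (\<Sum>m<n. x ^ m)"
    by (simp add: x_def power_mult_distrib power_mult[symmetric] mult.commute)
  also have "\<dots> = (if j = k then of_nat n else 0)"
  proof (cases "j = k")
    case True
    then show ?thesis by (simp add: x_cis)
  next
    case False
    have "x \<noteq> 1"
    proof
      assume "x = 1"
      then have "cos (2 * pi / real n * (real k - real j)) = 1" by (simp add: x_cis complex_eq_iff)
      then obtain i :: int where "2 * pi / real n * (real k - real j) = of_int i * 2 * pi"
        using cos_one_2pi_int by blast
      then have "pi * (real k - real j) = pi * (of_int i * real n)" using n by (simp add: field_simps)
      then have "real_of_int (int k - int j) = real_of_int (i * int n)" by simp
      then have "int k = int j + i * int n" by linarith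
      then have "int k mod int n = int j mod int n" by simp
      then show False using assms False by simp
    qed
    moreover have "x ^ n = 1"
    proof -
      have p: "(\<omega> ^ i) ^ n = 1" for i by (metis \<omega>_power_n mult.commute power_mult power_one)
      show ?thesis by (simp only: x_def power_mult_distrib complex_cnj_power[symmetric] p complex_cnj_one mult_1)
    qed
    ultimately show ?thesis using False by (simp add: geometric_sum)
  qed
  finally show ?thesis .
qed

text \<open>The quotients of this function along the cycle form the m-th character of the cyclic
  group. Only its values on one fibre are prescribed; it need not be an eigenvector of the operators
  in the Bergman space.\<close>

definition mode :: "nat \<Rightarrow> bergman"
  where "mode m = (SOME f. \<forall>k<n. Rep_bergman f (pt k) / deriv \<phi> (pt k) = \<omega> ^ (m * k))"

lemma mode_pt: "Rep_bergman (mode m) (pt k) / deriv \<phi> (pt k) = \<omega> ^ (m * k)"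
proof -
  have "\<exists>f. \<forall>k<n. Rep_bergman f (pt k) / deriv \<phi> (pt k) = \<omega> ^ (m * k)"
    using interpolation_pt[of "\<lambda>k. \<omega> ^ (m * k)"] by metis
  then have "\<forall>k<n. Rep_bergman (mode m) (pt k) / deriv \<phi> (pt k) = \<omega> ^ (m * k)"
    unfolding mode_def by (rule someI_ex)
  then have "Rep_bergman (mode m) (pt (k mod n)) / deriv \<phi> (pt (k mod n)) = \<omega> ^ (m * (k mod n))"
    using n by simp
  \<comment> \<open>The character has period n, which extends the interpolation from k < n to all
    k.\<close>
  moreover have "\<omega> ^ (m * (k mod n)) = \<omega> ^ (m * k)"
  proof -
    have "\<omega> ^ (m * k) = \<omega> ^ (m * (k mod n)) * (\<omega> ^ n) ^ (m * (k div n))"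
      by (metis mult_div_mod_eq power_add power_mult distrib_left mult.left_commute add.commute)
    then show ?thesis by (simp add: \<omega>_power_n)
  qed
  ultimately show ?thesis by (simp add: pt_mod)
qed

text \<open>The Fourier coefficients of the circulant matrix of \<open>T\<close> are its joint eigenvalues.\<close>

definition eigval :: "nat \<Rightarrow> (bergman \<Rightarrow> bergman) \<Rightarrow> complex"
  where "eigval m T = Rep_bergman (T (mode m)) (pt 0) / deriv \<phi> (pt 0)"

lemma eigval_eq:
  assumes "T \<in> A_phi \<phi>"
  shows "eigval m T = (\<Sum>k<n. coef T (pt k, pt 0) * \<omega> ^ (m * k))"
  unfolding eigval_def A_phi_pt[OF assms] by (simp only: add_0 mode_pt)

text \<open>Characters are eigenvectors of circulant matrices; the relation is one between values on
  the cycle.\<close>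

lemma mode_eigen:
  assumes T: "T \<in> A_phi \<phi>"
  shows "Rep_bergman (T (mode m)) (pt i) / deriv \<phi> (pt i) = \<omega> ^ (m * i) * eigval m T"
  unfolding A_phi_pt[OF T, of _ i] eigval_eq[OF T] mode_pt sum_distrib_left
  by (rule sum.cong) (simp_all add: distrib_left power_add mult_ac)

text \<open>On the cycle T (mode m) agrees with a multiple of \<open>mode m\<close>, and the value
  of S at \<open>pt 0\<close> depends on nothing else.\<close>

lemma eigval_comp:
  assumes S: "S \<in> A_phi \<phi>" and T: "T \<in> A_phi \<phi>"
  shows "eigval m (S \<circ> T) = eigval m S * eigval m T"
proof -
  have "eigval m (S \<circ> T) = (\<Sum>k<n. coef S (pt k, pt 0)
      * (Rep_bergman (T (mode m)) (pt (0 + k)) / deriv \<phi> (pt (0 + k))))"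
    unfolding eigval_def comp_apply by (rule A_phi_pt[OF S])
  also have "\<dots> = (\<Sum>k<n. coef S (pt k, pt 0) * (\<omega> ^ (m * k) * eigval m T))"
    by (simp only: add_0 mode_eigen[OF T])
  finally show ?thesis unfolding eigval_eq[OF S] by (simp add: sum_distrib_right mult.assoc)
qed

lemma eigval_lincomb: "eigval m (\<lambda>f. cscale c (S f) + cscale d (T f)) = c * eigval m S + d * eigval m T"
  by (simp add: eigval_def Rep_bergman_simps add_divide_distrib)

lemma eigval_sum: "eigval m (\<lambda>f. \<Sum>i\<in>I. cscale (c i) (T i f)) = (\<Sum>i\<in>I. c i * eigval m (T i))"
  by (simp add: eigval_def Rep_bergman_sum Rep_cscale sum_divide_distrib)

lemma eigval_id: "eigval m id = 1"
  using mode_pt[of m 0] by (simp add: eigval_def)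

text \<open>The inverse discrete Fourier transform recovers the row of coefficients from the
  eigenvalues.\<close>

lemma eigval_determines:
  assumes S: "S \<in> A_phi \<phi>" and T: "T \<in> A_phi \<phi>" and eq: "\<And>m. m < n \<Longrightarrow> eigval m S = eigval m T"
  shows "S = T"
proof (rule A_phi_eqI_pt[OF S T])
  have inv: "(\<Sum>m<n. cnj (\<omega> ^ (m * j)) * eigval m T) = of_nat n * coef T (pt j, pt 0)"
    if T: "T \<in> A_phi \<phi>" and j: "j < n" for T j
  proof -
    have "(\<Sum>m<n. cnj (\<omega> ^ (m * j)) * eigval m T)
        = (\<Sum>m<n. \<Sum>k<n. coef T (pt k, pt 0) * (cnj (\<omega> ^ (m * j)) * \<omega> ^ (m * k)))"
      unfolding eigval_eq[OF T] sum_distrib_left by (simp add: mult_ac)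
    also have "\<dots> = (\<Sum>k<n. coef T (pt k, pt 0) * (\<Sum>m<n. cnj (\<omega> ^ (m * j)) * \<omega> ^ (m * k)))"
      unfolding sum_distrib_left by (rule sum.swap)
    also have "\<dots> = (\<Sum>k<n. if k = j then coef T (pt j, pt 0) * of_nat n else 0)"
    proof (rule sum.cong[OF refl])
      fix k assume "k \<in> {..<n}"
      then have "k < n" by simp
      show "coef T (pt k, pt 0) * (\<Sum>m<n. cnj (\<omega> ^ (m * j)) * \<omega> ^ (m * k))
          = (if k = j then coef T (pt j, pt 0) * of_nat n else 0)"
        unfolding \<omega>_orthogonal[OF j \<open>k < n\<close>] by auto
    qed
    also have "\<dots> = of_nat n * coef T (pt j, pt 0)" using j by simp
    finally show ?thesis .
  qed
  fix k assume k: "k < n"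
  have "of_nat n * coef S (pt k, pt 0) = of_nat n * coef T (pt k, pt 0)"
    unfolding inv[OF S k, symmetric] inv[OF T k, symmetric] by (simp add: eq)
  then show "coef S (pt k, pt 0) = coef T (pt k, pt 0)" using n by simp
qed

lemma A_phi_commute:
  assumes S: "S \<in> A_phi \<phi>" and T: "T \<in> A_phi \<phi>"
  shows "S \<circ> T = T \<circ> S"
  by (rule eigval_determines) (simp_all add: A_phi_comp S T eigval_comp mult.commute)

text \<open>The quotient of f0 is 1 at \<open>pt 0\<close> and 0 at the other points of the fibre,
  so T f0 displays the whole row of coefficients: entry k appears at the point n - k, from which k
  turns lead back to \<open>pt 0\<close>. Operators can thereby be replaced by vectors when
  dimensions are counted.\<close>

lemma separating_vector:
  obtains f0 where "\<And>S T. S \<in> A_phi \<phi> \<Longrightarrow> T \<in> A_phi \<phi> \<Longrightarrow> S f0 = T f0 \<Longrightarrow> S = T"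
proof -
  obtain f0 where f0: "\<And>k. k < n \<Longrightarrow> Rep_bergman f0 (pt k) / deriv \<phi> (pt k) = (if k = 0 then 1 else 0)"
    using interpolation_pt[of "\<lambda>k. if k = 0 then 1 else 0"] by metis
  have val: "coef T (pt k, pt 0) = Rep_bergman (T f0) (pt (n - k)) / deriv \<phi> (pt (n - k))"
    if T: "T \<in> A_phi \<phi>" and k: "k < n" for T k
  proof -
    have "Rep_bergman (T f0) (pt (n - k)) / deriv \<phi> (pt (n - k))
        = (\<Sum>j<n. if j = k then coef T (pt k, pt 0) else 0)"
      unfolding A_phi_pt[OF T, of f0]
    proof (rule sum.cong[OF refl])
      fix j assume j: "j \<in> {..<n}"
      have "Rep_bergman f0 (pt (n - k + j)) / deriv \<phi> (pt (n - k + j)) = (if (n - k + j) mod n = 0 then 1 else 0)"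
        using f0[of "(n - k + j) mod n"] n by (simp add: pt_mod)
      \<comment> \<open>For j < k the index n - k + j lies strictly between 0 and n; for k = 0 the
        point is \<open>pt n\<close>, which is \<open>pt 0\<close>.\<close>
      moreover have "(n - k + j) mod n = 0 \<longleftrightarrow> j = k"
      proof (cases "k \<le> j")
        case True
        then have "n - k + j = n + (j - k)" using k by simp
        moreover have "j - k < n" using j by auto
        ultimately have "(n - k + j) mod n = j - k" by simp
        then show ?thesis using True by auto
      next
        case False
        then have "(n - k + j) mod n = n - k + j" using j k by simp
        then show ?thesis using False k by auto
      qed
      ultimately show "coef T (pt j, pt 0) * (Rep_bergman f0 (pt (n - k + j)) / deriv \<phi> (pt (n - k + j)))
          = (if j = k then coef T (pt k, pt 0) else 0)" by auto
    qed
    then show ?thesis using k by simp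
  qed
  show ?thesis
    by (rule that[of f0]) (rule A_phi_eqI_pt, auto simp: val)
qed

section \<open>Minimal idempotents and minimal reducing subspaces\<close>

definition block_equiv :: "nat \<Rightarrow> nat \<Rightarrow> bool"
  where "block_equiv m m' \<longleftrightarrow> (\<forall>T\<in>A_phi \<phi>. eigval m T = eigval m' T)"

text \<open>A transversal of least indices: it enumerates the distinct functionals among the n
  Fourier coefficients.\<close>

definition block_reps :: "nat set"
  where "block_reps = {r. r < n \<and> (\<forall>m<r. \<not> block_equiv m r)}"

lemma finite_block_reps: "finite block_reps"
  by (rule finite_subset[of _ "{..<n}"]) (auto simp: block_reps_def)

lemma block_rep_exists:
  assumes "m < n"
  obtains r where "r \<in> block_reps" "block_equiv r m"
proof -
  define r where "r = (LEAST r. block_equiv r m)"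
  have refl: "block_equiv m m" by (simp add: block_equiv_def)
  have r: "block_equiv r m" "r \<le> m"
    unfolding r_def by (rule LeastI[of "\<lambda>r. block_equiv r m", OF refl], rule Least_le[of "\<lambda>r. block_equiv r m", OF refl])
  have "\<not> block_equiv k r" if "k < r" for k
  proof
    assume "block_equiv k r"
    then have "block_equiv k m" using r(1) by (simp add: block_equiv_def)
    then show False using not_less_Least that unfolding r_def by blast
  qed
  then have "r \<in> block_reps" using r(2) assms unfolding block_reps_def by auto
  then show ?thesis using that r(1) by blast
qed

lemma eigval_injective:
  assumes S: "S \<in> A_phi \<phi>" and T: "T \<in> A_phi \<phi>"
    and eq: "\<And>r. r \<in> block_reps \<Longrightarrow> eigval r S = eigval r T"
  shows "S = T"
proof (rule eigval_determines[OF S T])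
  fix m assume "m < n"
  then obtain r where r: "r \<in> block_reps" "block_equiv r m" by (rule block_rep_exists)
  then show "eigval m S = eigval m T" using eq[OF r(1)] S T by (simp add: block_equiv_def)
qed

text \<open>Distinct functionals differ at some T, and the affine function of T that takes the two
  values to 1 and 0 separates them.\<close>

lemma separating_operator:
  assumes r: "r \<in> block_reps" and r': "r' \<in> block_reps" "r' \<noteq> r"
  obtains L where "L \<in> A_phi \<phi>" "eigval r L = 1" "eigval r' L = 0"
proof -
  \<comment> \<open>Minimality of a representative only compares it with smaller indices, so the
    order of r and r' decides which alternative holds.\<close>
  have "\<not> block_equiv r r' \<or> \<not> block_equiv r' r"
    using r r' by (auto simp: block_reps_def linorder_neq_iff)
  then obtain T where T: "T \<in> A_phi \<phi>" "eigval r T \<noteq> eigval r' T"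
    unfolding block_equiv_def by metis
  define d where "d = eigval r T - eigval r' T"
  have d: "d \<noteq> 0" using T by (simp add: d_def)
  show ?thesis
  proof (rule that)
    show "(\<lambda>f. cscale (1 / d) (T f) + cscale (- eigval r' T / d) (id f)) \<in> A_phi \<phi>"
      by (intro A_phi_lincomb T(1) A_phi_id)
    show "eigval r (\<lambda>f. cscale (1 / d) (T f) + cscale (- eigval r' T / d) (id f)) = 1"
      unfolding eigval_lincomb eigval_id using d by (simp add: diff_divide_distrib[symmetric] d_def)
    show "eigval r' (\<lambda>f. cscale (1 / d) (T f) + cscale (- eigval r' T / d) (id f)) = 0"
      unfolding eigval_lincomb eigval_id by simp
  qed
qed

text \<open>Lagrange interpolation in the algebra: a product of separating operators, one for each
  other block, takes the value 1 at r and 0 at the others because the functionals are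
  multiplicative.\<close>

lemma block_projection_exists:
  assumes r: "r \<in> block_reps"
  shows "\<exists>P\<in>A_phi \<phi>. \<forall>s\<in>block_reps. eigval s P = (if s = r then 1 else 0)"
proof -
  have "\<exists>P\<in>A_phi \<phi>. eigval r P = 1 \<and> (\<forall>s\<in>F. eigval s P = 0)" if "finite F" "F \<subseteq> block_reps - {r}" for F
    using that
  proof (induction F)
    case empty
    show ?case using A_phi_id eigval_id by blast
  next
    case (insert s F)
    then obtain P where P: "P \<in> A_phi \<phi>" "eigval r P = 1" "\<forall>s\<in>F. eigval s P = 0" by auto
    have "s \<in> block_reps" "s \<noteq> r" using insert.prems by auto
    then obtain L where L: "L \<in> A_phi \<phi>" "eigval r L = 1" "eigval s L = 0"
      using separating_operator[OF r] by metis
    show ?case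
    proof (rule bexI)
      show "L \<circ> P \<in> A_phi \<phi>" by (rule A_phi_comp[OF L(1) P(1)])
      show "eigval r (L \<circ> P) = 1 \<and> (\<forall>q\<in>insert s F. eigval q (L \<circ> P) = 0)"
        unfolding eigval_comp[OF L(1) P(1)] using P L by simp
    qed
  qed
  from this[of "block_reps - {r}"] finite_block_reps
  obtain P where "P \<in> A_phi \<phi>" "eigval r P = 1" "\<forall>s\<in>block_reps - {r}. eigval s P = 0" by auto
  then show ?thesis by (intro bexI[of _ P]) auto
qed

definition block_proj :: "nat \<Rightarrow> bergman \<Rightarrow> bergman"
  where "block_proj r = (SOME P. P \<in> A_phi \<phi> \<and> (\<forall>s\<in>block_reps. eigval s P = (if s = r then 1 else 0)))"

lemma block_proj:
  assumes "r \<in> block_reps"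
  shows "block_proj r \<in> A_phi \<phi>" "\<And>s. s \<in> block_reps \<Longrightarrow> eigval s (block_proj r) = (if s = r then 1 else 0)"
proof -
  have "\<exists>P. P \<in> A_phi \<phi> \<and> (\<forall>s\<in>block_reps. eigval s P = (if s = r then 1 else 0))"
    using block_projection_exists[OF assms] by blast
  from someI_ex[OF this, folded block_proj_def]
  show "block_proj r \<in> A_phi \<phi>" "\<And>s. s \<in> block_reps \<Longrightarrow> eigval s (block_proj r) = (if s = r then 1 else 0)"
    by blast+
qed

text \<open>The algebra is a finite product of copies of the complex numbers, with the block
  projections as coordinate idempotents.\<close>

lemma A_phi_decomposition:
  assumes T: "T \<in> A_phi \<phi>"
  shows "T = (\<lambda>f. \<Sum>r\<in>block_reps. cscale (eigval r T) (block_proj r f))"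
proof (rule eigval_injective[OF T])
  show "(\<lambda>f. \<Sum>r\<in>block_reps. cscale (eigval r T) (block_proj r f)) \<in> A_phi \<phi>"
    by (rule A_phi_sum[OF finite_block_reps block_proj(1)])
  fix s assume s: "s \<in> block_reps"
  have "(\<Sum>r\<in>block_reps. eigval r T * eigval s (block_proj r)) = (\<Sum>r\<in>block_reps. if r = s then eigval s T else 0)"
    by (rule sum.cong) (auto simp: block_proj(2)[OF _ s])
  then show "eigval s T = eigval s (\<lambda>f. \<Sum>r\<in>block_reps. cscale (eigval r T) (block_proj r f))"
    unfolding eigval_sum using s finite_block_reps by simp
qed

lemma block_proj_comp:
  assumes r: "r \<in> block_reps" and s: "s \<in> block_reps"
  shows "block_proj r (block_proj s f) = (if r = s then block_proj r f else 0)"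
proof (cases "r = s")
  case True
  have "block_proj r \<circ> block_proj r = block_proj r"
    by (rule eigval_injective) (simp_all add: A_phi_comp block_proj[OF r] eigval_comp)
  then show ?thesis using True by (metis comp_apply)
next
  case False
  have z: "(\<lambda>f. cscale 0 (id f) + cscale 0 (id f)) \<in> A_phi \<phi>" by (intro A_phi_lincomb A_phi_id)
  have "block_proj r \<circ> block_proj s = (\<lambda>f. cscale 0 (id f) + cscale 0 (id f))"
  proof (rule eigval_injective[OF A_phi_comp[OF block_proj(1)[OF r] block_proj(1)[OF s]] z])
    show "eigval q (block_proj r \<circ> block_proj s) = eigval q (\<lambda>f. cscale 0 (id f) + cscale 0 (id f))"
      if "q \<in> block_reps" for q
      unfolding eigval_lincomb eigval_comp[OF block_proj(1)[OF r] block_proj(1)[OF s]]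
      using False that by (simp add: block_proj(2)[OF r] block_proj(2)[OF s])
  qed
  then have "(block_proj r \<circ> block_proj s) f = 0" by simp
  then show ?thesis using False by simp
qed

definition block_space :: "nat \<Rightarrow> bergman set"
  where "block_space r = {f. block_proj r f = f}"

text \<open>The projection does not kill \<open>mode r\<close>, since the image shows the eigenvalue
  1 at \<open>pt 0\<close>.\<close>

lemma block_space_nontrivial:
  assumes r: "r \<in> block_reps"
  obtains f where "f \<in> block_space r" "f \<noteq> 0"
proof -
  have "block_proj r (mode r) \<noteq> 0"
  proof
    assume "block_proj r (mode r) = 0"
    then have "eigval r (block_proj r) = 0" by (simp add: eigval_def Rep_zero_bergman)
    then show False using block_proj(2)[OF r r] by simp
  qed
  moreover have "block_proj r (mode r) \<in> block_space r"
    by (simp add: block_space_def block_proj_comp[OF r r])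
  ultimately show ?thesis using that by blast
qed

lemma reducing_block_space:
  assumes r: "r \<in> block_reps"
  shows "reducing_subspace M (block_space r)"
proof -
  let ?P = "block_proj r"
  have P: "bounded_clinear ?P" "?P \<circ> M = M \<circ> ?P" "?P \<circ> cadjoint M = cadjoint M \<circ> ?P"
    using block_proj(1)[OF r] by (simp_all add: A_phi_iff)
  have bl: "bounded_linear ?P" using P(1) by (simp add: bounded_clinear_def)
  have "csubspace (block_space r)"
    unfolding csubspace_def subspace_def block_space_def
    using P(1) bl by (auto simp: bounded_clinear_add bounded_clinear_cscale linear_simps)
  moreover have "closed (block_space r)"
    unfolding block_space_def by (intro closed_Collect_eq linear_continuous_on bl continuous_on_id)
  moreover have "?P (M f) = M (?P f)" "?P (cadjoint M f) = cadjoint M (?P f)" for f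
    using P(2,3) by (metis comp_apply)+
  then have "M ` block_space r \<subseteq> block_space r" "cadjoint M ` block_space r \<subseteq> block_space r"
    by (auto simp: block_space_def)
  ultimately show ?thesis by (simp add: reducing_subspace_def)
qed

lemma zero_in_reducing: "reducing_subspace M N \<Longrightarrow> 0 \<in> N"
  by (simp add: reducing_subspace_def csubspace_def subspace_0)

text \<open>The projection P onto N is an idempotent of the algebra, so every functional is 0 or 1
  on it. Not all vanish because N is nonzero, and the value 1 at r makes P act as the identity on
  the block space of r.\<close>

lemma reducing_contains_block:
  assumes N: "reducing_subspace M N" and nz: "N \<noteq> {0}"
  obtains r where "r \<in> block_reps" "block_space r \<subseteq> N"
proof -
  obtain P where P: "P \<in> A_phi \<phi>" "\<And>f. P f \<in> N" "\<And>f. f \<in> N \<Longrightarrow> P f = f"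
    using projection_in_A_phi[OF N] by metis
  have "P \<circ> P = P" using P(2,3) by auto
  then have idem: "eigval r P * eigval r P = eigval r P" for r
    using eigval_comp[OF P(1) P(1)] by metis
  obtain r where r: "r \<in> block_reps" "eigval r P \<noteq> 0"
  proof (rule ccontr)
    assume "\<not> thesis"
    then have "eigval r P = 0" if "r \<in> block_reps" for r using that \<open>\<And>r. \<lbrakk>r \<in> block_reps; eigval r P \<noteq> 0\<rbrakk> \<Longrightarrow> thesis\<close> by blast
    then have "P f = 0" for f by (subst A_phi_decomposition[OF P(1)]) simp
    then have "N = {0}" using P(3) zero_in_reducing[OF N] by force
    then show False using nz by simp
  qed
  have r1: "eigval r P = 1" using idem[of r] r(2) by simp
  have "P \<circ> block_proj r = block_proj r"
  proof (rule eigval_injective[OF A_phi_comp[OF P(1) block_proj(1)[OF r(1)]] block_proj(1)[OF r(1)]])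
    show "eigval s (P \<circ> block_proj r) = eigval s (block_proj r)" if "s \<in> block_reps" for s
      unfolding eigval_comp[OF P(1) block_proj(1)[OF r(1)]] using r1 by (simp add: block_proj(2)[OF r(1) that])
  qed
  then have fixed: "P (block_proj r f) = block_proj r f" for f by (metis comp_apply)
  have "f \<in> N" if "f \<in> block_space r" for f
    using that P(2)[of f] fixed[of f] unfolding block_space_def by auto
  then show ?thesis using that r(1) by blast
qed

lemma block_space_subset_imp_eq:
  assumes r: "r \<in> block_reps" and s: "s \<in> block_reps" and sub: "block_space r \<subseteq> block_space s"
  shows "r = s"
proof (rule ccontr)
  assume ne: "r \<noteq> s"
  obtain f where f: "f \<in> block_space r" "f \<noteq> 0" using block_space_nontrivial[OF r] by metis
  then have "block_proj s f = f" "block_proj r f = f" using sub by (auto simp: block_space_def)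
  then have "block_proj s (block_proj r f) = f" by simp
  then show False using block_proj_comp[OF s r, of f] ne f(2) by simp
qed

text \<open>A minimal N contains a block space and hence equals it. Conversely, a nonzero reducing
  subspace inside a block space contains some block space, which can only be the same one.\<close>

lemma minimal_reducing_iff:
  "minimal_reducing_subspace M N \<longleftrightarrow> N \<in> block_space ` block_reps"
proof
  assume N: "minimal_reducing_subspace M N"
  then have red: "reducing_subspace M N" "N \<noteq> {0}" by (simp_all add: minimal_reducing_subspace_def)
  obtain r where r: "r \<in> block_reps" "block_space r \<subseteq> N" using reducing_contains_block[OF red] by metis
  have "block_space r \<noteq> {0}" using block_space_nontrivial[OF r(1)] by (metis singletonD)
  then have "block_space r = N"
    using N reducing_block_space[OF r(1)] r(2) unfolding minimal_reducing_subspace_def by blast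
  then show "N \<in> block_space ` block_reps" using r(1) by blast
next
  assume "N \<in> block_space ` block_reps"
  then obtain r where r: "r \<in> block_reps" "N = block_space r" by blast
  have "block_space r \<noteq> {0}" using block_space_nontrivial[OF r(1)] by (metis singletonD)
  moreover have "N' = block_space r \<or> N' = {0}" if N': "reducing_subspace M N'" "N' \<subseteq> block_space r" for N'
  proof (cases "N' = {0}")
    case False
    obtain s where s: "s \<in> block_reps" "block_space s \<subseteq> N'" using reducing_contains_block[OF N'(1) False] by metis
    then have "s = r" using block_space_subset_imp_eq[OF s(1) r(1)] N'(2) by blast
    then show ?thesis using s(2) N'(2) by blast
  qed simp
  ultimately show "minimal_reducing_subspace M N"
    unfolding minimal_reducing_subspace_def r(2) using reducing_block_space[OF r(1)] by blast
qed

section \<open>Counting components and blocks\<close>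

lemma finite_components: "finite (components cover)"
proof -
  have "\<exists>k. k < n \<and> (pt k, pt 0) \<in> K" if K: "K \<in> components cover" for K
  proof -
    obtain w where w: "(w, pt 0) \<in> K" using component_meets_fibre[OF K pt_regular] by metis
    then have "(w, pt 0) \<in> cover" using in_components_subset[OF K] by blast
    then have "w \<in> fibre (\<phi> (pt 0))" by (simp add: cover_iff)
    then show ?thesis using w pt_bij0 by (metis bij_betw_imp_surj_on imageE lessThan_iff)
  qed
  \<comment> \<open>A component is identified by one of its points over \<open>pt 0\<close>:
    different components are disjoint, so at most n of them exist.\<close>
  then obtain k where k: "\<And>K. K \<in> components cover \<Longrightarrow> k K < n \<and> (pt (k K), pt 0) \<in> K" by metis
  have "inj_on k (components cover)"
  proof (rule inj_onI)
    fix K L assume KL: "K \<in> components cover" "L \<in> components cover" "k K = k L"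
    then have "K \<inter> L \<noteq> {}" using k by (metis IntI emptyE)
    then show "K = L" using components_eq[OF KL(1,2)] by blast
  qed
  moreover have "k ` components cover \<subseteq> {..<n}" using k by blast
  ultimately show ?thesis by (meson finite_lessThan inj_on_finite)
qed

text \<open>The coefficient of T is constant on each component and may be read off at an arbitrary
  point of it; the combination of the sheet operators with these constants has the same coefficients
  everywhere.\<close>

lemma A_phi_sheet_decomposition:
  assumes T: "T \<in> A_phi \<phi>"
  shows "\<exists>c. T = (\<lambda>f. \<Sum>K\<in>components cover. cscale (c K) (sheet_op K f))"
proof -
  define c where "c = (\<lambda>K. coef T (SOME p. p \<in> K))"
  have L: "(\<lambda>f. \<Sum>K\<in>components cover. cscale (c K) (sheet_op K f)) \<in> A_phi \<phi>" (is "?L \<in> _")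
    by (rule A_phi_sum[OF finite_components sheet_op_in_A_phi[OF saturated_component]])
  have "T = ?L"
  proof (rule A_phi_eqI[OF T L])
    fix p assume p: "p \<in> cover"
    then obtain K0 where K0: "K0 \<in> components cover" "p \<in> K0" using Union_components by (metis UnionE)
    have "coef ?L p = (\<Sum>K\<in>components cover. c K * coef (sheet_op K) p)"
      by (rule coef_sum[OF finite_components sheet_op_in_A_phi[OF saturated_component] p])
    also have "\<dots> = (\<Sum>K\<in>components cover. if K = K0 then c K0 else 0)"
    proof (rule sum.cong[OF refl])
      fix K assume K: "K \<in> components cover"
      have "p \<in> K \<longleftrightarrow> K = K0" using K0 K components_eq[OF K K0(1)] by blast
      then show "c K * coef (sheet_op K) p = (if K = K0 then c K0 else 0)"
        using coef_sheet_op[OF saturated_component[OF K] p] by simp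
    qed
    also have "\<dots> = c K0" using K0(1) finite_components by simp
    also have "c K0 = coef T p"
      unfolding c_def by (rule coef_constant_on_component[OF T K0(1) someI[of "\<lambda>p. p \<in> K0", OF K0(2)] K0(2)])
    finally show "coef T p = coef ?L p" by simp
  qed
  then show ?thesis by blast
qed

text \<open>Block projections and sheet operators are two bases of the algebra. Evaluation at the
  separating vector f0 carries both injectively into the Bergman space, where the bases can be
  compared as sets of vectors.\<close>

lemma card_block_reps: "card block_reps = card (components cover)"
proof -
  interpret vs: vector_space cscale by (rule vector_space_cscale)
  obtain f0 where f0: "\<And>S T. S \<in> A_phi \<phi> \<Longrightarrow> T \<in> A_phi \<phi> \<Longrightarrow> S f0 = T f0 \<Longrightarrow> S = T"
    using separating_vector by metis
  define u where "u = (\<lambda>r. block_proj r f0)"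
  define v where "v = (\<lambda>K. sheet_op K f0)"
  note sheet_A = sheet_op_in_A_phi[OF saturated_component]
  have zero: "(\<lambda>f. 0) \<in> A_phi \<phi>" using A_phi_sum[of "{}"] by simp
  have inj_u: "inj_on u block_reps"
  proof (rule inj_onI)
    fix r s assume rs: "r \<in> block_reps" "s \<in> block_reps" "u r = u s"
    then have "block_proj r = block_proj s" using f0 block_proj(1) by (simp add: u_def)
    then show "r = s" using block_proj(2)[OF rs(1) rs(1)] block_proj(2)[OF rs(2) rs(1)] by (simp split: if_splits)
  qed
  have inj_v: "inj_on v (components cover)"
  proof (rule inj_onI)
    fix K L assume KL: "K \<in> components cover" "L \<in> components cover" "v K = v L"
    then have eq: "sheet_op K = sheet_op L" using f0 sheet_A by (simp add: v_def)
    obtain p where p: "p \<in> K" using in_components_nonempty[OF KL(1)] by blast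
    then have pc: "p \<in> cover" using in_components_subset[OF KL(1)] by blast
    have "p \<in> L"
      using coef_sheet_op[OF saturated_component[OF KL(1)] pc] coef_sheet_op[OF saturated_component[OF KL(2)] pc] p
      unfolding eq by (simp split: if_splits)
    then show "K = L" using p components_eq[OF KL(1,2)] by blast
  qed
  have ind_u: "vs.independent (u ` block_reps)"
    unfolding vs.dependent_finite[OF finite_imageI[OF finite_block_reps]]
  proof (intro notI, elim exE conjE bexE)
    fix c x assume x: "x \<in> u ` block_reps" "c x \<noteq> 0" and s: "(\<Sum>w\<in>u ` block_reps. cscale (c w) w) = 0"
    obtain s0 where s0: "s0 \<in> block_reps" "x = u s0" using x(1) by blast
    have "(\<Sum>r\<in>block_reps. cscale (c (u r)) (block_proj r f0)) = 0"
      using s by (simp only: sum.reindex[OF inj_u] o_def) (simp only: u_def)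
    \<comment> \<open>By separation the relation at f0 is one between operators of the algebra; the
      functional of s0 then isolates a single coefficient.\<close>
    then have "(\<lambda>f. \<Sum>r\<in>block_reps. cscale (c (u r)) (block_proj r f)) = (\<lambda>f. 0)"
      by (intro f0 A_phi_sum finite_block_reps block_proj(1) zero)
    then have "eigval s0 (\<lambda>f. \<Sum>r\<in>block_reps. cscale (c (u r)) (block_proj r f)) = eigval s0 (\<lambda>f. 0)" by simp
    then have "(\<Sum>r\<in>block_reps. c (u r) * eigval s0 (block_proj r)) = 0"
      unfolding eigval_sum by (simp add: eigval_def Rep_zero_bergman)
    also have "(\<Sum>r\<in>block_reps. c (u r) * eigval s0 (block_proj r)) = (\<Sum>r\<in>block_reps. if r = s0 then c (u s0) else 0)"
      by (rule sum.cong) (auto simp: block_proj(2)[OF _ s0(1)])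
    also have "\<dots> = c x" using s0 finite_block_reps by simp
    finally show False using x(2) by simp
  qed
  have ind_v: "vs.independent (v ` components cover)"
    unfolding vs.dependent_finite[OF finite_imageI[OF finite_components]]
  proof (intro notI, elim exE conjE bexE)
    fix c x assume x: "x \<in> v ` components cover" "c x \<noteq> 0" and s: "(\<Sum>w\<in>v ` components cover. cscale (c w) w) = 0"
    obtain K0 where K0: "K0 \<in> components cover" "x = v K0" using x(1) by blast
    obtain p where p: "p \<in> K0" using in_components_nonempty[OF K0(1)] by blast
    then have pc: "p \<in> cover" using in_components_subset[OF K0(1)] by blast
    have "(\<Sum>K\<in>components cover. cscale (c (v K)) (sheet_op K f0)) = 0"
      using s by (simp only: sum.reindex[OF inj_v] o_def) (simp only: v_def)
    then have "(\<lambda>f. \<Sum>K\<in>components cover. cscale (c (v K)) (sheet_op K f)) = (\<lambda>f. 0)"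
      by (intro f0 A_phi_sum finite_components sheet_A zero)
    \<comment> \<open>The coefficient at a point of K0 isolates the term of K0.\<close>
    then have "coef (\<lambda>f. \<Sum>K\<in>components cover. cscale (c (v K)) (sheet_op K f)) p = coef (\<lambda>f. 0) p" by simp
    also have "coef (\<lambda>f. 0) p = 0" using coef_sum[of "{}" _ p] pc by simp
    also have "coef (\<lambda>f. \<Sum>K\<in>components cover. cscale (c (v K)) (sheet_op K f)) p
        = (\<Sum>K\<in>components cover. c (v K) * coef (sheet_op K) p)"
      by (rule coef_sum[OF finite_components sheet_A pc])
    finally have "(\<Sum>K\<in>components cover. c (v K) * coef (sheet_op K) p) = 0" .
    also have "(\<Sum>K\<in>components cover. c (v K) * coef (sheet_op K) p) = (\<Sum>K\<in>components cover. if K = K0 then c (v K0) else 0)"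
    proof (rule sum.cong[OF refl])
      fix K assume K: "K \<in> components cover"
      have "p \<in> K \<longleftrightarrow> K = K0" using p K K0(1) components_eq[OF K K0(1)] by blast
      then show "c (v K) * coef (sheet_op K) p = (if K = K0 then c (v K0) else 0)"
        using coef_sheet_op[OF saturated_component[OF K] pc] by simp
    qed
    also have "\<dots> = c x" using K0 finite_components by simp
    finally show False using x(2) by simp
  qed
  have sub_u: "u ` block_reps \<subseteq> vs.span (v ` components cover)"
  proof (rule image_subsetI)
    fix r assume r: "r \<in> block_reps"
    obtain c where "block_proj r = (\<lambda>f. \<Sum>K\<in>components cover. cscale (c K) (sheet_op K f))"
      using A_phi_sheet_decomposition[OF block_proj(1)[OF r]] by blast
    then have "u r = (\<Sum>K\<in>components cover. cscale (c K) (v K))" by (simp add: u_def v_def)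
    then show "u r \<in> vs.span (v ` components cover)"
      by (simp add: vs.span_sum vs.span_scale vs.span_base)
  qed
  have sub_v: "v ` components cover \<subseteq> vs.span (u ` block_reps)"
  proof (rule image_subsetI)
    fix K assume K: "K \<in> components cover"
    have "v K = (\<Sum>r\<in>block_reps. cscale (eigval r (sheet_op K)) (u r))"
      unfolding u_def v_def by (subst A_phi_decomposition[OF sheet_A[OF K]]) simp
    then show "v K \<in> vs.span (u ` block_reps)"
      by (simp add: vs.span_sum vs.span_scale vs.span_base)
  qed
  show ?thesis
    by (rule vs.card_eq_of_independent_families[OF finite_block_reps finite_components
          inj_u inj_v ind_u ind_v sub_u sub_v])
qed

end

theorem theorem8p5:
  fixes n :: nat and \<phi> :: "complex \<Rightarrow> complex"
  assumes "1 \<le> n" and "n \<le> 8" and "is_blaschke_product n \<phi>"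
  shows "(\<forall>S\<in>A_phi \<phi>. \<forall>T\<in>A_phi \<phi>. S \<circ> T = T \<circ> S) \<and>
    finite (surface_components \<phi>) \<and>
    finite {M. minimal_reducing_subspace (mult_op \<phi>) M} \<and>
    card {M. minimal_reducing_subspace (mult_op \<phi>) M} = card (surface_components \<phi>)"
proof -
  obtain a where a: "\<And>j. j \<in> {1..n} \<Longrightarrow> a j \<in> unit_disk" "\<phi> = blaschke n a"
    using assms(3) unfolding is_blaschke_product_def by blast
  interpret blaschke_product n a \<phi>
    by unfold_locales (use assms(1) a in auto)
  obtain \<gamma> :: "real \<Rightarrow> complex" where \<gamma>: "continuous_on UNIV \<gamma>" "\<And>t. \<gamma> t \<in> regular_points"
    "\<And>t. \<phi> (\<gamma> (t + 2 * pi)) = \<phi> (\<gamma> t)" "\<And>t. \<gamma> (t + 2 * pi * real n) = \<gamma> t"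
    "\<And>t. bij_betw (\<lambda>k. \<gamma> (t + 2 * pi * real k)) {..<n} (fibre (\<phi> (\<gamma> t)))"
    using boundary_cycle by metis
  interpret blaschke_cycle n a \<phi> \<gamma>
    by unfold_locales (fact \<gamma>)+
  have minimal: "{M. minimal_reducing_subspace (mult_op \<phi>) M} = block_space ` block_reps"
    using minimal_reducing_iff by blast
  have "inj_on block_space block_reps"
    using block_space_subset_imp_eq by (metis inj_onI order_refl)
  then have "card (block_space ` block_reps) = card (components cover)"
    by (simp add: card_image card_block_reps)
  moreover have comps: "surface_components \<phi> = components cover"
    by (simp add: surface_components_def cover_def)
  ultimately show ?thesis
    unfolding minimal comps using finite_components finite_block_reps A_phi_commute by blast
qed

end
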